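(* Let $b>0$ and $A\in\mathcal O^0_e(-b,b)$. Let $F\in C^1(\mathbf H,\mathbb R)$ satisfy the following two conditions. (i) There is a constant $l_F<b$ such that $\|F'(z+h)-F'(z)\|_{\mathbf H}\le l_F\|h\|_{\mathbf H}$ for all $z,h\in\mathbf H$. (ii) There exist $B_1,B_2\in\mathcal L_s(\mathbf H,-b,b)$ and a map $B:\mathbf H\to\mathcal L_s(\mathbf H,-b,b)$ with $$B_1\le B_2,\quad i_A(B_1)=i_A(B_2),\quad \nu_A(B_2)=0,\qquad B_1\le B(z)\le B_2\ \ \forall z\in\mathbf H,$$ such that $F'(z)-B(z)z=o(\|z\|_{\mathbf H})$ as $\|z\|_{\mathbf H}\to\infty$. Then the equation $Az=F'(z)$, $z\in D(A)$, has at least one solution.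
   Context: $\mathbf H$ is an infinite-dimensional separable Hilbert space; $F'$ denotes the gradient of $F$. For $b>0$, $\mathcal O^0_e(-b,b)$ is the set of (possibly unbounded) linear self-adjoint operators $A$ on $\mathbf H$, with domain $D(A)$, such that $\sigma_e(A)\cap(-b,b)=\emptyset$ and $\sigma(A)\cap(-b,b)\neq\emptyset$ ($\sigma_e$ is the essential spectrum). $\mathcal L_s(\mathbf H,-b,b)$ is the set of bounded self-adjoint operators $B$ on $\mathbf H$ with $-bI<B<bI$, where $B<bI$ means that $(b-\delta)I-B$ is positive definite for some $\delta>0$, and $B>-bI$ is understood similarly. $B_1\le B_2$ is the usual order of self-adjoint operators. For $A\in\mathcal O^0_e(-b,b)$ and $B\in\mathcal L_s(\mathbf H,-b,b)$: $\nu_A(B)=\dim\ker(A-B)$, and $i_A(B)\in\mathbb Z$ is the relative Morse index, i.e. the Fredholm index ($\dim\ker-\dim\mathrm{coker}$) of the map $V^-(A-B)\to V^-(A)$ obtained by restricting the orthogonal projection onto $V^-(A)$, where $V^-(S)$ is the range of the spectral projection of a self-adjoint operator $S$ for $(-\infty,0)$. *)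

theory Defs
  imports "HOL-Analysis.Analysis" "HOL-Library.Extended_Nat" "HOL-Library.Landau_Symbols"
begin

text \<open>
  Hilbert spaces are types of class \<open>real_inner\<close> and \<open>complete_space\<close>. An unbounded operator
  is a pair of arguments \<open>D A\<close>: its domain \<open>D\<close> and a total function \<open>A\<close> of which only the
  values on \<open>D\<close> matter.
\<close>

definition finite_dim :: "'a::real_vector set \<Rightarrow> bool" where
  "finite_dim V \<longleftrightarrow> (\<exists>S. finite S \<and> V \<subseteq> span S)"

definition edim :: "'a::real_vector set \<Rightarrow> enat" where
  "edim V = (if finite_dim V then enat (dim V) else \<infinity>)"

section \<open>Unbounded self-adjoint operators and their spectrum\<close>

definition linear_operator :: "'a::real_vector set \<Rightarrow> ('a \<Rightarrow> 'a) \<Rightarrow> bool" where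
  "linear_operator D A \<longleftrightarrow> subspace D
     \<and> (\<forall>x\<in>D. \<forall>y\<in>D. A (x + y) = A x + A y)
     \<and> (\<forall>c. \<forall>x\<in>D. A (c *\<^sub>R x) = c *\<^sub>R A x)"

text \<open>
  \<open>y\<close> is in the domain of the adjoint, with value \<open>z\<close>, iff \<open>A x \<bullet> y = x \<bullet> z\<close> for all \<open>x\<close> in \<open>D\<close>.
  The last two conjuncts say that the adjoint has the domain \<open>D\<close> and agrees with \<open>A\<close> there.
\<close>
definition self_adjoint :: "'a::real_inner set \<Rightarrow> ('a \<Rightarrow> 'a) \<Rightarrow> bool" where
  "self_adjoint D A \<longleftrightarrow> linear_operator D A \<and> closure D = UNIV
     \<and> D = {y. \<exists>z. \<forall>x\<in>D. A x \<bullet> y = x \<bullet> z}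
     \<and> (\<forall>x\<in>D. \<forall>y\<in>D. A x \<bullet> y = x \<bullet> A y)"

text \<open>Only real spectral points are considered: the spectrum of a self-adjoint operator is real.\<close>
definition resolvent_set :: "'a::real_normed_vector set \<Rightarrow> ('a \<Rightarrow> 'a) \<Rightarrow> real set" where
  "resolvent_set D A = {\<mu>. bij_betw (\<lambda>x. A x - \<mu> *\<^sub>R x) D UNIV
     \<and> (\<exists>M. \<forall>x\<in>D. norm x \<le> M * norm (A x - \<mu> *\<^sub>R x))}"

definition spectrum :: "'a::real_normed_vector set \<Rightarrow> ('a \<Rightarrow> 'a) \<Rightarrow> real set" where
  "spectrum D A = - resolvent_set D A"

text \<open>Isolated points of the spectrum that are eigenvalues of finite multiplicity.\<close>
definition discrete_spectrum :: "'a::real_normed_vector set \<Rightarrow> ('a \<Rightarrow> 'a) \<Rightarrow> real set" where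
  "discrete_spectrum D A = {\<mu> \<in> spectrum D A. \<not> \<mu> islimpt spectrum D A
     \<and> {x\<in>D. A x = \<mu> *\<^sub>R x} \<noteq> {0} \<and> finite_dim {x\<in>D. A x = \<mu> *\<^sub>R x}}"

definition essential_spectrum :: "'a::real_normed_vector set \<Rightarrow> ('a \<Rightarrow> 'a) \<Rightarrow> real set" where
  "essential_spectrum D A = spectrum D A - discrete_spectrum D A"

text \<open>\<open>O0e b D A\<close>: the operator belongs to $\mathcal{O}^0_e(-b,b)$.\<close>
definition O0e :: "real \<Rightarrow> 'a::real_inner set \<Rightarrow> ('a \<Rightarrow> 'a) \<Rightarrow> bool" where
  "O0e b D A \<longleftrightarrow> self_adjoint D A
     \<and> essential_spectrum D A \<inter> {-b<..<b} = {} \<and> spectrum D A \<inter> {-b<..<b} \<noteq> {}"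

section \<open>Bounded self-adjoint operators\<close>

definition bounded_self_adjoint :: "('a::real_inner \<Rightarrow>\<^sub>L 'a) \<Rightarrow> bool" where
  "bounded_self_adjoint B \<longleftrightarrow> (\<forall>x y. B x \<bullet> y = x \<bullet> B y)"

definition positive_definite :: "('a::real_inner \<Rightarrow>\<^sub>L 'a) \<Rightarrow> bool" where
  "positive_definite B \<longleftrightarrow> (\<forall>x. x \<noteq> 0 \<longrightarrow> 0 < B x \<bullet> x)"

definition op_le :: "('a::real_inner \<Rightarrow>\<^sub>L 'a) \<Rightarrow> ('a \<Rightarrow>\<^sub>L 'a) \<Rightarrow> bool" where
  "op_le B C \<longleftrightarrow> (\<forall>x. B x \<bullet> x \<le> C x \<bullet> x)"

text \<open>The set $\mathcal{L}_s(\mathbf{H},-b,b)$.\<close>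
definition Ls :: "real \<Rightarrow> ('a::real_inner \<Rightarrow>\<^sub>L 'a) set" where
  "Ls b = {B. bounded_self_adjoint B
     \<and> (\<exists>\<delta>>0. positive_definite ((b - \<delta>) *\<^sub>R id_blinfun - B))
     \<and> (\<exists>\<delta>>0. positive_definite (B - (- b + \<delta>) *\<^sub>R id_blinfun))}"

section \<open>Spectral projections\<close>

definition orthogonal_projection :: "('a::real_inner \<Rightarrow>\<^sub>L 'a) \<Rightarrow> bool" where
  "orthogonal_projection P \<longleftrightarrow> bounded_self_adjoint P \<and> (\<forall>x. P (P x) = P x)"

definition projection_valued_measure :: "(real set \<Rightarrow> 'a::real_inner \<Rightarrow>\<^sub>L 'a) \<Rightarrow> bool" where
  "projection_valued_measure E \<longleftrightarrow>
     (\<forall>\<Omega>\<in>sets borel. orthogonal_projection (E \<Omega>)) \<and> E UNIV = id_blinfun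
     \<and> (\<forall>\<Omega>. range \<Omega> \<subseteq> sets borel \<and> disjoint_family \<Omega> \<longrightarrow>
          (\<forall>x. (\<lambda>n::nat. E (\<Omega> n) x) sums E (\<Union>n. \<Omega> n) x))"

definition scalar_spectral_measure ::
    "(real set \<Rightarrow> 'a::real_inner \<Rightarrow>\<^sub>L 'a) \<Rightarrow> 'a \<Rightarrow> real measure" where
  "scalar_spectral_measure E x = measure_of UNIV (sets borel) (\<lambda>\<Omega>. ennreal (E \<Omega> x \<bullet> x))"

text \<open>
  \<open>E\<close> is the spectral measure of \<open>A\<close>, i.e. \<open>A\<close> is the integral of \<open>t\<close> against \<open>E\<close>. It is enough
  to require the formula for the quadratic form of \<open>A\<close>: by polarization it determines the
  bilinear form \<open>A x \<bullet> y\<close> of a symmetric operator on \<open>D\<close>.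
\<close>
definition is_spectral_measure ::
    "'a::real_inner set \<Rightarrow> ('a \<Rightarrow> 'a) \<Rightarrow> (real set \<Rightarrow> 'a \<Rightarrow>\<^sub>L 'a) \<Rightarrow> bool" where
  "is_spectral_measure D A E \<longleftrightarrow> projection_valued_measure E
     \<and> D = {x. integrable (scalar_spectral_measure E x) (\<lambda>t. t\<^sup>2)}
     \<and> (\<forall>x\<in>D. A x \<bullet> x = (\<integral>t. t \<partial>scalar_spectral_measure E x))"

text \<open>
  By the spectral theorem a self-adjoint operator has a spectral measure, and it is unique on
  Borel sets; the choice below only concerns irrelevant values on other sets.
\<close>
definition spectral_projection ::
    "'a::real_inner set \<Rightarrow> ('a \<Rightarrow> 'a) \<Rightarrow> real set \<Rightarrow> 'a \<Rightarrow>\<^sub>L 'a" where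
  "spectral_projection D A = (SOME E. is_spectral_measure D A E)"

definition negative_space :: "'a::real_inner set \<Rightarrow> ('a \<Rightarrow> 'a) \<Rightarrow> 'a set" where
  "negative_space D A = range (blinfun_apply (spectral_projection D A {..<0}))"

section \<open>Nullity and relative Morse index\<close>

text \<open>
  The dimension of the quotient \<open>W / R\<close>, as the dimension of an algebraic complement of \<open>R\<close>
  in \<open>W\<close> (all of which are isomorphic to the quotient).
\<close>
definition quotient_dim :: "'a::real_vector set \<Rightarrow> 'a set \<Rightarrow> nat" where
  "quotient_dim W R =
     dim (SOME U. subspace U \<and> U \<inter> R = {0} \<and> W = {u + r | u r. u \<in> U \<and> r \<in> R})"

text \<open>
  The index of a linear map \<open>T\<close> from \<open>V\<close> to \<open>W\<close>. It is meaningful for Fredholm maps only, as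
  \<open>dim\<close> is \<open>0\<close> on infinite-dimensional spaces.
\<close>
definition fredholm_index :: "'a::real_vector set \<Rightarrow> 'a set \<Rightarrow> ('a \<Rightarrow> 'a) \<Rightarrow> int" where
  "fredholm_index V W T = int (dim {x\<in>V. T x = 0}) - int (quotient_dim W (T ` V))"

definition nullity :: "'a::real_inner set \<Rightarrow> ('a \<Rightarrow> 'a) \<Rightarrow> ('a \<Rightarrow>\<^sub>L 'a) \<Rightarrow> enat" where
  "nullity D A B = edim {x\<in>D. A x - B x = 0}"

text \<open>
  The orthogonal projection onto \<open>negative_space D A\<close> is the spectral projection for \<open>{..<0}\<close>.
  If \<open>A\<close> and \<open>B\<close> are in $\mathcal{O}^0_e(-b,b)$ and $\mathcal{L}_s(\mathbf{H},-b,b)$, the map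
  whose index is taken is Fredholm.
\<close>
definition relative_morse_index ::
    "'a::real_inner set \<Rightarrow> ('a \<Rightarrow> 'a) \<Rightarrow> ('a \<Rightarrow>\<^sub>L 'a) \<Rightarrow> int" where
  "relative_morse_index D A B =
     fredholm_index (negative_space D (\<lambda>x. A x - B x)) (negative_space D A)
       (spectral_projection D A {..<0})"

end

theory Submission
  imports Defs "HOL-Homology.Brouwer_Degree"
begin

text \<open>
  Fix \<open>c < b\<close> above the Lipschitz constant of \<open>F'\<close> and the norms of \<open>B\<^sub>1\<close>, \<open>B\<^sub>2\<close>. The spectral subspace of \<open>A\<close>
  for \<open>[-c, c]\<close> is finite-dimensional, and \<open>A - C\<close> is uniformly definite on the domain parts of the
  spectral subspaces \<open>X\<^sub>-\<close>, \<open>X\<^sub>+\<close> for \<open>(-\<infinity>, -c)\<close>, \<open>(c, \<infinity>)\<close> whenever \<open>\<parallel>C\<parallel> < c\<close>. Enlarge \<open>X\<^sub>-\<close> by a maximal \<open>L\<^sub>1\<close> on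
  which \<open>A - B\<^sub>1\<close> stays uniformly negative and \<open>X\<^sub>+\<close> by a maximal \<open>L\<^sub>2\<close> on which \<open>A - B\<^sub>2\<close> stays uniformly
  positive. The relative Morse index bounds \<open>dim L\<^sub>1\<close> and \<open>dim L\<^sub>2\<close> from below, and equality of the two
  indices forces \<open>D = (L\<^sub>1 + X\<^sub>- \<inter> D) + (L\<^sub>2 + X\<^sub>+ \<inter> D)\<close>. Since every \<open>A - C\<close> with \<open>B\<^sub>1 \<le> C \<le> B\<^sub>2\<close> is negative
  on the first and positive on the second summand, these operators are uniformly bounded below.

  This is an a priori bound for the homotopy \<open>t F' + (1 - t) B\<^sub>2\<close>. Solving the equation on the complement
  of the spectral subspace for \<open>[-c, c]\<close> by contraction leaves a continuous map of a finite-dimensional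
  space, which has a zero by a degree argument.

  The index is defined through spectral measures, which have to be known to exist. The spectral
  subspace of \<open>A\<close> for \<open>(-\<infinity>, t]\<close> is the kernel of \<open>S + \<bar>S\<bar>\<close> for the bounded operator
  \<open>S = (A - t) (1 + (A - t)\<^sup>2)\<inverse>\<close>, and the resulting spectral family extends to a projection-valued
  measure by means of the Stieltjes measures of its quadratic forms.
\<close>

section \<open>Orthogonal projections and finite-dimensional subspaces\<close>

text \<open>Let \<open>Pm\<close>, \<open>Pz\<close>, \<open>Pp\<close> be the spectral projections
  of \<open>A\<close> for \<open>X\<^sub>-\<close>, \<open>[-c, c]\<close>,
  \<open>X\<^sub>+\<close>, and \<open>N(B)\<close> the kernel of \<open>Pm\<close> on the negative
  space of \<open>A - B\<close>. \<open>Pm\<close> maps this space and the negative space of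
  \<open>A\<close> onto the same subspace, so the index of \<open>B\<close> is
  \<open>dim N(B)\<close> minus a number independent of \<open>B\<close>, and equal indices mean
  \<open>dim N(B\<^sub>1) = dim N(B\<^sub>2)\<close>. Spectral gaps at 0 give
  \<open>dim L\<^sub>1 \<ge> dim N(B\<^sub>1)\<close> and
  \<open>dim L\<^sub>2 \<ge> rank Pz - dim N(B\<^sub>2)\<close>, hence
  \<open>dim L\<^sub>1 + dim L\<^sub>2 \<ge> rank Pz\<close>. Conversely \<open>Pz\<close> is
  injective on \<open>L\<^sub>1 + L\<^sub>2\<close>, because the forms have opposite signs on the
  two enlarged spaces; so it is onto, and this is the decomposition of \<open>D\<close>.

  The negative spaces of \<open>A - B\<^sub>1\<close> and \<open>A - B\<^sub>2\<close> cannot be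
  compared directly; the splitting of \<open>A\<close> is the common frame. The kernel of
  \<open>A - B\<close> lies in its nonnegative space, which is where the trivial kernel of
  \<open>A - B\<^sub>2\<close> enters.\<close>

lemma nearest_point_orthogonal:
  fixes V :: "'a::real_inner set"
  assumes V: "subspace V" and y: "y \<in> V" and min: "\<And>v. v \<in> V \<Longrightarrow> (norm (x - y))\<^sup>2 \<le> (norm (x - v))\<^sup>2"
    and v: "v \<in> V"
  shows "(x - y) \<bullet> v = 0"
proof (cases "v = 0")
  case False
  define t where "t = (x - y) \<bullet> v / (v \<bullet> v)"
  have "y + t *\<^sub>R v \<in> V" using V y v by (simp add: subspace_add subspace_scale)
  from min[OF this] have "(norm (x - y))\<^sup>2 \<le> (norm ((x - y) - t *\<^sub>R v))\<^sup>2"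
    by (simp add: algebra_simps)
  also have "\<dots> = (norm (x - y))\<^sup>2 - 2 * t * ((x - y) \<bullet> v) + t\<^sup>2 * (v \<bullet> v)"
    unfolding power2_norm_eq_inner by (simp add: inner_diff inner_commute algebra_simps power2_eq_square)
  finally have "2 * t * ((x - y) \<bullet> v) \<le> t\<^sup>2 * (v \<bullet> v)" by simp
  moreover have "v \<bullet> v > 0" using False by simp
  ultimately have "((x - y) \<bullet> v)\<^sup>2 \<le> 0"
    by (simp add: t_def power2_eq_square divide_simps)
  then show ?thesis by simp
qed simp

text \<open>A minimising sequence is Cauchy by the parallelogram law. Only the subspace has to be
  complete, so that the lemma serves closed subspaces, finite-dimensional subspaces and the graph of
  an operator in the product space alike.\<close>

lemma projection_exists:
  fixes V :: "'a::real_inner set"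
  assumes V: "subspace V" and c: "complete V"
  shows "\<exists>y\<in>V. \<forall>v\<in>V. (x - y) \<bullet> v = 0"
proof -
  define q where "q = (INF v\<in>V. (norm (x - v))\<^sup>2)"
  have V0: "V \<noteq> {}" using V subspace_0 by blast
  have bdd: "bdd_below ((\<lambda>v. (norm (x - v))\<^sup>2) ` V)" by (rule bdd_belowI2[of _ 0]) simp
  have q_le: "q \<le> (norm (x - v))\<^sup>2" if "v \<in> V" for v
    unfolding q_def using bdd that by (rule cINF_lower)
  have "\<exists>v\<in>V. (norm (x - v))\<^sup>2 < q + 1 / real (Suc n)" for n
    using cINF_less_iff[OF V0 bdd, of "q + 1 / real (Suc n)"] by (simp add: q_def)
  then obtain s where s: "\<And>n. s n \<in> V" "\<And>n. (norm (x - s n))\<^sup>2 < q + 1 / real (Suc n)" by metis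
  have est: "(norm (s m - s n))\<^sup>2 \<le> 2 / real (Suc m) + 2 / real (Suc n)" for m n
  proof -
    have mid: "(1/2) *\<^sub>R (s m + s n) \<in> V" using V s by (simp add: subspace_add subspace_scale)
    have "(norm (s m - s n))\<^sup>2 = 2 * (norm (x - s m))\<^sup>2 + 2 * (norm (x - s n))\<^sup>2
        - 4 * (norm (x - (1/2) *\<^sub>R (s m + s n)))\<^sup>2"
      unfolding power2_norm_eq_inner
      by (simp add: inner_diff inner_add inner_commute algebra_simps)
    also have "\<dots> \<le> 2 * (q + 1 / real (Suc m)) + 2 * (q + 1 / real (Suc n)) - 4 * q"
    proof -
      have "2 * a + 2 * b - 4 * e \<le> 2 * (q + c) + 2 * (q + d) - 4 * q"
        if "a < q + c" "b < q + d" "q \<le> e" for a b c d e :: real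
        using that by argo
      then show ?thesis using s(2)[of m] s(2)[of n] q_le[OF mid] by blast
    qed
    finally show ?thesis by (simp add: algebra_simps)
  qed
  have "Cauchy s"
    unfolding Cauchy_def
  proof (intro allI impI)
    fix e :: real assume e: "e > 0"
    then obtain N :: nat where N: "4 / e\<^sup>2 < real N" using reals_Archimedean2 by blast
    then have N': "4 < real (Suc N) * e\<^sup>2" using e
      by (simp add: divide_simps split: if_splits) (smt (verit) zero_less_power mult_right_mono)
    show "\<exists>M. \<forall>m\<ge>M. \<forall>n\<ge>M. dist (s m) (s n) < e"
    proof (intro exI[of _ N] allI impI)
      fix m n assume "m \<ge> N" "n \<ge> N"
      then have "2 / real (Suc m) \<le> 2 / real (Suc N)" "2 / real (Suc n) \<le> 2 / real (Suc N)"
        by (auto intro!: divide_left_mono)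
      then have "(norm (s m - s n))\<^sup>2 \<le> 4 / real (Suc N)" using est[of m n] by simp
      also have "\<dots> < e\<^sup>2" using N' by (simp add: divide_simps mult.commute)
      finally show "dist (s m) (s n) < e" using e by (simp add: dist_norm power2_less_imp_less)
    qed
  qed
  then obtain y where y: "y \<in> V" "s \<longlonglongrightarrow> y" using c s(1) by (auto simp: complete_def)
  have "(norm (x - y))\<^sup>2 \<le> q"
  proof (rule LIMSEQ_le)
    show "(\<lambda>n. (norm (x - s n))\<^sup>2) \<longlonglongrightarrow> (norm (x - y))\<^sup>2" by (intro tendsto_intros y)
    show "(\<lambda>n. q + 1 / real (Suc n)) \<longlonglongrightarrow> q"
      using tendsto_add[OF tendsto_const LIMSEQ_inverse_real_of_nat, of q] by (simp add: inverse_eq_divide)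
    show "\<exists>N. \<forall>n\<ge>N. (norm (x - s n))\<^sup>2 \<le> q + 1 / real (Suc n)" using s(2) less_imp_le by blast
  qed
  then have "(norm (x - y))\<^sup>2 \<le> (norm (x - v))\<^sup>2" if "v \<in> V" for v using q_le[OF that] by linarith
  then show ?thesis using nearest_point_orthogonal[OF V y(1)] y(1) by blast
qed

text \<open>A total function of \<open>V\<close>; it is the orthogonal projection when
  \<open>V\<close> is a complete subspace, and nothing is claimed otherwise.\<close>

definition proj :: "'a::real_inner set \<Rightarrow> 'a \<Rightarrow> 'a" where
  "proj V x = (SOME y. y \<in> V \<and> (\<forall>v\<in>V. (x - y) \<bullet> v = 0))"

context
  fixes V :: "'a::real_inner set"
  assumes V: "subspace V" and c: "complete V"
begin

lemma proj_mem: "proj V x \<in> V" and proj_orthogonal: "v \<in> V \<Longrightarrow> (x - proj V x) \<bullet> v = 0"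
  using someI_ex[of "\<lambda>y. y \<in> V \<and> (\<forall>v\<in>V. (x - y) \<bullet> v = 0)"] projection_exists[OF V c, of x]
  unfolding proj_def by blast+

lemma proj_unique: 
  assumes "y \<in> V" "\<And>v. v \<in> V \<Longrightarrow> (x - y) \<bullet> v = 0" shows "proj V x = y"
proof -
  have "y - proj V x \<in> V" using V assms(1) proj_mem by (simp add: subspace_diff)
  then have "(x - proj V x) \<bullet> (y - proj V x) - (x - y) \<bullet> (y - proj V x) = 0"
    using assms(2) proj_orthogonal by simp
  then have "(y - proj V x) \<bullet> (y - proj V x) = 0" by (simp add: inner_diff_left)
  then show ?thesis by simp
qed

lemma proj_id: "x \<in> V \<Longrightarrow> proj V x = x" by (rule proj_unique) auto

lemma proj_eq_0_iff: "proj V x = 0 \<longleftrightarrow> (\<forall>v\<in>V. x \<bullet> v = 0)"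
  using proj_orthogonal[of _ x] proj_unique[of 0 x] subspace_0[OF V] by auto

lemma linear_proj: "linear (proj V)"
proof (rule linearI)
  fix x y and r :: real
  have "(x + y - (proj V x + proj V y)) \<bullet> v = (x - proj V x) \<bullet> v + (y - proj V y) \<bullet> v" for v
    by (simp add: algebra_simps)
  then show "proj V (x + y) = proj V x + proj V y"
    by (intro proj_unique) (simp_all add: V proj_mem proj_orthogonal subspace_add)
  have "(r *\<^sub>R x - r *\<^sub>R proj V x) \<bullet> v = r * ((x - proj V x) \<bullet> v)" for v
    by (simp add: algebra_simps)
  then show "proj V (r *\<^sub>R x) = r *\<^sub>R proj V x"
    by (intro proj_unique) (simp_all add: V proj_mem proj_orthogonal subspace_scale)
qed

lemma proj_inner: "proj V x \<bullet> y = x \<bullet> proj V y"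
  using proj_orthogonal[OF proj_mem, of x y] proj_orthogonal[OF proj_mem, of y x]
  by (simp add: inner_diff_left inner_commute[of "proj V x"])

lemma proj_pythagoras: "(norm x)\<^sup>2 = (norm (proj V x))\<^sup>2 + (norm (x - proj V x))\<^sup>2"
  using proj_orthogonal[OF proj_mem, of x x]
  by (simp add: power2_norm_eq_inner inner_diff inner_commute)

lemma norm_proj_le: "norm (proj V x) \<le> norm x"
  by (rule power2_le_imp_le) (use proj_pythagoras[of x] in auto)

lemma bounded_linear_proj: "bounded_linear (proj V)"
  using linear_proj norm_proj_le
  by (auto simp: bounded_linear_def bounded_linear_axioms_def intro!: exI[of _ 1])

end

section \<open>Dimension of subspaces of an infinite-dimensional space\<close>

lemma finite_dim_subset: "finite_dim W \<Longrightarrow> V \<subseteq> W \<Longrightarrow> finite_dim V"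
  unfolding finite_dim_def by blast

lemma finite_dim_span: "finite S \<Longrightarrow> finite_dim (span S)"
  unfolding finite_dim_def by blast

lemma finite_dim_linear_image:
  assumes "linear f" "finite_dim V" shows "finite_dim (f ` V)"
  using assms unfolding finite_dim_def by (metis finite_imageI image_mono linear_span_image)

lemma finite_dim_basis:
  assumes "subspace V" "finite_dim V"
  obtains B where "finite B" "independent B" "B \<subseteq> V" "span B = V" "card B = dim V"
proof -
  obtain B where B: "B \<subseteq> V" "independent B" "V \<subseteq> span B" "card B = dim V" by (rule basis_exists)
  obtain S where "finite S" "V \<subseteq> span S" using assms(2) unfolding finite_dim_def by blast
  then have "finite B" using independent_span_bound B by blast
  with B show thesis using that span_subspace[OF B(1,3) assms(1)] by blast
qed

text \<open>\<open>dim\<close> is the cardinality of a basis, with value 0 for an infinite one;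
  monotonicity therefore depends on the larger set being finite-dimensional.\<close>

lemma dim_mono_finite_dim:
  assumes "finite_dim W" "V \<subseteq> span W"
  shows "dim V \<le> dim W"
proof -
  obtain B where B: "B \<subseteq> span W" "independent B" "span W \<subseteq> span B" "card B = dim (span W)"
    by (rule basis_exists)
  obtain S where S: "finite S" "W \<subseteq> span S" using assms(1) unfolding finite_dim_def by blast
  then have "B \<subseteq> span S" using B(1) by (meson span_minimal subset_trans subspace_span)
  then have "finite B" using independent_span_bound S B by blast
  then show ?thesis using dim_le_card[of V B] B assms(2) by simp
qed

lemma finite_dim_eqI:
  assumes "subspace V" "V \<subseteq> W" "finite_dim W" "dim W \<le> dim V"
  shows "V = W"
proof (rule ccontr)
  assume "V \<noteq> W"
  then obtain w where w: "w \<in> W" "w \<notin> V" using assms by blast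
  obtain B where B: "finite B" "independent B" "B \<subseteq> V" "span B = V" "card B = dim V"
    by (rule finite_dim_basis[OF assms(1) finite_dim_subset[OF assms(3,2)]])
  have i: "independent (insert w B)" using B w by (simp add: independent_insertI)
  have "w \<notin> B" using w B by blast
  then have "dim (insert w B) = Suc (dim V)"
    using dim_eq_card_independent[OF i] B by simp
  moreover have "insert w B \<subseteq> W" using w(1) B(3) assms(2) by auto
  then have "insert w B \<subseteq> span W" by (rule subset_trans[OF _ span_superset])
  then have "dim (insert w B) \<le> dim W" by (rule dim_mono_finite_dim[OF assms(3)])
  ultimately show False using assms(4) by linarith
qed

lemma linear_inj_on_subspaceI:
  assumes "linear f" "subspace V" "\<And>x. x \<in> V \<Longrightarrow> f x = 0 \<Longrightarrow> x = 0"
  shows "inj_on f V"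
proof (rule inj_onI)
  fix x y assume xy: "x \<in> V" "y \<in> V" "f x = f y"
  then have "x - y = 0" using assms by (intro assms(3)) (auto simp: subspace_diff linear_diff)
  then show "x = y" by simp
qed

lemma dim_zero_subspace: "dim {0::'a::real_vector} = 0"
  by (rule dim_unique[of "{}"]) (simp_all add: independent_empty)

text \<open>Finiteness and the bound come together: the image of a basis of \<open>V\<close> is
  independent in \<open>W\<close>. All dimension estimates for spectral subspaces are obtained in
  this way, with \<open>f\<close> an orthogonal projection.\<close>

lemma dim_inj_le:
  assumes f: "linear f" and V: "subspace V" and inj: "\<And>x. x \<in> V \<Longrightarrow> f x = 0 \<Longrightarrow> x = 0"
    and W: "f ` V \<subseteq> W" "finite_dim W"
  shows "finite_dim V" "dim V \<le> dim W"
proof -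
  obtain B where B: "B \<subseteq> V" "independent B" "V \<subseteq> span B" "card B = dim V" by (rule basis_exists)
  have sp: "span B = V" using span_subspace B V by blast
  have "inj_on f (span B)"
    unfolding sp by (rule linear_inj_on_subspaceI[OF f V inj])
  then have i: "independent (f ` B)" and ib: "inj_on f B"
    using linear_independent_injective_image[OF f B(2)] inj_on_subset[OF _ span_superset] by blast+
  obtain S where S: "finite S" "W \<subseteq> span S" using W(2) unfolding finite_dim_def by blast
  have "f ` B \<subseteq> W" using B W by blast
  then have "finite (f ` B)" using independent_span_bound[OF S(1) i] S(2) by blast
  then have fB: "finite B" using ib finite_image_iff by blast
  then show "finite_dim V" using sp finite_dim_span by blast
  have "f ` B \<subseteq> span W" using \<open>f ` B \<subseteq> W\<close> span_superset by blast
  then have "dim (f ` B) \<le> dim W" by (rule dim_mono_finite_dim[OF W(2)])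
  then show "dim V \<le> dim W" using dim_eq_card_independent[OF i] card_image[OF ib] B(4) by simp
qed

lemma orthonormal_basis_exists:
  fixes V :: "'a::real_inner set"
  assumes V: "subspace V" and f: "finite_dim V"
  obtains B where "finite B" "independent B" "B \<subseteq> V" "span B = V" "card B = dim V"
    "\<forall>b\<in>B. b \<bullet> b = 1" "\<forall>b\<in>B. \<forall>c\<in>B. b \<noteq> c \<longrightarrow> b \<bullet> c = 0"
proof -
  obtain B0 where B0: "finite B0" "independent B0" "B0 \<subseteq> V" "span B0 = V" "card B0 = dim V"
    by (rule finite_dim_basis[OF V f])
  obtain C where C: "finite C" "span C = span B0" "pairwise orthogonal C"
    using basis_orthogonal[OF B0(1)] by blast
  define B where "B = (\<lambda>x. x /\<^sub>R norm x) ` (C - {0})"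
  have fB: "finite B" using C by (simp add: B_def)
  have one: "b \<bullet> b = 1" if "b \<in> B" for b
  proof -
    obtain x where "x \<noteq> 0" "b = x /\<^sub>R norm x" using \<open>b \<in> B\<close> by (auto simp: B_def)
    then show ?thesis by (simp add: dot_square_norm power2_eq_square field_simps)
  qed
  have orth: "b \<bullet> c = 0" if "b \<in> B" "c \<in> B" "b \<noteq> c" for b c
  proof -
    obtain x y where xy: "x \<in> C" "b = x /\<^sub>R norm x" "y \<in> C" "c = y /\<^sub>R norm y"
      using \<open>b \<in> B\<close> \<open>c \<in> B\<close> by (auto simp: B_def)
    then have "x \<noteq> y" using \<open>b \<noteq> c\<close> by blast
    then have "x \<bullet> y = 0" using C(3) xy by (auto simp: pairwise_def orthogonal_def)
    then show ?thesis using xy by simp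
  qed
  have "0 \<notin> B" using one by force
  then have ind: "independent B" 
    using orth by (intro pairwise_orthogonal_independent) (auto simp: pairwise_def orthogonal_def)
  have "x /\<^sub>R norm x \<in> span C" if "x \<in> C" for x using that by (intro span_scale span_base)
  then have "B \<subseteq> span C" by (auto simp: B_def)
  moreover have "C \<subseteq> span B"
  proof
    fix x assume x: "x \<in> C"
    show "x \<in> span B"
    proof (cases "x = 0")
      case False
      then have "x /\<^sub>R norm x \<in> B" using x by (auto simp: B_def)
      then have "norm x *\<^sub>R (x /\<^sub>R norm x) \<in> span B" by (intro span_scale span_base)
      then show ?thesis using False by simp
    qed (simp add: span_zero)
  qed
  ultimately have sp: "span B = V" using C B0 by (metis span_eq)
  then have "card B = dim V" using dim_span_eq_card_independent[OF ind] by simp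
  then show thesis using that[OF fB ind _ sp] one orth sp span_superset by blast
qed

lemma orthonormal_expansion:
  fixes B :: "'a::real_inner set"
  assumes B: "finite B" "\<forall>b\<in>B. b \<bullet> b = 1" "\<forall>b\<in>B. \<forall>c\<in>B. b \<noteq> c \<longrightarrow> b \<bullet> c = 0" and x: "x \<in> span B"
  shows "(\<Sum>b\<in>B. (x \<bullet> b) *\<^sub>R b) = x"
  using x
proof (induct rule: span_induct_alt)
  case (step c y z)
  have "(\<Sum>b\<in>B. ((c *\<^sub>R y + z) \<bullet> b) *\<^sub>R b) = (\<Sum>b\<in>B. (if b = y then c *\<^sub>R y else 0)) + (\<Sum>b\<in>B. (z \<bullet> b) *\<^sub>R b)"
    unfolding sum.distrib[symmetric] using step B(2,3)
    by (intro sum.cong) (auto simp: inner_add_left scaleR_add_left)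
  then show ?case using step B(1) by simp
qed simp

lemma finite_dim_complete:
  fixes V :: "'a::real_inner set"
  assumes V: "subspace V" and f: "finite_dim V"
  shows "complete V"
proof -
  obtain B where B: "finite B" "independent B" "B \<subseteq> V" "span B = V" "card B = dim V"
    "\<forall>b\<in>B. b \<bullet> b = 1" "\<forall>b\<in>B. \<forall>c\<in>B. b \<noteq> c \<longrightarrow> b \<bullet> c = 0"
    by (rule orthonormal_basis_exists[OF V f])
  have expand: "x = (\<Sum>b\<in>B. (x \<bullet> b) *\<^sub>R b)" if "x \<in> V" for x
    using orthonormal_expansion[OF B(1,6,7)] that B(4) by simp
  show ?thesis
    unfolding complete_def
  proof (intro allI impI, elim conjE)
    fix s assume s: "\<forall>n. s n \<in> V" "Cauchy s"
    have "Cauchy (\<lambda>n. s n \<bullet> b)" for b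
      using bounded_linear.Cauchy[OF bounded_linear_inner_left s(2)] .
    then have "(\<lambda>n. s n \<bullet> b) \<longlonglongrightarrow> lim (\<lambda>n. s n \<bullet> b)" for b
      using Cauchy_convergent convergent_LIMSEQ_iff by blast
    then have "(\<lambda>n. \<Sum>b\<in>B. (s n \<bullet> b) *\<^sub>R b) \<longlonglongrightarrow> (\<Sum>b\<in>B. lim (\<lambda>n. s n \<bullet> b) *\<^sub>R b)"
      by (intro tendsto_intros)
    then have "s \<longlonglongrightarrow> (\<Sum>b\<in>B. lim (\<lambda>n. s n \<bullet> b) *\<^sub>R b)" using expand s(1) by simp
    moreover have "(\<Sum>b\<in>B. lim (\<lambda>n. s n \<bullet> b) *\<^sub>R b) \<in> V"
      using B V by (auto intro!: subspace_sum subspace_scale)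
    ultimately show "\<exists>l\<in>V. s \<longlonglongrightarrow> l" by blast
  qed
qed

text \<open>The complement \<open>W\<close> of the kernel is taken orthogonal, so that orthonormal
  bases of the two unite to a basis of \<open>V\<close>, while \<open>f\<close> is injective on
  \<open>W\<close> with the same image.\<close>

lemma rank_nullity:
  fixes V :: "'a::real_inner set"
  assumes l: "linear f" and V: "subspace V" and f: "finite_dim V"
  shows "dim V = dim {x\<in>V. f x = 0} + dim (f ` V)"
proof -
  define K where "K = {x\<in>V. f x = 0}"
  define W where "W = {x\<in>V. \<forall>k\<in>K. x \<bullet> k = 0}"
  have sK: "subspace K" unfolding K_def subspace_def
    using V l by (auto simp: subspace_0 subspace_add subspace_scale linear_0 linear_add linear_scale)
  have sW: "subspace W" unfolding W_def subspace_def
    using V by (auto simp: subspace_0 subspace_add subspace_scale inner_add_left)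
  have fK: "finite_dim K" and fW: "finite_dim W"
    using finite_dim_subset[OF f] by (auto simp: K_def W_def)
  obtain BK where BK: "finite BK" "independent BK" "BK \<subseteq> K" "span BK = K" "card BK = dim K"
    "\<forall>b\<in>BK. b \<bullet> b = 1" "\<forall>b\<in>BK. \<forall>c\<in>BK. b \<noteq> c \<longrightarrow> b \<bullet> c = 0"
    by (rule orthonormal_basis_exists[OF sK fK])
  obtain BW where BW: "finite BW" "independent BW" "BW \<subseteq> W" "span BW = W" "card BW = dim W"
    "\<forall>b\<in>BW. b \<bullet> b = 1" "\<forall>b\<in>BW. \<forall>c\<in>BW. b \<noteq> c \<longrightarrow> b \<bullet> c = 0"
    by (rule orthonormal_basis_exists[OF sW fW])
  have cross: "b \<bullet> c = 0" "c \<bullet> b = 0" if "b \<in> BK" "c \<in> BW" for b c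
    using that BK(3) BW(3) by (auto simp: W_def inner_commute[of b])
  have one: "b \<bullet> b = 1" if "b \<in> BK \<union> BW" for b using that BK(6) BW(6) by blast
  have "pairwise orthogonal (BK \<union> BW)"
    using BK(7) BW(7) cross by (auto simp: pairwise_def orthogonal_def)
  then have ind: "independent (BK \<union> BW)" using one by (intro pairwise_orthogonal_independent) force+
  have disj: "BK \<inter> BW = {}" using cross one by fastforce
  have "dim V = card (BK \<union> BW)"
  proof (rule dim_unique[OF _ _ ind refl])
    show "BK \<union> BW \<subseteq> V" using BK(3) BW(3) by (auto simp: K_def W_def)
    show "V \<subseteq> span (BK \<union> BW)"
    proof
      fix x assume x: "x \<in> V"
      note pK = sK finite_dim_complete[OF sK fK]
      have 1: "proj K x \<in> span BK" using proj_mem[OF pK] BK by simp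
      then have "x - proj K x \<in> V" using x V BK(4) by (auto simp: K_def intro!: subspace_diff)
      then have "x - proj K x \<in> span BW"
        using proj_orthogonal[OF pK] BW by (auto simp: W_def)
      then have "proj K x + (x - proj K x) \<in> span (BK \<union> BW)"
        using 1 by (intro span_add) (auto intro: set_mp[OF span_mono])
      then show "x \<in> span (BK \<union> BW)" by simp
    qed
  qed
  then have dV: "dim V = dim K + dim W" using card_Un_disjoint[OF BK(1) BW(1) disj] BK BW by simp
  have img: "f ` V = f ` W"
  proof
    show "f ` V \<subseteq> f ` W"
    proof
      fix y assume "y \<in> f ` V"
      then obtain x where x: "x \<in> V" "y = f x" by blast
      note pK = sK finite_dim_complete[OF sK fK]
      have p: "proj K x \<in> K" by (rule proj_mem[OF pK])
      then have "x - proj K x \<in> V" using x V by (auto simp: K_def intro!: subspace_diff)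
      then have "x - proj K x \<in> W"
        using proj_orthogonal[OF pK] by (auto simp: W_def)
      moreover have "f (x - proj K x) = y" using p x l by (simp add: K_def linear_diff)
      ultimately show "y \<in> f ` W" by blast
    qed
  qed (auto simp: W_def)
  have inj0: "x = 0" if "x \<in> W" "f x = 0" for x
    using that by (auto simp: W_def K_def)
  have "inj_on f (span BW)"
    unfolding BW(4) by (rule linear_inj_on_subspaceI[OF l sW inj0])
  then have i: "independent (f ` BW)" and ib: "inj_on f BW"
    using linear_independent_injective_image[OF l BW(2)] inj_on_subset[OF _ span_superset] by blast+
  have "dim (f ` W) = card (f ` BW)"
    using dim_span_eq_card_independent[OF i] linear_span_image[OF l, of BW] BW(4) by simp
  then have "dim (f ` W) = dim W" using card_image[OF ib] BW by simp
  then show ?thesis using dV img K_def by simp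
qed

section \<open>The negative spectral projection of a bounded self-adjoint operator\<close>

text \<open>The scalar model of the operator iteration below. It increases because
  \<open>y (Suc n) - y n\<close> is half the square of \<open>1 - y n\<close>.\<close>

lemma scalar_iteration:
  fixes y :: "nat \<Rightarrow> real"
  assumes "y 0 = 0" "\<And>n. y (Suc n) = (1 + (y n)\<^sup>2) / 2"
  shows "0 \<le> y n" "y n \<le> 1" "y n \<le> y (Suc n)"
proof -
  have b: "0 \<le> y n \<and> y n \<le> 1" for n
  proof (induct n)
    case (Suc n)
    then have "(y n)\<^sup>2 \<le> 1" by (intro power_le_one) auto
    then show ?case unfolding assms(2) using zero_le_power2[of "y n"] by simp
  qed (simp add: assms)
  then show "0 \<le> y n" "y n \<le> 1" by auto
  have "0 \<le> (1 - y n)\<^sup>2" by simp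
  then show "y n \<le> y (Suc n)" using assms(2)[of n] by (simp add: power2_eq_square algebra_simps)
qed

text \<open>
  The operator is \<open>1 - Y\<close>, where \<open>Y\<close> solves \<open>Y = (1 - S\<^sup>2 + Y\<^sup>2) / 2\<close>; the increments of the iteration for \<open>Y\<close>
  are dominated in norm by those of the scalar iteration.
\<close>
lemma absolute_value_exists:
  fixes S :: "'a::{real_inner,complete_space} \<Rightarrow> 'a"
  assumes S: "linear S" and sym: "\<And>x y. S x \<bullet> y = x \<bullet> S y" and nS: "\<And>x. norm (S x) \<le> norm x"
  obtains K where "linear K" "\<And>x y. K x \<bullet> y = x \<bullet> K y" "\<And>x. norm (K x) \<le> 2 * norm x"
    "\<And>x. 0 \<le> K x \<bullet> x" "\<And>x. K (K x) = S (S x)"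
    "\<And>C. linear C \<Longrightarrow> continuous_on UNIV C \<Longrightarrow> (\<And>x. C (S x) = S (C x)) \<Longrightarrow> (\<And>x. C (K x) = K (C x))"
proof -
  define X where "X x = x - S (S x)" for x
  define Y where "Y = rec_nat (\<lambda>x. 0 :: 'a) (\<lambda>n g x. (1/2) *\<^sub>R (X x + g (g x)))"
  have Y0: "Y 0 x = 0" and YS: "Y (Suc n) x = (1/2) *\<^sub>R (X x + Y n (Y n x))" for n x
    by (simp_all add: Y_def)
  define y where "y = rec_nat (0::real) (\<lambda>n r. (1 + r\<^sup>2) / 2)"
  have y0: "y 0 = 0" and yS: "y (Suc n) = (1 + (y n)\<^sup>2) / 2" for n by (simp_all add: y_def)
  note y_props = scalar_iteration[of y, OF y0 yS]
  have lX: "linear X" unfolding X_def using S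
    by (intro linearI) (simp_all add: linear_add linear_scale algebra_simps)
  have symX: "X x \<bullet> z = x \<bullet> X z" for x z by (simp add: X_def inner_diff sym)
  have nX: "norm (X x) \<le> norm x" for x
  proof (rule power2_le_imp_le)
    have "(norm (X x))\<^sup>2 = (norm x)\<^sup>2 - 2 * (norm (S x))\<^sup>2 + (norm (S (S x)))\<^sup>2"
      unfolding power2_norm_eq_inner X_def by (simp add: inner_diff sym[of x] sym[of _ x] inner_commute)
    moreover have "(norm (S (S x)))\<^sup>2 \<le> (norm (S x))\<^sup>2" by (rule power_mono[OF nS]) simp
    moreover have "0 \<le> (norm (S x))\<^sup>2" by simp
    ultimately show "(norm (X x))\<^sup>2 \<le> (norm x)\<^sup>2" by argo
  qed simp
  have lY: "linear (Y n)" for n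
  proof (induct n)
    case (Suc n)
    show ?case by (intro linearI)
      (simp_all add: YS linear_add[OF Suc] linear_scale[OF Suc] linear_add[OF lX] linear_scale[OF lX] algebra_simps)
  qed (intro linearI, simp_all add: Y0)
  have symY: "Y n x \<bullet> z = x \<bullet> Y n z" for n x z
    by (induct n arbitrary: x z) (simp_all add: Y0 YS inner_add symX)
  have nY: "norm (Y n x) \<le> y n * norm x" for n x
  proof (induct n arbitrary: x)
    case (Suc n)
    have "norm (Y n (Y n x)) \<le> y n * (y n * norm x)"
      using Suc[of "Y n x"] mult_left_mono[OF Suc[of x] y_props(1)[of n]] by linarith
    then have "norm (X x + Y n (Y n x)) \<le> norm x + y n * (y n * norm x)"
      using nX[of x] norm_triangle_le by (meson add_mono order_trans norm_triangle_ineq)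
    then show ?case by (simp add: YS yS power2_eq_square del: scaleR_add_right) (simp add: algebra_simps)
  qed (simp add: Y0 y0)
  \<comment> \<open>Every \<open>Y n\<close> is a polynomial in \<open>S\<close>, so it inherits the
    commutation relations of \<open>S\<close>.\<close>
  have commY: "C (Y n x) = Y n (C x)" if C: "linear C" "\<And>x. C (S x) = S (C x)" for C n x
    by (induct n arbitrary: x)
      (simp_all add: Y0 YS X_def C linear_0[OF C(1)] linear_add[OF C(1)] linear_diff[OF C(1)] linear_scale[OF C(1)])
  have SY: "S (Y n x) = Y n (S x)" for n x by (rule commY[OF S refl])
  have YY: "Y m (Y n x) = Y n (Y m x)" for m n x
    by (rule commY[OF lY]) (simp add: SY)
  \<comment> \<open>As the iterates commute, the difference of the squares of two successive
    iterates is their sum applied to their difference. The norms of both are bounded by scalar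
    quantities, and the same factorisation for \<open>y\<close> closes the induction.\<close>
  have dY: "norm (Y (Suc n) x - Y n x) \<le> (y (Suc n) - y n) * norm x" for n x
  proof (induct n arbitrary: x)
    case 0
    have "norm (X x) \<le> norm x" by (rule nX)
    then show ?case by (simp add: YS Y0 yS y0 linear_0[OF lY])
  next
    case (Suc n)
    define d where "d = Y (Suc n) x - Y n x"
    have d: "norm d \<le> (y (Suc n) - y n) * norm x" unfolding d_def by (rule Suc)
    have "Y (Suc (Suc n)) x - Y (Suc n) x = (1/2) *\<^sub>R (Y (Suc n) (Y (Suc n) x) - Y n (Y n x))"
      by (simp only: YS[of "Suc n"] YS[of n x]) (simp add: algebra_simps)
    also have "Y (Suc n) (Y (Suc n) x) - Y n (Y n x) = Y (Suc n) d + Y n d"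
      unfolding d_def by (simp add: linear_diff[OF lY] YY[of n "Suc n"])
    finally have "norm (Y (Suc (Suc n)) x - Y (Suc n) x) \<le> (1/2) * (norm (Y (Suc n) d) + norm (Y n d))"
      using norm_triangle_ineq[of "Y (Suc n) d" "Y n d"] by simp
    also have "\<dots> \<le> (1/2) * ((y (Suc n) + y n) * norm d)"
      using nY[of "Suc n" d] nY[of n d] by (simp add: algebra_simps)
    also have "\<dots> \<le> (1/2) * ((y (Suc n) + y n) * ((y (Suc n) - y n) * norm x))"
      using d y_props(1)[of n] y_props(1)[of "Suc n"] by (intro mult_left_mono) auto
    also have "\<dots> = (y (Suc (Suc n)) - y (Suc n)) * norm x"
      by (simp only: yS[of "Suc n"] yS[of n]) (simp add: power2_eq_square field_simps)
    finally show ?case .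
  qed
  have dYY: "norm (Y m x - Y n x) \<le> (y m - y n) * norm x" if "n \<le> m" for m n x
    using that
  proof (induct m rule: dec_induct)
    case (step m)
    have "norm (Y (Suc m) x - Y n x) \<le> norm (Y (Suc m) x - Y m x) + norm (Y m x - Y n x)"
      using norm_triangle_ineq[of "Y (Suc m) x - Y m x" "Y m x - Y n x"] by simp
    then show ?case using step(3) dY[of m x] by (simp add: algebra_simps)
  qed simp
  have "incseq y" using y_props(3) by (rule incseq_SucI)
  then have "convergent y"
    using y_props(1,2) by (intro Bseq_monoseq_convergent BseqI'[of _ 1]) (auto simp: monoseq_def incseq_def)
  then have Cy: "Cauchy y" by (simp add: convergent_Cauchy)
  have CY: "Cauchy (\<lambda>n. Y n x)" for x
  proof (rule CauchyI)
    fix e :: real assume "e > 0"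
    then have "e / (norm x + 1) > 0" by (simp add: add_nonneg_pos)
    then obtain M where M: "\<And>m n. m \<ge> M \<Longrightarrow> n \<ge> M \<Longrightarrow> norm (y m - y n) < e / (norm x + 1)"
      using Cy by (meson CauchyD)
    have *: "norm (Y m x - Y n x) < e" if "n \<le> m" "n \<ge> M" for m n
    proof -
      have "norm (Y m x - Y n x) \<le> (y m - y n) * norm x" by (rule dYY[OF that(1)])
      also have "\<dots> \<le> (y m - y n) * (norm x + 1)"
        using incseqD[OF \<open>incseq y\<close> that(1)] by (intro mult_left_mono) auto
      also have "\<dots> < e" using M[of m n] that by (simp add: pos_less_divide_eq add_nonneg_pos abs_less_iff)
      finally show ?thesis .
    qed
    show "\<exists>M. \<forall>m\<ge>M. \<forall>n\<ge>M. norm (Y m x - Y n x) < e"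
      using * by (metis nle_le norm_minus_commute)
  qed
  define Z where "Z x = lim (\<lambda>n. Y n x)" for x
  have Z: "(\<lambda>n. Y n x) \<longlonglongrightarrow> Z x" for x
    unfolding Z_def using CY Cauchy_convergent convergent_LIMSEQ_iff by blast
  have lZ: "linear Z"
  proof (rule linearI)
    show "Z (a + c) = Z a + Z c" for a c
      using LIMSEQ_unique[OF Z tendsto_add[OF Z[of a] Z[of c], folded linear_add[OF lY]]] .
    show "Z (r *\<^sub>R a) = r *\<^sub>R Z a" for r a
      using LIMSEQ_unique[OF Z tendsto_scaleR[OF tendsto_const Z[of a], of r, folded linear_scale[OF lY]]] .
  qed
  have symZ: "Z x \<bullet> z = x \<bullet> Z z" for x z
    using LIMSEQ_unique[OF tendsto_inner[OF Z tendsto_const] ] tendsto_inner[OF tendsto_const Z, of x z]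
    by (simp add: symY)
  have nY1: "norm (Y n x) \<le> norm x" for n x
    using nY[of n x] mult_right_mono[OF y_props(2)[of n] norm_ge_zero[of x]] by simp
  have nZ: "norm (Z x) \<le> norm x" for x
    by (rule LIMSEQ_le_const2[OF tendsto_norm[OF Z]]) (use nY1 in auto)
  \<comment> \<open>Pointwise convergence passes to the squares because the iterates are uniformly
    bounded by 1.\<close>
  have YYZ: "(\<lambda>n. Y n (Y n x)) \<longlonglongrightarrow> Z (Z x)" for x
  proof -
    have "(\<lambda>n. Y n (Y n x - Z x)) \<longlonglongrightarrow> 0"
    proof (rule Lim_null_comparison)
      show "\<forall>\<^sub>F n in sequentially. norm (Y n (Y n x - Z x)) \<le> norm (Y n x - Z x)" using nY1 by simp
      show "(\<lambda>n. norm (Y n x - Z x)) \<longlonglongrightarrow> 0" using Z[of x] by (simp add: tendsto_norm_zero LIM_zero)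
    qed
    from tendsto_add[OF this Z[of "Z x"]] show ?thesis by (simp add: linear_diff[OF lY])
  qed
  have eqZ: "Z x = (1/2) *\<^sub>R (X x + Z (Z x))" for x
  proof (rule LIMSEQ_unique)
    show "(\<lambda>n. Y (Suc n) x) \<longlonglongrightarrow> Z x" using Z[of x] by (rule LIMSEQ_Suc)
    show "(\<lambda>n. Y (Suc n) x) \<longlonglongrightarrow> (1/2) *\<^sub>R (X x + Z (Z x))"
      unfolding YS by (intro tendsto_intros YYZ)
  qed
  show thesis
  proof (rule that[of "\<lambda>x. x - Z x"])
    show "linear (\<lambda>x. x - Z x)" using lZ by (intro linearI) (simp_all add: linear_add linear_scale algebra_simps)
    show "(x - Z x) \<bullet> z = x \<bullet> (z - Z z)" for x z by (simp add: inner_diff symZ)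
    show "norm (x - Z x) \<le> 2 * norm x" for x using norm_triangle_ineq4[of x "Z x"] nZ[of x] by linarith
    have "Z x \<bullet> x \<le> norm x * norm x" for x
      using norm_cauchy_schwarz[of "Z x" x] mult_right_mono[OF nZ[of x] norm_ge_zero[of x]] by linarith
    then show "0 \<le> (x - Z x) \<bullet> x" for x by (simp add: inner_diff_left dot_square_norm power2_eq_square)
    \<comment> \<open>The fixed-point equation says
      \<open>2 Z - Z\<^sup>2 = X = 1 - S\<^sup>2\<close>, that is,
      \<open>(1 - Z)\<^sup>2 = S\<^sup>2\<close>.\<close>
    show "(x - Z x) - Z (x - Z x) = S (S x)" for x
    proof -
      have "2 *\<^sub>R Z x = X x + Z (Z x)" by (subst eqZ) simp
      then have "Z x + Z x - Z (Z x) = X x" by (metis add_diff_cancel_right' scaleR_2)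
      then show ?thesis by (simp add: X_def linear_diff[OF lZ] algebra_simps)
    qed
    show "C (x - Z x) = C x - Z (C x)"
      if C: "linear C" "continuous_on UNIV C" "\<And>x. C (S x) = S (C x)" for C x
    proof -
      have "(\<lambda>n. C (Y n x)) \<longlonglongrightarrow> C (Z x)"
        using continuous_on_tendsto_compose[OF C(2) Z] by simp
      then have "C (Z x) = Z (C x)" using LIMSEQ_unique[OF _ Z[of "C x"]] commY[OF C(1,3)] by simp
      then show ?thesis by (simp add: linear_diff[OF C(1)])
    qed
  qed
qed

lemma linear_bounded_continuous:
  assumes "linear f" "\<And>x. norm (f x) \<le> K * norm x" shows "continuous_on S f"
proof -
  have "bounded_linear f" using assms
    by (auto simp: bounded_linear_def bounded_linear_axioms_def mult.commute)
  then show ?thesis by (rule linear_continuous_on)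
qed

text \<open>A subspace invariant under a symmetric operator is reducing: its orthogonal complement
  is invariant too.\<close>

lemma proj_commute:
  fixes N :: "'a::real_inner set"
  assumes N: "subspace N" "complete N" and C: "linear C" "\<And>x y. C x \<bullet> y = x \<bullet> C y"
    and inv: "\<And>x. x \<in> N \<Longrightarrow> C x \<in> N"
  shows "proj N (C x) = C (proj N x)"
proof (rule proj_unique[OF N])
  show "C (proj N x) \<in> N" by (intro inv proj_mem N)
  show "(C x - C (proj N x)) \<bullet> v = 0" if "v \<in> N" for v
    using proj_orthogonal[OF N inv[OF that], of x] C by (simp add: linear_diff[symmetric])
qed

lemma psd_kernel:
  fixes K :: "'a::real_inner \<Rightarrow> 'a"
  assumes K: "linear K" "\<And>x y. K x \<bullet> y = x \<bullet> K y" "\<And>x. 0 \<le> K x \<bullet> x" and x: "K x \<bullet> x = 0"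
  shows "K x = 0"
proof (rule ccontr)
  assume "K x \<noteq> 0"
  then have a: "K x \<bullet> K x > 0" by simp
  \<comment> \<open>The summand 1 keeps the denominator of \<open>t\<close> positive when the
    quadratic coefficient vanishes. A step of length proportional to \<open>1 / b\<close> along
    \<open>- K x\<close> makes the first-order term win, contradicting positivity.\<close>
  define b where "b = K (K x) \<bullet> K x + 1"
  have b: "b > 0" using K(3)[of "K x"] by (simp add: b_def)
  define t where "t = - (K x \<bullet> K x) / b"
  have "0 \<le> K (x + t *\<^sub>R K x) \<bullet> (x + t *\<^sub>R K x)" by (rule K(3))
  also have "\<dots> = 2 * t * (K x \<bullet> K x) + t\<^sup>2 * (b - 1)"
    using x K(2)[of "K x" x] by (simp add: linear_add[OF K(1)] linear_scale[OF K(1)] inner_add b_def power2_eq_square algebra_simps)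
  also have "\<dots> = - (K x \<bullet> K x)\<^sup>2 / b - (t\<^sup>2)"
    using b by (simp add: t_def field_simps power2_eq_square)
  also have "\<dots> < 0"
  proof -
    have "(K x \<bullet> K x)\<^sup>2 / b > 0" using a b by simp
    then show ?thesis using zero_le_power2[of t] by linarith
  qed
  finally show False by simp
qed

text \<open>With \<open>K\<close> the absolute value of \<open>S\<close>,
  \<open>(K + S) (K - S) = K\<^sup>2 - S\<^sup>2 = 0\<close> puts the range of \<open>K - S\<close>
  into the kernel \<open>N\<close> of \<open>K + S\<close>; so \<open>K = S\<close> on the
  orthogonal complement of \<open>N\<close>. The kernel of \<open>S\<close> is contained in
  \<open>N\<close>, which makes the form strictly positive on nonzero vectors of the
  complement.\<close>

lemma bounded_negative_space_exists:
  fixes S :: "'a::{real_inner,complete_space} \<Rightarrow> 'a"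
  assumes S: "linear S" and sym: "\<And>x y. S x \<bullet> y = x \<bullet> S y" and nS: "\<And>x. norm (S x) \<le> norm x"
  obtains N where "subspace N" "complete N" "\<And>x. x \<in> N \<Longrightarrow> S x \<bullet> x \<le> 0"
    "\<And>x. proj N x = 0 \<Longrightarrow> 0 \<le> S x \<bullet> x" "\<And>x. proj N x = 0 \<Longrightarrow> S x \<bullet> x = 0 \<Longrightarrow> x = 0"
    "\<And>C x. linear C \<Longrightarrow> continuous_on UNIV C \<Longrightarrow> (\<And>x. C (S x) = S (C x)) \<Longrightarrow> x \<in> N \<Longrightarrow> C x \<in> N"
proof -
  obtain K where K: "linear K" "\<And>x y. K x \<bullet> y = x \<bullet> K y" "\<And>x. norm (K x) \<le> 2 * norm x"
    "\<And>x. 0 \<le> K x \<bullet> x" "\<And>x. K (K x) = S (S x)"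
    "\<And>C x. linear C \<Longrightarrow> continuous_on UNIV C \<Longrightarrow> (\<And>x. C (S x) = S (C x)) \<Longrightarrow> C (K x) = K (C x)"
    by (rule absolute_value_exists[OF S sym nS]) blast
  have cS: "continuous_on UNIV S" using linear_bounded_continuous[OF S, of 1] nS by simp
  have cK: "continuous_on UNIV K" using linear_bounded_continuous[OF K(1,3)] .
  have SK: "S (K x) = K (S x)" for x by (rule K(6)[OF S cS refl])
  define N where "N = {x. K x + S x = 0}"
  have sN: "subspace N" unfolding N_def subspace_def
    by (auto simp: linear_0 linear_add linear_scale S K(1) algebra_simps simp flip: scaleR_add_right)
  have "closed N" unfolding N_def
    by (rule closed_Collect_eq) (intro continuous_intros cS cK)+
  then have cN: "complete N" by (simp add: complete_eq_closed)
  note pN = sN cN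
  have KS: "K x = S x" if "proj N x = 0" for x
  proof -
    have "K (K z - S z) + S (K z - S z) = 0" for z
      by (simp add: linear_diff[OF S] linear_diff[OF K(1)] K(5) SK)
    then have "K z - S z \<in> N" for z by (simp add: N_def)
    then have "x \<bullet> (K z - S z) = 0" for z using that proj_eq_0_iff[OF pN] by blast
    then have "(K x - S x) \<bullet> z = 0" for z by (simp add: inner_diff sym K(2))
    from this[of "K x - S x"] show ?thesis by simp
  qed
  show thesis
  proof (rule that[OF pN])
    show "S x \<bullet> x \<le> 0" if "x \<in> N" for x
      using that K(4)[of x] by (simp add: N_def) (metis add_eq_0_iff2 inner_minus_left neg_le_0_iff_le add.commute)
    show "0 \<le> S x \<bullet> x" if "proj N x = 0" for x using KS[OF that] K(4)[of x] by simp
    show "x = 0" if p: "proj N x = 0" "S x \<bullet> x = 0" for x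
    proof -
      have "K x = 0" using psd_kernel[OF K(1,2,4)] KS p by metis
      then have "x \<in> N" using KS[OF p(1)] by (simp add: N_def)
      then show ?thesis using proj_id[OF pN] p(1) by metis
    qed
    show "C x \<in> N" if C: "linear C" "continuous_on UNIV C" "\<And>x. C (S x) = S (C x)" "x \<in> N" for C x
      using K(6)[OF C(1-3), of x] C(3)[of x] C(4) linear_add[OF C(1), of "K x" "S x"] linear_0[OF C(1)] by (simp add: N_def)
  qed
qed

section \<open>Self-adjoint operators\<close>

text \<open>An everywhere defined symmetric \<open>C\<close> shifts the value of the adjoint at
  \<open>y\<close> by \<open>C y\<close> and leaves its domain alone.\<close>

lemma self_adjoint_diff:
  assumes sa: "self_adjoint D A" and C: "linear C" "\<And>x y. C x \<bullet> y = x \<bullet> C y"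
  shows "self_adjoint D (\<lambda>x. A x - C x)"
proof -
  have D: "D = {y. \<exists>z. \<forall>x\<in>D. A x \<bullet> y = x \<bullet> z}" using sa by (simp add: self_adjoint_def)
  have "(\<exists>z. \<forall>x\<in>D. A x \<bullet> y = x \<bullet> z) \<longleftrightarrow> (\<exists>z. \<forall>x\<in>D. (A x - C x) \<bullet> y = x \<bullet> z)" for y
  proof
    assume "\<exists>z. \<forall>x\<in>D. A x \<bullet> y = x \<bullet> z"
    then obtain z where "\<forall>x\<in>D. A x \<bullet> y = x \<bullet> z" ..
    then have "\<forall>x\<in>D. (A x - C x) \<bullet> y = x \<bullet> (z - C y)" by (simp add: inner_diff C)
    then show "\<exists>z. \<forall>x\<in>D. (A x - C x) \<bullet> y = x \<bullet> z" ..
  next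
    assume "\<exists>z. \<forall>x\<in>D. (A x - C x) \<bullet> y = x \<bullet> z"
    then obtain z where "\<forall>x\<in>D. (A x - C x) \<bullet> y = x \<bullet> z" ..
    then have "\<forall>x\<in>D. A x \<bullet> y = x \<bullet> (z + C y)" by (simp add: inner_diff inner_add C algebra_simps)
    then show "\<exists>z. \<forall>x\<in>D. A x \<bullet> y = x \<bullet> z" ..
  qed
  then have "D = {y. \<exists>z. \<forall>x\<in>D. (A x - C x) \<bullet> y = x \<bullet> z}" using D by simp
  then show ?thesis using sa C
    unfolding self_adjoint_def linear_operator_def by (auto simp: linear_add linear_scale inner_diff scaleR_diff_right)
qed

locale self_adjoint_operator =
  fixes D :: "'a::{real_inner,complete_space} set" and A :: "'a \<Rightarrow> 'a"
  assumes self_adjoint: "self_adjoint D A"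
begin

lemma subspace_D: "subspace D" and dense: "closure D = UNIV"
  and add: "x \<in> D \<Longrightarrow> y \<in> D \<Longrightarrow> A (x + y) = A x + A y"
  and scale: "x \<in> D \<Longrightarrow> A (c *\<^sub>R x) = c *\<^sub>R A x"
  and symmetric: "x \<in> D \<Longrightarrow> y \<in> D \<Longrightarrow> A x \<bullet> y = x \<bullet> A y"
  using self_adjoint by (auto simp: self_adjoint_def linear_operator_def)

lemma add_D: "x \<in> D \<Longrightarrow> y \<in> D \<Longrightarrow> x + y \<in> D" and scale_D: "x \<in> D \<Longrightarrow> c *\<^sub>R x \<in> D"
  and diff_D: "x \<in> D \<Longrightarrow> y \<in> D \<Longrightarrow> x - y \<in> D" and zero_D: "0 \<in> D"
  using subspace_D by (auto simp: subspace_add subspace_scale subspace_diff subspace_0)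

lemma zero [simp]: "A 0 = 0" using scale[OF zero_D, of 0] by simp

lemma diff: "x \<in> D \<Longrightarrow> y \<in> D \<Longrightarrow> A (x - y) = A x - A y"
  using add[of x "- y"] scale[of y "-1"] scale_D[of y "-1"] by simp

lemma orthogonal_D:
  assumes "\<And>x. x \<in> D \<Longrightarrow> x \<bullet> w = 0" shows "w = 0"
proof -
  have "closed {x. x \<bullet> w = 0}" by (intro closed_Collect_eq continuous_intros)
  then have "closure D \<subseteq> {x. x \<bullet> w = 0}" using assms by (intro closure_minimal) auto
  then have "w \<bullet> w = 0" using dense by blast
  then show ?thesis by simp
qed

lemma adjointD:
  assumes "\<And>x. x \<in> D \<Longrightarrow> A x \<bullet> y = x \<bullet> z" shows "y \<in> D" "A y = z"
proof -
  have D: "D = {y. \<exists>z. \<forall>x\<in>D. A x \<bullet> y = x \<bullet> z}" using self_adjoint by (simp add: self_adjoint_def)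
  show y: "y \<in> D" by (subst D) (use assms in blast)
  have "A y - z = 0" by (rule orthogonal_D) (use assms y symmetric in \<open>simp add: inner_diff_right\<close>)
  then show "A y = z" by simp
qed

lemma closed_graph:
  assumes "\<And>n. s n \<in> D" "s \<longlonglongrightarrow> y" "(\<lambda>n. A (s n)) \<longlonglongrightarrow> z"
  shows "y \<in> D" "A y = z"
proof -
  have "A x \<bullet> y = x \<bullet> z" if x: "x \<in> D" for x
  proof (rule LIMSEQ_unique)
    show "(\<lambda>n. A x \<bullet> s n) \<longlonglongrightarrow> A x \<bullet> y" by (intro tendsto_intros assms)
    show "(\<lambda>n. A x \<bullet> s n) \<longlonglongrightarrow> x \<bullet> z"
      using tendsto_inner[OF tendsto_const assms(3), of x] by (simp add: symmetric x assms(1))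
  qed
  then show "y \<in> D" "A y = z" using adjointD by blast+
qed

text \<open>
  The projection of \<open>(h, 0)\<close> onto the graph of \<open>A\<close> is \<open>(J h, S h)\<close>, where formally
  \<open>J = (1 + A\<^sup>2)\<inverse>\<close> and \<open>S = A (1 + A\<^sup>2)\<inverse>\<close>.
\<close>
lemma graph_projection:
  obtains J S where "linear J" "linear S" "\<And>x. norm (J x) \<le> norm x" "\<And>x. norm (S x) \<le> norm x"
    "\<And>x. J x \<in> D" "\<And>x. A (J x) = S x" "\<And>x. S x \<in> D" "\<And>x. A (S x) = x - J x"
proof -
  define G where "G = (\<lambda>x. (x, A x)) ` D"
  have sG: "subspace G"
  proof (rule subspaceI)
    show "0 \<in> G" using zero_D by (auto simp: G_def zero_prod_def image_iff intro!: bexI[of _ 0])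
    show "p + q \<in> G" if "p \<in> G" "q \<in> G" for p q
      using that by (auto simp: G_def add add_D image_iff intro!: bexI)
    show "c *\<^sub>R p \<in> G" if "p \<in> G" for p c
      using that by (auto simp: G_def scale scale_D image_iff intro!: bexI)
  qed
  have cG: "complete G"
    unfolding complete_def
  proof (intro allI impI, elim conjE)
    fix s assume s: "\<forall>n. s n \<in> G" "Cauchy s"
    have "Cauchy (\<lambda>n. fst (s n))" "Cauchy (\<lambda>n. snd (s n))"
      using s(2) by (auto intro: bounded_linear.Cauchy bounded_linear_fst bounded_linear_snd)
    then obtain a b where ab: "(\<lambda>n. fst (s n)) \<longlonglongrightarrow> a" "(\<lambda>n. snd (s n)) \<longlonglongrightarrow> b"
      by (auto dest!: Cauchy_convergent simp: convergent_def)
    have sn: "fst (s n) \<in> D" "snd (s n) = A (fst (s n))" for n using s(1)[rule_format, of n] by (auto simp: G_def)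
    then have "a \<in> D" "A a = b" using closed_graph[of "\<lambda>n. fst (s n)" a b] ab by auto
    moreover have "s \<longlonglongrightarrow> (a, b)" using tendsto_Pair[OF ab] by simp
    ultimately show "\<exists>l\<in>G. s \<longlonglongrightarrow> l" by (auto simp: G_def)
  qed
  note pG = sG cG
  define J where "J h = fst (proj G (h, 0))" for h
  define S where "S h = snd (proj G (h, 0))" for h
  have lin: "linear (\<lambda>h. proj G (h, 0))"
    using linear_compose[of "\<lambda>h. (h, 0)" "proj G"] linear_proj[OF pG]
    by (simp add: o_def linear_iff)
  have J: "linear J" unfolding J_def using linear_compose[OF lin, of fst] by (simp add: o_def linear_iff)
  have S: "linear S" unfolding S_def using linear_compose[OF lin, of snd] by (simp add: o_def linear_iff)
  have n: "norm (proj G (h, 0)) \<le> norm h" for h using norm_proj_le[OF pG, of "(h,0)"] by (simp add: norm_Pair)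
  have nJ: "norm (J h) \<le> norm h" for h using n[of h] norm_fst_le[of "fst (proj G (h, 0))" "snd (proj G (h, 0))"] by (simp add: J_def)
  have nS: "norm (S h) \<le> norm h" for h using n[of h] norm_snd_le[of "snd (proj G (h, 0))" "fst (proj G (h, 0))"] by (simp add: S_def)
  have "\<exists>x\<in>D. proj G (h, 0) = (x, A x)" for h
    using proj_mem[OF pG, of "(h, 0)"] by (auto simp: G_def)
  then have JS: "J h \<in> D" "A (J h) = S h" for h unfolding J_def S_def by (metis fst_conv snd_conv)+
  \<comment> \<open>Orthogonality of \<open>(h, 0) - (J h, S h)\<close> to the graph is exactly the
    statement that \<open>S h\<close> lies in the domain of the adjoint with value
    \<open>h - J h\<close>.\<close>
  have "A x \<bullet> S h = x \<bullet> (h - J h)" if "x \<in> D" for x h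
  proof -
    have "((h, 0) - proj G (h, 0)) \<bullet> (x, A x) = 0"
      by (rule proj_orthogonal[OF pG]) (use that in \<open>auto simp: G_def\<close>)
    then show ?thesis by (simp add: inner_prod_def J_def S_def inner_diff inner_commute)
  qed
  then have "S h \<in> D" "A (S h) = h - J h" for h using adjointD by blast+
  then show thesis using that[OF J S nJ nS JS] by blast
qed

text \<open>\<open>S\<close> is formally \<open>s / (1 + s\<^sup>2)\<close> evaluated at
  \<open>A\<close>, a bounded operator with the sign of \<open>A\<close>; its negative space serves
  for \<open>A\<close>. The last property, invariance under operators commuting with
  \<open>A\<close>, later makes the spectral projections for different levels commute.\<close>

lemma negative_space_exists:
  obtains N where "subspace N" "complete N"
    "\<And>x. x \<in> D \<Longrightarrow> proj N x \<in> D" "\<And>x. x \<in> D \<Longrightarrow> A (proj N x) = proj N (A x)"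
    "\<And>x. x \<in> D \<Longrightarrow> x \<in> N \<Longrightarrow> A x \<bullet> x \<le> 0"
    "\<And>x. x \<in> D \<Longrightarrow> proj N x = 0 \<Longrightarrow> x \<noteq> 0 \<Longrightarrow> 0 < A x \<bullet> x"
    "\<And>C x. linear C \<Longrightarrow> continuous_on UNIV C \<Longrightarrow> (\<And>x. x \<in> D \<Longrightarrow> C x \<in> D \<and> A (C x) = C (A x))
       \<Longrightarrow> x \<in> N \<Longrightarrow> C x \<in> N"
proof -
  obtain J S where J: "linear J" and S: "linear S" and nJ: "\<And>x. norm (J x) \<le> norm x"
    and nS: "\<And>x. norm (S x) \<le> norm x" and JD: "\<And>x. J x \<in> D" and AJ: "\<And>x. A (J x) = S x"
    and SD: "\<And>x. S x \<in> D" and AS: "\<And>x. A (S x) = x - J x"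
    using graph_projection by blast
  \<comment> \<open>\<open>1 + A\<^sup>2\<close> is injective. All commutation relations of
    \<open>J\<close> and \<open>S\<close> are read off from this.\<close>
  have J_unique: "J h = y" if y: "y \<in> D" "A y \<in> D" "y + A (A y) = h" for y h
  proof -
    define z where "z = J h - y"
    have z: "z \<in> D" "A z \<in> D" using y JD SD by (auto simp: z_def diff AJ diff_D)
    have "z + A (A z) = 0" using y JD SD by (simp add: z_def diff AJ AS algebra_simps)
    then have "(z + A (A z)) \<bullet> z = 0" by simp
    then have "z \<bullet> z + A z \<bullet> A z = 0" using symmetric[OF z(2,1)] by (simp add: inner_add_left)
    then have "z \<bullet> z = 0" using inner_ge_zero[of z] inner_ge_zero[of "A z"] by linarith
    then show ?thesis by (simp add: z_def)
  qed
  have JA: "J (A x) = S x" if "x \<in> D" for x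
    by (rule J_unique) (use that in \<open>simp_all add: SD AS diff_D JD diff AJ\<close>)
  have SA: "S (A x) = x - J x" if "x \<in> D" for x
    using AJ[of "A x"] by (simp add: JA that AS)
  have symJ: "J x \<bullet> y = x \<bullet> J y" for x y
  proof -
    have "J x \<bullet> y = J x \<bullet> J y + J x \<bullet> A (S y)" by (simp add: AS inner_diff_right)
    also have "J x \<bullet> A (S y) = S x \<bullet> S y" using symmetric[OF JD SD] by (simp add: AJ)
    also have "S x \<bullet> S y = A (S x) \<bullet> J y" using symmetric[OF SD JD] by (simp add: AJ)
    finally show ?thesis by (simp add: AS inner_diff_left)
  qed
  have symS: "S x \<bullet> y = x \<bullet> S y" for x y
  proof -
    have "S x \<bullet> y = S x \<bullet> J y + S x \<bullet> A (S y)" by (simp add: AS inner_diff_right)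
    also have "S x \<bullet> J y = J x \<bullet> S y" using symmetric[OF JD JD, of x y] by (simp add: AJ)
    also have "S x \<bullet> A (S y) = A (S x) \<bullet> S y" using symmetric[OF SD SD, of x y] by simp
    finally show ?thesis by (simp add: AS inner_diff_left)
  qed
  have comm: "C (J x) = J (C x)" "C (S x) = S (C x)"
    if C: "linear C" "\<And>x. x \<in> D \<Longrightarrow> C x \<in> D \<and> A (C x) = C (A x)" for C x
  proof -
    have "J (C x) = C (J x)"
      by (rule J_unique) (use C JD SD in \<open>simp_all add: AJ AS linear_diff\<close>)
    then show "C (J x) = J (C x)" by simp
    then show "C (S x) = S (C x)" using C(2)[OF JD, of x] by (simp add: AJ)
  qed
  have JS: "J (S x) = S (J x)" for x by (rule comm(2)[OF J]) (simp add: JD AJ JA)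
  obtain N where N: "subspace N" "complete N" and neg: "\<And>x. x \<in> N \<Longrightarrow> S x \<bullet> x \<le> 0"
    and pos: "\<And>x. proj N x = 0 \<Longrightarrow> 0 \<le> S x \<bullet> x" "\<And>x. proj N x = 0 \<Longrightarrow> S x \<bullet> x = 0 \<Longrightarrow> x = 0"
    and inv: "\<And>C x. linear C \<Longrightarrow> continuous_on UNIV C \<Longrightarrow> (\<And>x. C (S x) = S (C x)) \<Longrightarrow> x \<in> N \<Longrightarrow> C x \<in> N"
    by (rule bounded_negative_space_exists[OF S symS nS]) blast
  have cJ: "continuous_on UNIV J" using linear_bounded_continuous[OF J, of 1] nJ by simp
  have cS: "continuous_on UNIV S" using linear_bounded_continuous[OF S, of 1] nS by simp
  have PJ: "proj N (J x) = J (proj N x)" for x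
    by (rule proj_commute[OF N J symJ]) (rule inv[OF J cJ JS])
  have PS: "proj N (S x) = S (proj N x)" for x
    by (rule proj_commute[OF N S symS]) (rule inv[OF S cS refl])
  note P_add = linear_add[OF linear_proj[OF N]] and P_diff = linear_diff[OF linear_proj[OF N]]
  \<comment> \<open>The identity \<open>x = J x + S (A x)\<close> is projected; since
    \<open>J\<close> and \<open>S\<close> map into \<open>D\<close>, this shows that the projection
    preserves \<open>D\<close>.\<close>
  have Px: "proj N x = J (proj N x) + S (proj N (A x))" if "x \<in> D" for x
    using P_add[of "J x" "S (A x)"] unfolding PJ PS by (simp add: SA that)
  have PD: "proj N x \<in> D" if "x \<in> D" for x
    by (subst Px[OF that]) (simp add: JD SD add_D)
  have AP: "A (proj N x) = proj N (A x)" if "x \<in> D" for x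
  proof -
    have "A (proj N x) = S (proj N x) + (proj N (A x) - J (proj N (A x)))"
      by (subst Px[OF that]) (simp add: add JD SD AJ AS)
    also have "J (proj N (A x)) = S (proj N x)" by (simp add: JA that flip: PJ PS)
    finally show ?thesis by simp
  qed
  \<comment> \<open>On the spectral side this is
    \<open>s = s / (1 + s\<^sup>2) + s * (s / (1 + s\<^sup>2)) * s\<close>; it transfers the sign of
    the form of \<open>S\<close> to that of \<open>A\<close>.\<close>
  have form: "A x \<bullet> x = S x \<bullet> x + S (A x) \<bullet> A x" if "x \<in> D" for x
  proof -
    have "A x \<bullet> x = A x \<bullet> (J x + S (A x))" by (simp add: SA that)
    also have "\<dots> = S x \<bullet> x + S (A x) \<bullet> A x"
      using symJ[of "A x" x] by (simp add: inner_add_right JA that inner_commute[of "A x" "S (A x)"])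
    finally show ?thesis .
  qed
  show thesis
  proof (rule that[OF N PD AP])
    show "A x \<bullet> x \<le> 0" if x: "x \<in> D" "x \<in> N" for x
    proof -
      have "A x \<in> N" using AP[OF x(1)] proj_id[OF N x(2)] proj_mem[OF N, of "A x"] by simp
      then show ?thesis using form[OF x(1)] neg[OF x(2)] neg[of "A x"] by simp
    qed
    show "0 < A x \<bullet> x" if x: "x \<in> D" "proj N x = 0" "x \<noteq> 0" for x
    proof -
      have "proj N (A x) = 0" using AP[OF x(1)] x(2) by simp
      then show ?thesis using form[OF x(1)] pos[OF x(2)] pos(1)[of "A x"] x(3) by force
    qed
    show "C x \<in> N" if C: "linear C" "continuous_on UNIV C"
      "\<And>x. x \<in> D \<Longrightarrow> C x \<in> D \<and> A (C x) = C (A x)" "x \<in> N" for C x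
      by (rule inv[OF C(1,2) comm(2)[OF C(1,3)] C(4)])
  qed
qed

end

section \<open>Spectral families\<close>

text \<open>For orthogonal increments the squared norms add up to a scalar sequence, whose
  convergence then carries over to the vectors.\<close>

lemma Cauchy_of_square_increments:
  fixes u :: "nat \<Rightarrow> 'a::real_normed_vector" and q :: "nat \<Rightarrow> real"
  assumes q: "Cauchy q" and le: "\<And>m n. m \<le> n \<Longrightarrow> (norm (u m - u n))\<^sup>2 \<le> \<bar>q m - q n\<bar>"
  shows "Cauchy u"
proof (rule CauchyI)
  fix e :: real assume e: "e > 0"
  obtain M where M: "\<And>m n. m \<ge> M \<Longrightarrow> n \<ge> M \<Longrightarrow> norm (q m - q n) < e\<^sup>2"
    using CauchyD[OF q, of "e\<^sup>2"] e by auto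
  have *: "norm (u m - u n) < e" if "m \<ge> M" "n \<ge> M" "m \<le> n" for m n
  proof -
    have "(norm (u m - u n))\<^sup>2 < e\<^sup>2" using M[OF that(1,2)] le[OF that(3)] by simp
    then show ?thesis using e by (simp add: power2_less_imp_less)
  qed
  show "\<exists>M. \<forall>m\<ge>M. \<forall>n\<ge>M. norm (u m - u n) < e"
    using * by (metis nle_le norm_minus_commute)
qed

text \<open>The norm of a symmetric operator is controlled by its quadratic form, by polarization
  and the parallelogram law. \<open>V\<close> may be the domain part of a closed subspace: the value
  \<open>S x\<close> only has to be a limit of vectors of \<open>V\<close>, against which it can be
  tested.\<close>

lemma form_norm_le:
  fixes V :: "'a::real_inner set"
  assumes V: "subspace V" and add: "\<And>x y. x \<in> V \<Longrightarrow> y \<in> V \<Longrightarrow> S (x + y) = S x + S y"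
    and diff: "\<And>x y. x \<in> V \<Longrightarrow> y \<in> V \<Longrightarrow> S (x - y) = S x - S y"
    and sym: "\<And>x y. x \<in> V \<Longrightarrow> y \<in> V \<Longrightarrow> S x \<bullet> y = x \<bullet> S y"
    and form: "\<And>x. x \<in> V \<Longrightarrow> \<bar>S x \<bullet> x\<bar> \<le> c * (norm x)\<^sup>2" and x: "x \<in> V" and Sx: "S x \<in> closure V"
  shows "norm (S x) \<le> c * norm x"
proof -
  have c: "0 \<le> c * norm x"
  proof (cases "x = 0")
    case False
    have "0 \<le> c * (norm x)\<^sup>2" using form[OF x] by linarith
    then show ?thesis using False by (simp add: zero_le_mult_iff)
  qed simp
  have main: "S x \<bullet> y \<le> c * norm x * norm y" if y: "y \<in> V" for y
  proof (cases "x = 0 \<or> y = 0")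
    case True
    have "S 0 = 0" using diff[OF x x] by simp
    then show ?thesis using True by auto
  next
    case False
    \<comment> \<open>Rescaling \<open>y\<close> to the length of \<open>x\<close> makes the
      parallelogram bound sharp.\<close>
    define r where "r = norm x / norm y"
    have r: "r > 0" using False by (simp add: r_def)
    define z where "z = r *\<^sub>R y"
    have z: "z \<in> V" using V y by (simp add: z_def subspace_scale)
    have nz: "norm z = norm x" using False by (simp add: z_def r_def)
    have "4 * (S x \<bullet> z) = S (x + z) \<bullet> (x + z) - S (x - z) \<bullet> (x - z)"
      using sym[OF z x] by (simp add: add[OF x z] diff[OF x z] inner_add inner_diff inner_commute)
    also have "\<dots> \<le> c * (norm (x + z))\<^sup>2 + c * (norm (x - z))\<^sup>2"
      using form[of "x + z"] form[of "x - z"] V x z by (simp add: subspace_add subspace_diff abs_le_iff)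
    also have "\<dots> = c * (2 * (norm x)\<^sup>2 + 2 * (norm z)\<^sup>2)"
      unfolding power2_norm_eq_inner by (simp add: inner_add inner_diff inner_commute algebra_simps)
    finally have "S x \<bullet> z \<le> c * (norm x)\<^sup>2" by (simp add: nz algebra_simps)
    then have "r * (S x \<bullet> y) \<le> r * (c * norm x * norm y)"
      using False by (simp add: z_def r_def power2_eq_square mult.assoc mult.left_commute)
    then show ?thesis using r by simp
  qed
  have "closed {y. S x \<bullet> y \<le> c * norm x * norm y}" by (intro closed_Collect_le continuous_intros)
  then have "closure V \<subseteq> {y. S x \<bullet> y \<le> c * norm x * norm y}" using main by (intro closure_minimal) auto
  then have "S x \<bullet> S x \<le> c * norm x * norm (S x)" using Sx by blast
  then have "norm (S x) * norm (S x) \<le> c * norm x * norm (S x)" by (simp add: dot_square_norm power2_eq_square)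
  then show ?thesis using c by (cases "S x = 0") auto
qed

text \<open>Summing over \<open>n\<close> equal parts, one factor of the bound is the mesh and the
  other telescopes, so the total increment is at most a constant over \<open>n\<close>. This
  replaces limits of Riemann-Stieltjes sums in the integral formulas.\<close>

lemma increments_bound_const:
  fixes \<Phi> F :: "real \<Rightarrow> real"
  assumes ab: "a \<le> b" and bound: "\<And>s t. a \<le> s \<Longrightarrow> s \<le> t \<Longrightarrow> t \<le> b \<Longrightarrow> \<bar>\<Phi> t - \<Phi> s\<bar> \<le> K * (t - s) * (F t - F s)"
  shows "\<Phi> b = \<Phi> a"
proof -
  define C where "C = K * (b - a) * (F b - F a)"
  have le: "real n * \<bar>\<Phi> b - \<Phi> a\<bar> \<le> C" if n: "n > 0" for n :: nat
  proof -
    define h where "h = (b - a) / real n"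
    define p where "p i = a + real i * h" for i :: nat
    have h: "h \<ge> 0" using ab by (simp add: h_def)
    have pn: "p n = b" using n by (simp add: p_def h_def)
    have p: "a \<le> p i" "p i \<le> p (Suc i)" "p (Suc i) - p i = h" for i
      using h by (auto simp: p_def algebra_simps)
    have pb: "p i \<le> b" if "i \<le> n" for i
      using lift_Suc_mono_le[of p, OF p(2) that] pn by simp
    have "\<bar>\<Phi> b - \<Phi> a\<bar> = \<bar>\<Sum>i<n. \<Phi> (p (Suc i)) - \<Phi> (p i)\<bar>"
      using pn by (simp add: sum_lessThan_telescope[of "\<lambda>i. \<Phi> (p i)"]) (simp add: p_def)
    also have "\<dots> \<le> (\<Sum>i<n. \<bar>\<Phi> (p (Suc i)) - \<Phi> (p i)\<bar>)" by (rule sum_abs)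
    also have "\<dots> \<le> (\<Sum>i<n. K * h * (F (p (Suc i)) - F (p i)))"
    proof (rule sum_mono)
      fix i assume "i \<in> {..<n}"
      then show "\<bar>\<Phi> (p (Suc i)) - \<Phi> (p i)\<bar> \<le> K * h * (F (p (Suc i)) - F (p i))"
        using bound[OF p(1,2), of i] pb[of "Suc i"] by (simp add: p(3))
    qed
    also have "\<dots> = K * h * (F b - F a)"
      unfolding sum_distrib_left[symmetric] sum_lessThan_telescope[of "\<lambda>i. F (p i)"] pn by (simp add: p_def)
    finally show ?thesis using n by (simp add: C_def h_def field_simps)
  qed
  show ?thesis
  proof (rule ccontr)
    assume "\<Phi> b \<noteq> \<Phi> a"
    then have pos: "\<bar>\<Phi> b - \<Phi> a\<bar> > 0" by simp
    obtain n :: nat where "\<bar>C\<bar> / \<bar>\<Phi> b - \<Phi> a\<bar> < real n" using reals_Archimedean2 by blast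
    then have "\<bar>C\<bar> < real n * \<bar>\<Phi> b - \<Phi> a\<bar>" using pos by (simp add: field_simps)
    moreover then have "n > 0" by (cases n) auto
    ultimately show False using le[of n] by linarith
  qed
qed

text \<open>\<open>N l\<close> plays the part of the spectral subspace for
  \<open>(-\<infinity>, l]\<close>. The weak inequality inside and the strict one on the complement
  fix on which side an eigenvalue \<open>l\<close> falls, and thereby yield right
  continuity.\<close>

locale spectral_family = self_adjoint_operator D A
  for D :: "'a::{real_inner,complete_space} set" and A +
  fixes N :: "real \<Rightarrow> 'a set"
  assumes subspace_N: "subspace (N l)" and complete_N: "complete (N l)"
    and proj_D: "x \<in> D \<Longrightarrow> proj (N l) x \<in> D"
    and proj_A: "x \<in> D \<Longrightarrow> A (proj (N l) x) = proj (N l) (A x)"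
    and form_le: "x \<in> D \<Longrightarrow> x \<in> N l \<Longrightarrow> A x \<bullet> x \<le> l * (x \<bullet> x)"
    and form_gt: "x \<in> D \<Longrightarrow> proj (N l) x = 0 \<Longrightarrow> x \<noteq> 0 \<Longrightarrow> l * (x \<bullet> x) < A x \<bullet> x"
    and invariant: "linear C \<Longrightarrow> continuous_on UNIV C \<Longrightarrow> (\<And>x. x \<in> D \<Longrightarrow> C x \<in> D \<and> A (C x) = C (A x))
       \<Longrightarrow> x \<in> N l \<Longrightarrow> C x \<in> N l"

lemma (in self_adjoint_operator) spectral_family_exists:
  obtains N where "spectral_family D A N"
proof -
  define good where "good l N \<longleftrightarrow> subspace N \<and> complete N \<and>
    (\<forall>x\<in>D. proj N x \<in> D \<and> A (proj N x) = proj N (A x) \<and> (x \<in> N \<longrightarrow> A x \<bullet> x \<le> l * (x \<bullet> x))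
      \<and> (proj N x = 0 \<and> x \<noteq> 0 \<longrightarrow> l * (x \<bullet> x) < A x \<bullet> x)) \<and>
    (\<forall>C. linear C \<longrightarrow> continuous_on UNIV C \<longrightarrow> (\<forall>x\<in>D. C x \<in> D \<and> A (C x) = C (A x)) \<longrightarrow> C ` N \<subseteq> N)"
    for l :: real and N
  have "\<exists>N. good l N" for l
  proof -
    interpret T: self_adjoint_operator D "\<lambda>x. A x - l *\<^sub>R x"
      by unfold_locales (rule self_adjoint_diff[OF self_adjoint]; simp)
    obtain N where N: "subspace N" "complete N" and P: "\<And>x. x \<in> D \<Longrightarrow> proj N x \<in> D"
      "\<And>x. x \<in> D \<Longrightarrow> A (proj N x) - l *\<^sub>R proj N x = proj N (A x - l *\<^sub>R x)"
      "\<And>x. x \<in> D \<Longrightarrow> x \<in> N \<Longrightarrow> (A x - l *\<^sub>R x) \<bullet> x \<le> 0"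
      "\<And>x. x \<in> D \<Longrightarrow> proj N x = 0 \<Longrightarrow> x \<noteq> 0 \<Longrightarrow> 0 < (A x - l *\<^sub>R x) \<bullet> x"
      "\<And>C x. linear C \<Longrightarrow> continuous_on UNIV C \<Longrightarrow> 
        (\<And>x. x \<in> D \<Longrightarrow> C x \<in> D \<and> A (C x) - l *\<^sub>R C x = C (A x - l *\<^sub>R x)) \<Longrightarrow> x \<in> N \<Longrightarrow> C x \<in> N"
      using T.negative_space_exists by blast
    have "good l N"
      unfolding good_def
    proof (intro conjI ballI allI impI subsetI)
      fix x assume x: "x \<in> D"
      show "A (proj N x) = proj N (A x)"
        using P(2)[OF x] by (simp add: linear_diff[OF linear_proj[OF N]] linear_scale[OF linear_proj[OF N]])
      show "A x \<bullet> x \<le> l * (x \<bullet> x)" if "x \<in> N" using P(3)[OF x that] by (simp add: inner_diff_left)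
      show "l * (x \<bullet> x) < A x \<bullet> x" if "proj N x = 0 \<and> x \<noteq> 0" using P(4)[OF x] that by (simp add: inner_diff_left)
    next
      fix C y assume C: "linear C" "continuous_on UNIV C" "\<forall>x\<in>D. C x \<in> D \<and> A (C x) = C (A x)" and y: "y \<in> C ` N"
      then obtain x where x: "x \<in> N" "y = C x" by blast
      have "C x \<in> N" by (rule P(5)[OF C(1,2) _ x(1)]) (use C in \<open>simp add: linear_diff linear_scale\<close>)
      then show "y \<in> N" using x by simp
    qed (use N P in auto)
    then show ?thesis ..
  qed
  then obtain N where N: "\<And>l. good l (N l)" by metis
  have "spectral_family D A N"
  proof
    fix l C x assume "linear C" "continuous_on UNIV C" "\<And>x. x \<in> D \<Longrightarrow> C x \<in> D \<and> A (C x) = C (A x)" "x \<in> N l"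
    then show "C x \<in> N l" using N[of l] unfolding good_def by (metis image_subset_iff)
  qed (use N in \<open>auto simp: good_def\<close>)
  then show thesis by (rule that)
qed

context spectral_family
begin

abbreviation E :: "real \<Rightarrow> 'a \<Rightarrow> 'a" where "E l \<equiv> proj (N l)"

lemmas E_linear = linear_proj[OF subspace_N complete_N]
  and E_inner = proj_inner[OF subspace_N complete_N]
  and E_mem = proj_mem[OF subspace_N complete_N]
  and E_id = proj_id[OF subspace_N complete_N]
  and norm_E = norm_proj_le[OF subspace_N complete_N]
  and E_pythagoras = proj_pythagoras[OF subspace_N complete_N]
  and E_continuous = linear_continuous_on[OF bounded_linear_proj[OF subspace_N complete_N]]

lemma E_idem: "E l (E l x) = E l x" by (rule E_id) (rule E_mem)

lemmas E_add = linear_add[OF E_linear] and E_diff = linear_diff[OF E_linear]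
  and E_scale = linear_scale[OF E_linear] and E_0 [simp] = linear_0[OF E_linear]

lemma E_commute: "E l (E m x) = E m (E l x)"
proof (rule proj_commute[OF subspace_N complete_N E_linear E_inner])
  show "E m x \<in> N l" if "x \<in> N l" for x
    using that by (intro invariant[OF E_linear E_continuous]) (auto simp: proj_D proj_A)
qed

lemma dense_eq:
  assumes "continuous_on UNIV f" "continuous_on UNIV g" "\<And>x. x \<in> D \<Longrightarrow> f x = g x"
  shows "f x = (g x :: 'b::t2_space)"
proof -
  have "closed {x. f x = g x}" by (rule closed_Collect_eq[OF assms(1,2)])
  then have "closure D \<subseteq> {x. f x = g x}" using assms(3) by (intro closure_minimal) auto
  then show ?thesis using dense by blast
qed

text \<open>A nonzero domain vector in \<open>N l\<close> orthogonal to \<open>N m\<close> would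
  have its form at most \<open>l\<close> and above \<open>m\<close> times its squared norm. Density
  of \<open>D\<close> does the rest.\<close>

lemma E_mono:
  assumes "l \<le> m" shows "E m (E l x) = E l x"
proof (rule dense_eq[where f = "\<lambda>x. E m (E l x)"])
  show "continuous_on UNIV (\<lambda>x. E m (E l x))" 
    using continuous_on_compose2[OF E_continuous E_continuous] by blast
  fix x assume x: "x \<in> D"
  define y where "y = E l x - E m (E l x)"
  have yD: "y \<in> D" using x by (simp add: y_def proj_D diff_D)
  have "E l y = y" by (simp add: y_def E_diff E_idem E_commute[of l m])
  then have yN: "y \<in> N l" using E_mem[of l y] by simp
  have "E m y = 0" by (simp add: y_def E_diff E_idem)
  then have "y = 0" using form_le[OF yD yN] form_gt[OF yD] mult_right_mono[OF assms inner_ge_zero[of y]] by force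
  then show "E m (E l x) = E l x" by (simp add: y_def)
qed (rule E_continuous)

lemma E_mono': "l \<le> m \<Longrightarrow> E l (E m x) = E l x"
  using E_mono E_commute[of l m] by simp

text \<open>The spectral subspace for the half-open interval \<open>(s, t]\<close>.\<close>

definition R :: "real \<Rightarrow> real \<Rightarrow> 'a set" where
  "R s t = {y. E t y = y \<and> E s y = 0}"

lemma R_mem: "s \<le> t \<Longrightarrow> E t x - E s x \<in> R s t"
  by (simp add: R_def E_diff E_idem E_mono E_commute[of s t])

lemma R_subspace: "subspace (R s t)"
  by (auto simp: R_def subspace_def E_add E_scale)

lemma R_closure:
  assumes st: "s \<le> t" and y: "y \<in> R s t" shows "y \<in> closure (R s t \<inter> D)"
proof -
  obtain u where u: "\<And>n. u n \<in> D" "u \<longlonglongrightarrow> y" using dense closure_sequential[of y D] by auto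
  have "(\<lambda>n. E l (u n)) \<longlonglongrightarrow> E l y" for l
    by (rule continuous_on_tendsto_compose[OF E_continuous[of UNIV] u(2)]) auto
  then have "(\<lambda>n. E t (u n) - E s (u n)) \<longlonglongrightarrow> E t y - E s y"
    by (intro tendsto_diff)
  moreover have "E t (u n) - E s (u n) \<in> R s t \<inter> D" for n using u R_mem[OF st] by (simp add: diff_D proj_D)
  moreover have "E t y - E s y = y" using y by (simp add: R_def)
  ultimately show ?thesis unfolding closure_sequential
    by (intro exI[of _ "\<lambda>n. E t (u n) - E s (u n)"]) auto
qed

lemma R_form:
  assumes "y \<in> R s t" "y \<in> D" shows "s * (y \<bullet> y) \<le> A y \<bullet> y" "A y \<bullet> y \<le> t * (y \<bullet> y)"
proof -
  show "s * (y \<bullet> y) \<le> A y \<bullet> y" using form_gt[OF assms(2), of s] assms(1) by (cases "y = 0") (auto simp: R_def)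
  have "y \<in> N t" using assms(1) E_mem[of t y] by (simp add: R_def)
  then show "A y \<bullet> y \<le> t * (y \<bullet> y)" using form_le assms by blast
qed

lemma R_A: "y \<in> R s t \<Longrightarrow> y \<in> D \<Longrightarrow> A y \<in> R s t"
  using proj_A[of y s] proj_A[of y t] by (simp add: R_def)

lemma R_norm_D:
  assumes st: "s \<le> t" and y: "y \<in> R s t" "y \<in> D" and l: "s \<le> l" "l \<le> t"
  shows "norm (A y - l *\<^sub>R y) \<le> (t - s) * norm y"
proof (rule form_norm_le[where V = "R s t \<inter> D"])
  show "subspace (R s t \<inter> D)" using R_subspace subspace_D by (simp add: subspace_inter)
  show "\<bar>(A x - l *\<^sub>R x) \<bullet> x\<bar> \<le> (t - s) * (norm x)\<^sup>2" if "x \<in> R s t \<inter> D" for x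
    using R_form[of x s t] that mult_right_mono[OF l(1) inner_ge_zero[of x]] mult_right_mono[OF l(2) inner_ge_zero[of x]]
    by (simp add: power2_norm_eq_inner inner_diff_left abs_le_iff algebra_simps)
  have "A y - l *\<^sub>R y \<in> R s t" using R_A[OF y] y(1) R_subspace by (simp add: subspace_diff subspace_scale)
  then show "A y - l *\<^sub>R y \<in> closure (R s t \<inter> D)" by (rule R_closure[OF st])
qed (use y in \<open>auto simp: add diff algebra_simps inner_diff symmetric\<close>)

text \<open>\<open>A\<close> is bounded on the dense part \<open>R s t \<inter> D\<close>, and
  \<open>A\<close> is closed; so the domain contains all of \<open>R s t\<close>.\<close>

lemma R_D:
  assumes st: "s \<le> t" and y: "y \<in> R s t" shows "y \<in> D"
proof -
  obtain u where u: "\<And>n. u n \<in> R s t \<inter> D" "u \<longlonglongrightarrow> y"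
    using R_closure[OF st y] unfolding closure_sequential by blast
  have "Cauchy (\<lambda>n. A (u n) - s *\<^sub>R u n)"
  proof (rule CauchyI)
    fix e :: real assume e: "e > 0"
    define K where "K = t - s + 1"
    have K: "K > 0" using st by (simp add: K_def)
    obtain M where M: "\<And>m n. m \<ge> M \<Longrightarrow> n \<ge> M \<Longrightarrow> norm (u m - u n) < e / K"
      using LIMSEQ_imp_Cauchy[OF u(2)] e K by (meson CauchyD divide_pos_pos)
    have "norm ((A (u m) - s *\<^sub>R u m) - (A (u n) - s *\<^sub>R u n)) < e" if "m \<ge> M" "n \<ge> M" for m n
    proof -
      have d: "u m - u n \<in> R s t" "u m - u n \<in> D" using u(1) R_subspace by (auto simp: subspace_diff diff_D)
      have "(A (u m) - s *\<^sub>R u m) - (A (u n) - s *\<^sub>R u n) = A (u m - u n) - s *\<^sub>R (u m - u n)"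
        using u(1) by (simp add: diff algebra_simps)
      then have "norm ((A (u m) - s *\<^sub>R u m) - (A (u n) - s *\<^sub>R u n)) \<le> (t - s) * norm (u m - u n)"
        using R_norm_D[OF st d, of s] st by simp
      also have "\<dots> \<le> K * norm (u m - u n)" by (intro mult_right_mono) (auto simp: K_def)
      also have "\<dots> < e" using M[OF that] K by (simp add: field_simps)
      finally show ?thesis .
    qed
    then show "\<exists>M. \<forall>m\<ge>M. \<forall>n\<ge>M. norm ((A (u m) - s *\<^sub>R u m) - (A (u n) - s *\<^sub>R u n)) < e" by blast
  qed
  then obtain z where "(\<lambda>n. A (u n) - s *\<^sub>R u n) \<longlonglongrightarrow> z" using Cauchy_convergent convergent_def by blast
  from tendsto_add[OF this tendsto_scaleR[OF tendsto_const u(2), of s]]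
  have "(\<lambda>n. A (u n)) \<longlonglongrightarrow> z + s *\<^sub>R y" by simp
  then show ?thesis using closed_graph[of u y] u by blast
qed

lemma R_norm: "s \<le> t \<Longrightarrow> y \<in> R s t \<Longrightarrow> s \<le> l \<Longrightarrow> l \<le> t \<Longrightarrow> norm (A y - l *\<^sub>R y) \<le> (t - s) * norm y"
  using R_norm_D R_D by blast

lemma dense_null_sequence:
  assumes "\<And>n. linear (T n)" "\<And>n x. norm (T n x) \<le> norm x" "\<And>x. x \<in> D \<Longrightarrow> (\<lambda>n::nat. T n x) \<longlonglongrightarrow> (0::'a)"
  shows "(\<lambda>n. T n x) \<longlonglongrightarrow> 0"
proof (rule LIMSEQ_I)
  fix r :: real assume r: "r > 0"
  have "x \<in> closure D" using dense by simp
  then obtain y where y: "y \<in> D" "dist y x < r / 2" using r unfolding closure_approachable by (meson half_gt_zero)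
  obtain M where M: "\<And>n. n \<ge> M \<Longrightarrow> norm (T n y) < r / 2"
    using LIMSEQ_D[OF assms(3)[OF y(1)], of "r/2"] r by auto
  have "norm (T n x) < r" if "n \<ge> M" for n
  proof -
    have "T n x = T n y + T n (x - y)" by (simp add: linear_diff[OF assms(1)])
    then have "norm (T n x) \<le> norm (T n y) + norm (x - y)"
      using norm_triangle_ineq[of "T n y" "T n (x - y)"] assms(2)[of n "x - y"] by simp
    then show ?thesis using M[OF that] y(2) by (simp add: dist_norm norm_minus_commute)
  qed
  then show "\<exists>M. \<forall>n\<ge>M. norm (T n x - 0) < r" by auto
qed

lemma norm_E_diff: "s \<le> t \<Longrightarrow> (norm (E t x - E s x))\<^sup>2 = E t x \<bullet> x - E s x \<bullet> x"
proof -
  assume st: "s \<le> t"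
  have "E t x \<bullet> E t x = E t x \<bullet> x" "E s x \<bullet> E s x = E s x \<bullet> x" "E t x \<bullet> E s x = E s x \<bullet> x"
    using E_inner[of t x "E t x"] E_inner[of s x "E s x"] E_inner[of t x "E s x"] E_mono[OF st, of x]
    by (simp_all add: E_idem inner_commute)
  then show ?thesis by (simp add: power2_norm_eq_inner inner_diff inner_commute)
qed

lemma norm_E_diff_le: "s \<le> t \<Longrightarrow> norm (E t x - E s x) \<le> norm x"
  using norm_E[of t "x - E s x"] E_pythagoras[of x s] 
  by (simp add: E_diff E_mono) (smt (verit) norm_ge_zero power2_le_imp_le zero_le_power2)

text \<open>For \<open>x\<close> in \<open>D\<close>, the component below \<open>- n\<close> has a
  form at most \<open>- n\<close> times its squared norm, while \<open>A\<close> of it is no longer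
  than \<open>A x\<close>; its norm is thus at most \<open>norm (A x) / n\<close>. The top end is
  treated in the same way.\<close>

lemma E_at_bot: "(\<lambda>n. E (- real n) x) \<longlonglongrightarrow> 0"
proof (rule dense_null_sequence[OF E_linear norm_E])
  fix x assume x: "x \<in> D"
  have "norm (E (- real n) x) \<le> norm (A x) / real n" if n: "n > 0" for n
  proof -
    define y where "y = E (- real n) x"
    have yD: "y \<in> D" and yN: "y \<in> N (- real n)" using x by (auto simp: y_def proj_D E_mem)
    have "real n * (y \<bullet> y) \<le> - (A y \<bullet> y)" using form_le[OF yD yN] by simp
    also have "\<dots> \<le> norm (A y) * norm y" using Cauchy_Schwarz_ineq2[of "A y" y] by linarith
    also have "\<dots> \<le> norm (A x) * norm y" unfolding y_def using x by (intro mult_right_mono) (auto simp: proj_A norm_E)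
    finally have "real n * norm y * norm y \<le> norm (A x) * norm y" by (simp add: dot_square_norm power2_eq_square)
    then have "real n * norm y \<le> norm (A x)" by (cases "y = 0") auto
    then show ?thesis using n by (simp add: y_def field_simps)
  qed
  then have "\<forall>\<^sub>F n in sequentially. norm (E (- real n) x) \<le> norm (A x) / real n"
    by (intro eventually_sequentiallyI[of 1]) auto
  then show "(\<lambda>n. E (- real n) x) \<longlonglongrightarrow> 0"
    by (rule Lim_null_comparison) (rule lim_const_over_n)
qed

lemma E_at_top: "(\<lambda>n. E (real n) x) \<longlonglongrightarrow> x"
proof -
  have "(\<lambda>n. x - E (real n) x) \<longlonglongrightarrow> 0"
  proof (rule dense_null_sequence[where T = "\<lambda>n x. x - E (real n) x"])
    show "linear (\<lambda>x. x - E (real n) x)" for n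
      by (intro linearI) (simp_all add: E_add E_scale algebra_simps)
    show "norm (x - E (real n) x) \<le> norm x" for n x
      by (rule power2_le_imp_le) (use E_pythagoras[of x "real n"] in auto)
    fix x assume x: "x \<in> D"
    have "norm (x - E (real n) x) \<le> norm (A x) / real n" if n: "n > 0" for n
    proof -
      define y where "y = x - E (real n) x"
      have yD: "y \<in> D" and yN: "E (real n) y = 0" using x by (auto simp: y_def proj_D diff_D E_diff E_idem)
      have Ay: "A y = A x - E (real n) (A x)" using x by (simp add: y_def diff proj_D proj_A)
      have "norm (A y) \<le> norm (A x)"
        by (rule power2_le_imp_le) (use E_pythagoras[of "A x" "real n"] Ay in auto)
      then have "norm (A y) * norm y \<le> norm (A x) * norm y" by (rule mult_right_mono) simp
      moreover have "real n * (y \<bullet> y) \<le> A y \<bullet> y" using form_gt[OF yD yN] by (cases "y = 0") auto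
      moreover have "A y \<bullet> y \<le> norm (A y) * norm y" by (rule norm_cauchy_schwarz)
      ultimately have "real n * norm y * norm y \<le> norm (A x) * norm y" by (simp add: dot_square_norm power2_eq_square)
      then have "real n * norm y \<le> norm (A x)" by (cases "y = 0") auto
      then show ?thesis using n by (simp add: y_def field_simps)
    qed
    then have "\<forall>\<^sub>F n in sequentially. norm (x - E (real n) x) \<le> norm (A x) / real n"
      by (intro eventually_sequentiallyI[of 1]) auto
    then show "(\<lambda>n. x - E (real n) x) \<longlonglongrightarrow> 0"
      by (rule Lim_null_comparison) (rule lim_const_over_n)
  qed
  from tendsto_diff[OF tendsto_const this, of x] show ?thesis by simp
qed

definition F :: "'a \<Rightarrow> real \<Rightarrow> real" where "F x l = E l x \<bullet> x"

lemma F_mono: "s \<le> t \<Longrightarrow> F x s \<le> F x t"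
  using norm_E_diff[of s t x] zero_le_power2[of "norm (E t x - E s x)"] unfolding F_def by linarith

text \<open>The components over \<open>(l, l + 1 / (n + 1)]\<close> converge by monotonicity of
  \<open>F\<close>. As \<open>A - l\<close> tends to 0 on them, their limit is an eigenvector for
  \<open>l\<close> or 0; being orthogonal to \<open>N l\<close>, it must vanish by the strict
  inequality \<open>form_gt\<close>.\<close>

lemma E_right_sequence: "(\<lambda>n. E (l + 1 / real (Suc n)) x - E l x) \<longlonglongrightarrow> 0"
proof (rule dense_null_sequence[where T = "\<lambda>n x. E (l + 1 / real (Suc n)) x - E l x"])
  show "linear (\<lambda>x. E (l + 1 / real (Suc n)) x - E l x)" for n
    by (intro linearI) (simp_all add: E_add E_scale algebra_simps)
  show "norm (E (l + 1 / real (Suc n)) x - E l x) \<le> norm x" for n x by (rule norm_E_diff_le) simp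
  fix x assume x: "x \<in> D"
  define p where "p n = l + 1 / real (Suc n)" for n
  have p: "l \<le> p n" for n by (simp add: p_def)
  have pm: "p n \<le> p m" if "m \<le> n" for m n using that by (simp add: p_def field_simps)
  define u where "u n = E (p n) x - E l x" for n
  have uD: "u n \<in> D" "u n \<in> R l (p n)" for n using x p R_mem by (auto simp: u_def proj_D diff_D)
  have conv: "convergent (\<lambda>n. F x (p n))"
  proof (rule Bseq_monoseq_convergent)
    show "monoseq (\<lambda>n. F x (p n))" by (rule monoI2) (use F_mono pm in blast)
    have "norm (F x (p n)) \<le> norm x * norm x" for n
      using Cauchy_Schwarz_ineq2[of "E (p n) x" x] mult_right_mono[OF norm_E[of "p n" x] norm_ge_zero[of x]]
      by (simp add: F_def)
    then show "Bseq (\<lambda>n. F x (p n))" by (intro BseqI') 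
  qed
  have "Cauchy u"
  proof (rule Cauchy_of_square_increments[OF convergent_Cauchy[OF conv]])
    show "(norm (u m - u n))\<^sup>2 \<le> \<bar>F x (p m) - F x (p n)\<bar>" if "m \<le> n" for m n
      using norm_E_diff[OF pm[OF that], of x] by (simp add: u_def F_def)
  qed
  then obtain y where y: "u \<longlonglongrightarrow> y" using Cauchy_convergent convergent_def by blast
  have "(\<lambda>n. A (u n) - l *\<^sub>R u n) \<longlonglongrightarrow> 0"
  proof (rule Lim_null_comparison)
    have "norm (A (u n) - l *\<^sub>R u n) \<le> norm x / real (Suc n)" for n
    proof -
      have "norm (A (u n) - l *\<^sub>R u n) \<le> (p n - l) * norm (u n)" using R_norm_D[OF p uD(2,1)] p by simp
      also have "\<dots> \<le> (p n - l) * norm x"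
        using norm_E_diff_le[OF p[of n], of x] p[of n] by (intro mult_left_mono) (auto simp: u_def)
      finally show ?thesis by (simp add: p_def)
    qed
    then show "\<forall>\<^sub>F n in sequentially. norm (A (u n) - l *\<^sub>R u n) \<le> norm x / real (Suc n)" by simp
    show "(\<lambda>n. norm x / real (Suc n)) \<longlonglongrightarrow> 0"
      using LIMSEQ_Suc[OF lim_const_over_n[of "norm x"]] .
  qed
  from tendsto_add[OF this tendsto_scaleR[OF tendsto_const y, of l]]
  have "(\<lambda>n. A (u n)) \<longlonglongrightarrow> l *\<^sub>R y" by simp
  then have yD: "y \<in> D" "A y = l *\<^sub>R y" using closed_graph[OF uD(1) y] by auto
  have "(\<lambda>n. E l (u n)) \<longlonglongrightarrow> E l y" by (rule continuous_on_tendsto_compose[OF E_continuous[of UNIV] y]) auto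
  moreover have "E l (u n) = 0" for n using uD(2)[of n] by (simp add: R_def)
  ultimately have "E l y = 0" by (simp add: LIMSEQ_const_iff)
  then have "y = 0" using form_gt[OF yD(1), of l] yD(2) by auto
  then show "(\<lambda>n. E (l + 1 / real (Suc n)) x - E l x) \<longlonglongrightarrow> 0" using y unfolding u_def p_def by simp
qed

lemma F_right_continuous: "continuous (at_right l) (F x)"
  unfolding continuous_within
proof (rule tendstoI)
  fix e :: real assume e: "e > 0"
  have "(\<lambda>n. (E (l + 1 / real (Suc n)) x - E l x) \<bullet> x) \<longlonglongrightarrow> 0 \<bullet> x" by (intro tendsto_inner E_right_sequence tendsto_const)
  then have "\<forall>\<^sub>F n in sequentially. dist ((E (l + 1 / real (Suc n)) x - E l x) \<bullet> x) 0 < e"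
    using e by (intro tendstoD) auto
  then obtain n where n: "\<bar>F x (l + 1 / real (Suc n)) - F x l\<bar> < e"
    by (auto simp: F_def inner_diff_left dist_real_def dest: eventually_happens)
  have "\<forall>\<^sub>F m in at_right l. m \<in> {l<..<l + 1 / real (Suc n)}" by (rule eventually_at_right_real) simp
  then show "\<forall>\<^sub>F m in at_right l. dist (F x m) (F x l) < e"
  proof eventually_elim
    case (elim m)
    then show ?case using n F_mono[of l m x] F_mono[of m "l + 1 / real (Suc n)" x] by (auto simp: dist_real_def)
  qed
qed

end

section \<open>Existence of spectral measures\<close>

context spectral_family
begin

definition \<mu> :: "'a \<Rightarrow> real measure" where "\<mu> x = interval_measure (F x)"

lemma sets_\<mu> [simp, measurable_cong]: "sets (\<mu> x) = sets borel" and space_\<mu> [simp]: "space (\<mu> x) = UNIV"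
  by (simp_all add: \<mu>_def)

lemma F_diff: "s \<le> t \<Longrightarrow> F x t - F x s = (norm (E t x - E s x))\<^sup>2"
  by (simp add: F_def norm_E_diff)

lemma emeasure_Ioc: "a \<le> b \<Longrightarrow> emeasure (\<mu> x) {a<..b} = ennreal (F x b - F x a)"
  unfolding \<mu>_def by (rule emeasure_interval_measure_Ioc[OF _ F_mono F_right_continuous])

lemma measure_Ioc: "a \<le> b \<Longrightarrow> measure (\<mu> x) {a<..b} = F x b - F x a"
  using F_mono[of a b x] by (simp add: measure_def emeasure_Ioc)

lemma truncation_tendsto: "(\<lambda>n. E (real n) x - E (- real n) x) \<longlonglongrightarrow> x"
  using tendsto_diff[OF E_at_top E_at_bot] by simp

lemma emeasure_UNIV: "emeasure (\<mu> x) UNIV = ennreal (x \<bullet> x)"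
proof -
  define B where "B n = {- real n<..real n}" for n
  have "(\<lambda>n. emeasure (\<mu> x) (B n)) \<longlonglongrightarrow> emeasure (\<mu> x) (\<Union>n. B n)"
    by (rule Lim_emeasure_incseq) (auto simp: B_def incseq_def)
  moreover have "(\<Union>n. B n) = UNIV"
  proof -
    have "\<exists>n. u \<in> B n" for u
    proof -
      obtain n where "\<bar>u\<bar> < real n" using reals_Archimedean2 by blast
      then show ?thesis by (intro exI[of _ n]) (auto simp: B_def)
    qed
    then show ?thesis by blast
  qed
  moreover have "emeasure (\<mu> x) (B n) = ennreal (F x (real n) - F x (- real n))" for n
    unfolding B_def by (rule emeasure_Ioc) simp
  moreover have "(\<lambda>n. ennreal (F x (real n) - F x (- real n))) \<longlonglongrightarrow> ennreal (x \<bullet> x)"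
    using tendsto_inner[OF truncation_tendsto tendsto_const, of x x]
    by (intro tendsto_ennrealI) (simp add: F_def inner_diff_left)
  ultimately show ?thesis using LIMSEQ_unique by simp
qed

lemma finite_measure_\<mu>: "finite_measure (\<mu> x)"
  by (rule finite_measureI) (simp add: emeasure_UNIV)

lemma measure_UNIV: "measure (\<mu> x) UNIV = x \<bullet> x"
  by (simp add: measure_def emeasure_UNIV)

definition I :: "'a \<Rightarrow> (real \<Rightarrow> real) \<Rightarrow> real \<Rightarrow> real \<Rightarrow> real" where
  "I x g s t = (\<integral>u. indicator {s<..t} u * g u \<partial>\<mu> x)"

lemma I_integrable:
  fixes g :: "real \<Rightarrow> real"
  assumes "continuous_on UNIV g"
  shows "integrable (\<mu> x) (\<lambda>u. indicator {s<..t} u * g u)"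
proof -
  interpret finite_measure "\<mu> x" by (rule finite_measure_\<mu>)
  have "compact (g ` {s..t})" using assms by (intro compact_continuous_image) (auto intro: continuous_on_subset)
  then obtain K where K: "\<forall>v\<in>g ` {s..t}. norm v \<le> K" using compact_imp_bounded bounded_iff by metis
  have g: "g \<in> borel_measurable borel" using assms by (rule borel_measurable_continuous_onI)
  show ?thesis
  proof (rule integrable_const_bound[where B = "\<bar>K\<bar>"])
    have "norm (indicator {s<..t} u * g u) \<le> \<bar>K\<bar>" for u
    proof (cases "u \<in> {s<..t}")
      case True
      then have "norm (g u) \<le> K" using K by auto
      then show ?thesis using True by simp
    qed simp
    then show "AE u in \<mu> x. norm (indicator {s<..t} u * g u) \<le> \<bar>K\<bar>" by simp
    show "(\<lambda>u. indicator {s<..t} u * g u) \<in> borel_measurable (\<mu> x)" using g by simp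
  qed
qed

lemma I_add:
  assumes g: "continuous_on UNIV g" and st: "a \<le> s" "s \<le> t"
  shows "I x g a t = I x g a s + I x g s t"
proof -
  have "indicator {a<..t} u = (indicator {a<..s} u + indicator {s<..t} u :: real)" for u
    using st by (auto simp: indicator_def)
  then show ?thesis unfolding I_def
    by (subst Bochner_Integration.integral_add[symmetric]) (auto simp: I_integrable[OF g] distrib_right)
qed

lemma I_bounds:
  assumes g: "continuous_on UNIV g" and st: "s \<le> t" and b: "\<And>u. s < u \<Longrightarrow> u \<le> t \<Longrightarrow> m \<le> g u \<and> g u \<le> M"
  shows "m * (F x t - F x s) \<le> I x g s t" "I x g s t \<le> M * (F x t - F x s)"
proof -
  interpret finite_measure "\<mu> x" by (rule finite_measure_\<mu>)
  have c: "(\<integral>u. indicator {s<..t} u * k \<partial>\<mu> x) = k * (F x t - F x s)" for k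
    using measure_Ioc[OF st] by simp
  have i: "integrable (\<mu> x) (\<lambda>u. indicator {s<..t} u * k)" for k :: real
    by (rule I_integrable) simp
  have "(\<integral>u. indicator {s<..t} u * m \<partial>\<mu> x) \<le> I x g s t" unfolding I_def
    by (rule integral_mono[OF i I_integrable[OF g]]) (use b in \<open>auto simp: indicator_def\<close>)
  then show "m * (F x t - F x s) \<le> I x g s t" by (simp only: c)
  have "I x g s t \<le> (\<integral>u. indicator {s<..t} u * M \<partial>\<mu> x)" unfolding I_def
    by (rule integral_mono[OF I_integrable[OF g] i]) (use b in \<open>auto simp: indicator_def\<close>)
  then show "I x g s t \<le> M * (F x t - F x s)" by (simp only: c)
qed

lemma R_orthogonal: "y \<in> R a s \<Longrightarrow> z \<in> R s t \<Longrightarrow> y \<bullet> z = 0"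
  using E_inner[of s y z] by (simp add: R_def)

text \<open>Both sides are additive over adjacent intervals, and over \<open>(s, t]\<close> both lie
  between \<open>s\<close> and \<open>t\<close> times the mass \<open>F x t - F x s\<close>; hence
  their difference has the increments that \<open>increments_bound_const\<close> excludes.\<close>

lemma truncated_form:
  assumes ab: "a \<le> b"
  shows "A (E b x - E a x) \<bullet> (E b x - E a x) = I x (\<lambda>u. u) a b"
proof -
  define v where "v t = E t x - E a x" for t
  define \<Phi> where "\<Phi> t = A (v t) \<bullet> v t - I x (\<lambda>u. u) a t" for t
  have "\<Phi> b = \<Phi> a"
  proof (rule increments_bound_const[OF ab, where K = 1 and F = "F x"])
    fix s t assume st: "a \<le> s" "s \<le> t" "t \<le> b"
    define r where "r = E t x - E s x"
    have r: "r \<in> R s t" "r \<in> D" and vs: "v s \<in> R a s" "v s \<in> D"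
      using R_mem R_D st by (auto simp: r_def v_def)
    have rn: "r \<bullet> r = F x t - F x s" using F_diff[OF st(2)] by (simp add: r_def power2_norm_eq_inner)
    have "v t = v s + r" by (simp add: v_def r_def)
    then have "A (v t) \<bullet> v t = A (v s) \<bullet> v s + A r \<bullet> r"
      using R_orthogonal[OF R_A[OF vs] r(1)] symmetric[OF r(2) vs(2)]
      by (simp add: add vs r inner_add inner_commute)
    then have "\<Phi> t - \<Phi> s = A r \<bullet> r - I x (\<lambda>u. u) s t"
      using I_add[of "\<lambda>u. u" a s t x] st by (simp add: \<Phi>_def)
    moreover have "s * (F x t - F x s) \<le> A r \<bullet> r" "A r \<bullet> r \<le> t * (F x t - F x s)"
      using R_form[OF r] by (simp_all add: rn)
    moreover have "s * (F x t - F x s) \<le> I x (\<lambda>u. u) s t" "I x (\<lambda>u. u) s t \<le> t * (F x t - F x s)"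
      using I_bounds[OF continuous_on_id st(2), of s t x] by auto
    ultimately have "\<bar>\<Phi> t - \<Phi> s\<bar> \<le> t * (F x t - F x s) - s * (F x t - F x s)" by argo
    then show "\<bar>\<Phi> t - \<Phi> s\<bar> \<le> 1 * (t - s) * (F x t - F x s)" by (simp add: algebra_simps)
  qed
  then show ?thesis by (simp add: \<Phi>_def v_def I_def)
qed

text \<open>Expanding both sides around the left end \<open>s\<close> of a small interval, the
  linear terms agree by \<open>truncated_form\<close>, and each remaining square is at most
  \<open>(t - s)\<^sup>2\<close> times the mass. One factor \<open>t - s\<close> is estimated by
  \<open>b - a\<close>.\<close>

lemma truncated_norm:
  assumes ab: "a \<le> b"
  shows "(norm (A (E b x - E a x)))\<^sup>2 = I x (\<lambda>u. u\<^sup>2) a b"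
proof -
  define v where "v t = E t x - E a x" for t
  define \<Phi> where "\<Phi> t = (norm (A (v t)))\<^sup>2 - I x (\<lambda>u. u\<^sup>2) a t" for t
  have "\<Phi> b = \<Phi> a"
  proof (rule increments_bound_const[OF ab, where K = "b - a" and F = "F x"])
    fix s t assume st: "a \<le> s" "s \<le> t" "t \<le> b"
    define r where "r = E t x - E s x"
    define m where "m = F x t - F x s"
    have m: "m \<ge> 0" using F_mono[OF st(2)] by (simp add: m_def)
    have r: "r \<in> R s t" "r \<in> D" and vs: "v s \<in> R a s" "v s \<in> D"
      using R_mem R_D st by (auto simp: r_def v_def)
    have rn: "r \<bullet> r = m" using F_diff[OF st(2)] by (simp add: r_def power2_norm_eq_inner m_def)
    have "v t = v s + r" by (simp add: v_def r_def)
    then have "(norm (A (v t)))\<^sup>2 = (norm (A (v s)))\<^sup>2 + (norm (A r))\<^sup>2"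
      using R_orthogonal[OF R_A[OF vs] R_A[OF r]]
      by (simp add: add vs r power2_norm_eq_inner inner_add inner_commute)
    moreover have "(norm (A r))\<^sup>2 = (norm (A r - s *\<^sub>R r))\<^sup>2 + 2 * s * (A r \<bullet> r) - s\<^sup>2 * m"
      using rn unfolding power2_norm_eq_inner
      by (simp add: inner_diff inner_commute power2_eq_square algebra_simps)
    moreover have "A r \<bullet> r = I x (\<lambda>u. u) s t" unfolding r_def by (rule truncated_form[OF st(2)])
    moreover have "I x (\<lambda>u. u\<^sup>2) s t = I x (\<lambda>u. (u - s)\<^sup>2) s t + 2 * s * I x (\<lambda>u. u) s t - s\<^sup>2 * m"
    proof -
      have "I x (\<lambda>u. (u - s)\<^sup>2) s t = (\<integral>u. indicator {s<..t} u * u\<^sup>2 - 2 * s * (indicator {s<..t} u * u)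
          + s\<^sup>2 * (indicator {s<..t} u * 1) \<partial>\<mu> x)"
        unfolding I_def by (rule Bochner_Integration.integral_cong) (auto simp: power2_eq_square algebra_simps)
      also have "\<dots> = (\<integral>u. indicator {s<..t} u * u\<^sup>2 \<partial>\<mu> x) - (\<integral>u. 2 * s * (indicator {s<..t} u * u) \<partial>\<mu> x)
          + (\<integral>u. s\<^sup>2 * (indicator {s<..t} u * 1) \<partial>\<mu> x)"
      proof -
        have i: "integrable (\<mu> x) (\<lambda>u. indicator {s<..t} u * u\<^sup>2)"
          "integrable (\<mu> x) (\<lambda>u. 2 * s * (indicator {s<..t} u * u))"
          "integrable (\<mu> x) (\<lambda>u. s\<^sup>2 * (indicator {s<..t} u * 1))"
          by (intro integrable_mult_right I_integrable continuous_intros)+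
        show ?thesis
          by (simp only: Bochner_Integration.integral_add[OF Bochner_Integration.integrable_diff[OF i(1,2)] i(3)]
              Bochner_Integration.integral_diff[OF i(1,2)])
      qed
      also have "\<dots> = I x (\<lambda>u. u\<^sup>2) s t - 2 * s * I x (\<lambda>u. u) s t + s\<^sup>2 * m"
        using measure_Ioc[OF st(2)] by (simp add: I_def m_def)
      finally show ?thesis by simp
    qed
    ultimately have "\<Phi> t - \<Phi> s = (norm (A r - s *\<^sub>R r))\<^sup>2 - I x (\<lambda>u. (u - s)\<^sup>2) s t"
      using I_add[of "\<lambda>u. u\<^sup>2" a s t x] st by (simp add: \<Phi>_def continuous_intros)
    moreover have "(norm (A r - s *\<^sub>R r))\<^sup>2 \<le> (t - s)\<^sup>2 * m"
    proof -
      have "norm (A r - s *\<^sub>R r) \<le> (t - s) * norm r" by (rule R_norm[OF st(2) r(1)]) (use st in auto)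
      then have "(norm (A r - s *\<^sub>R r))\<^sup>2 \<le> ((t - s) * norm r)\<^sup>2" by (rule power_mono) simp
      then show ?thesis using rn by (simp add: power_mult_distrib flip: power2_norm_eq_inner)
    qed
    moreover have "0 * m \<le> I x (\<lambda>u. (u - s)\<^sup>2) s t" "I x (\<lambda>u. (u - s)\<^sup>2) s t \<le> (t - s)\<^sup>2 * m"
      unfolding m_def using st
      by (intro I_bounds[where M = "(t - s)\<^sup>2" and m = 0]; auto intro!: continuous_intros power_mono)+
    ultimately have "\<bar>\<Phi> t - \<Phi> s\<bar> \<le> (t - s)\<^sup>2 * m"
      using zero_le_power2[of "norm (A r - s *\<^sub>R r)"] by linarith
    also have "\<dots> \<le> (b - a) * (t - s) * m"
      using st m by (intro mult_right_mono) (auto simp: power2_eq_square intro!: mult_right_mono)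
    finally show "\<bar>\<Phi> t - \<Phi> s\<bar> \<le> (b - a) * (t - s) * (F x t - F x s)" by (simp add: m_def)
  qed
  then show ?thesis by (simp add: \<Phi>_def v_def I_def)
qed

lemma indicator_exhausts: "(\<lambda>n. indicator {- real n<..real n} u * g u) \<longlonglongrightarrow> (g u :: real)"
proof -
  obtain n where n: "\<bar>u\<bar> < real n" using reals_Archimedean2 by blast
  have "\<forall>\<^sub>F m in sequentially. indicator {- real m<..real m} u * g u = g u"
    by (rule eventually_sequentiallyI[of n]) (use n in \<open>auto simp: indicator_def\<close>)
  then show ?thesis by (rule tendsto_eventually)
qed

lemma truncation_D: "E (real n) x - E (- real n) x \<in> D"
  by (rule R_D[OF _ R_mem]) simp_all

text \<open>The truncations \<open>w n\<close> commute with \<open>A\<close>, so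
  \<open>A (w n)\<close> tends to \<open>A x\<close>; the second moments over \<open>(-n, n]\<close>
  are their squared norms, and monotone convergence applies.\<close>

lemma domain_integrable:
  assumes x: "x \<in> D"
  shows "integrable (\<mu> x) (\<lambda>t. t\<^sup>2)" "A x \<bullet> x = (\<integral>t. t \<partial>\<mu> x)"
proof -
  interpret finite_measure "\<mu> x" by (rule finite_measure_\<mu>)
  define w where "w n = E (real n) x - E (- real n) x" for n
  have Aw: "A (w n) = E (real n) (A x) - E (- real n) (A x)" for n
    using x by (simp add: w_def diff proj_D proj_A)
  have Aw_lim: "(\<lambda>n. A (w n)) \<longlonglongrightarrow> A x" unfolding Aw by (rule truncation_tendsto)
  have w_lim: "w \<longlonglongrightarrow> x" unfolding w_def by (rule truncation_tendsto)
  show i2: "integrable (\<mu> x) (\<lambda>t. t\<^sup>2)"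
  proof (rule integrable_monotone_convergence)
    show "integrable (\<mu> x) (\<lambda>u. indicator {- real n<..real n} u * u\<^sup>2)" for n
      by (rule I_integrable) (intro continuous_intros)
    show "AE u in \<mu> x. mono (\<lambda>n. indicator {- real n<..real n} u * u\<^sup>2)"
      by (auto simp: mono_def indicator_def)
    show "AE u in \<mu> x. (\<lambda>n. indicator {- real n<..real n} u * u\<^sup>2) \<longlonglongrightarrow> u\<^sup>2"
      by (intro always_eventually allI indicator_exhausts)
    show "(\<lambda>n. \<integral>u. indicator {- real n<..real n} u * u\<^sup>2 \<partial>\<mu> x) \<longlonglongrightarrow> (norm (A x))\<^sup>2"
      using tendsto_power[OF tendsto_norm[OF Aw_lim], of 2] truncated_norm[of "- real n" "real n" x for n]
      by (simp add: w_def I_def)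
  qed simp
  have "(\<lambda>n. \<integral>u. indicator {- real n<..real n} u * u \<partial>\<mu> x) \<longlonglongrightarrow> (\<integral>u. u \<partial>\<mu> x)"
  proof (rule integral_dominated_convergence[where w = "\<lambda>u. u\<^sup>2 + 1"])
    show "integrable (\<mu> x) (\<lambda>u. u\<^sup>2 + 1)" using i2 by simp
    show "AE u in \<mu> x. norm (indicator {- real n<..real n} u * u) \<le> u\<^sup>2 + 1" for n
    proof -
      have "\<bar>u\<bar> \<le> u\<^sup>2 + 1" for u :: real
        using zero_le_power2[of "\<bar>u\<bar> - 1"] zero_le_power2[of u] by (simp add: power2_eq_square algebra_simps) 
      then show ?thesis by (auto simp: indicator_def)
    qed
    show "AE u in \<mu> x. (\<lambda>n. indicator {- real n<..real n} u * u) \<longlonglongrightarrow> u"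
      by (intro always_eventually allI indicator_exhausts)
  qed simp_all
  moreover have "(\<integral>u. indicator {- real n<..real n} u * u \<partial>\<mu> x) = A (w n) \<bullet> w n" for n
    using truncated_form[of "- real n" "real n" x] by (simp add: w_def I_def)
  moreover have "(\<lambda>n. A (w n) \<bullet> w n) \<longlonglongrightarrow> A x \<bullet> x" by (intro tendsto_inner Aw_lim w_lim)
  ultimately show "A x \<bullet> x = (\<integral>t. t \<partial>\<mu> x)" using LIMSEQ_unique by simp
qed

text \<open>A finite second moment makes \<open>A (w n)\<close> a Cauchy sequence, because the
  squared distance of two terms is the moment over the difference of the truncation intervals.
  Closedness of \<open>A\<close> puts the limit \<open>x\<close> into the domain.\<close>

lemma integrable_domain:
  assumes i2: "integrable (\<mu> x) (\<lambda>t. t\<^sup>2)" shows "x \<in> D"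
proof -
  define w where "w n = E (real n) x - E (- real n) x" for n
  have w_lim: "w \<longlonglongrightarrow> x" unfolding w_def by (rule truncation_tendsto)
  have wD: "w n \<in> D" for n unfolding w_def by (rule truncation_D)
  define q where "q n = (norm (A (w n)))\<^sup>2" for n
  have "(\<lambda>n. \<integral>u. indicator {- real n<..real n} u * u\<^sup>2 \<partial>\<mu> x) \<longlonglongrightarrow> (\<integral>u. u\<^sup>2 \<partial>\<mu> x)"
  proof (rule integral_dominated_convergence[where w = "\<lambda>u. u\<^sup>2"])
    show "AE u in \<mu> x. norm (indicator {- real n<..real n} u * u\<^sup>2) \<le> u\<^sup>2" for n by (auto simp: indicator_def)
    show "AE u in \<mu> x. (\<lambda>n. indicator {- real n<..real n} u * u\<^sup>2) \<longlonglongrightarrow> u\<^sup>2"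
      by (intro always_eventually allI indicator_exhausts)
  qed (use i2 in simp_all)
  then have "q \<longlonglongrightarrow> (\<integral>u. u\<^sup>2 \<partial>\<mu> x)"
    using truncated_norm[of "- real n" "real n" x for n] by (simp add: w_def I_def q_def[abs_def])
  then have Cq: "Cauchy q" by (rule LIMSEQ_imp_Cauchy)
  have d: "(norm (A (w m) - A (w n)))\<^sup>2 = q m - q n" if nm: "n \<le> m" for m n
  proof -
    have Q: "E (real n) (w m) - E (- real n) (w m) = w n"
      using nm by (simp add: w_def E_diff E_mono E_mono')
    have An: "A (w n) = E (real n) (A (w m)) - E (- real n) (A (w m))"
      by (subst Q[symmetric]) (simp add: diff proj_D proj_A wD)
    then have "A (w m) \<bullet> A (w n) = A (w n) \<bullet> A (w n)"
      using norm_E_diff[of "- real n" "real n" "A (w m)"]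
      by (simp add: inner_diff inner_commute power2_norm_eq_inner)
    then show ?thesis by (simp add: q_def power2_norm_eq_inner inner_diff inner_commute)
  qed
  have "Cauchy (\<lambda>n. A (w n))"
  proof (rule Cauchy_of_square_increments[OF Cq])
    fix m n :: nat assume "m \<le> n"
    from d[OF this] have "(norm (A (w n) - A (w m)))\<^sup>2 \<le> \<bar>q n - q m\<bar>" by simp
    then show "(norm (A (w m) - A (w n)))\<^sup>2 \<le> \<bar>q m - q n\<bar>" by (subst norm_minus_commute, subst abs_minus_commute)
  qed
  then obtain z where "(\<lambda>n. A (w n)) \<longlonglongrightarrow> z" using Cauchy_convergent convergent_def by blast
  then show ?thesis using closed_graph[OF wD w_lim] by blast
qed

end

section \<open>Countable sums of orthogonal projections\<close>

lemma orthogonal_projectionD: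
  assumes "orthogonal_projection P"
  shows "P x \<bullet> y = x \<bullet> P y" "P (P x) = P x" "P x \<bullet> x = (norm (P x))\<^sup>2" "norm (P x) \<le> norm x" "P x \<bullet> x \<le> x \<bullet> x"
proof -
  show s: "P x \<bullet> y = x \<bullet> P y" for x y using assms by (simp add: orthogonal_projection_def bounded_self_adjoint_def)
  show i: "P (P x) = P x" for x using assms by (simp add: orthogonal_projection_def)
  show n: "P x \<bullet> x = (norm (P x))\<^sup>2" for x using s[of x "P x"] i by (simp add: power2_norm_eq_inner inner_commute)
  have "(norm (P x))\<^sup>2 \<le> norm (P x) * norm x" using n[of x] norm_cauchy_schwarz[of "P x" x] by simp
  then show nn: "norm (P x) \<le> norm x" by (cases "P x = 0") (auto simp: power2_eq_square)
  then show "P x \<bullet> x \<le> x \<bullet> x" by (simp add: n power_mono flip: power2_norm_eq_inner)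
qed

lemma bounded_self_adjoint_eqI:
  assumes "bounded_self_adjoint P" "bounded_self_adjoint Q" "\<And>x. P x \<bullet> x = Q x \<bullet> x"
  shows "P = Q"
proof (rule blinfun_eqI)
  fix x
  have "P x \<bullet> y = Q x \<bullet> y" for y
    using assms(3)[of "x + y"] assms(3)[of x] assms(3)[of y] assms(1,2)
    by (simp add: blinfun.add_right inner_add bounded_self_adjoint_def inner_commute)
  then have "(P x - Q x) \<bullet> (P x - Q x) = 0" by (simp add: inner_diff_left)
  then show "P x = Q x" by simp
qed

lemma orthogonal_projections_orthogonal:
  assumes P: "orthogonal_projection P" and Q: "orthogonal_projection Q"
    and le: "\<And>x. P x \<bullet> x + Q x \<bullet> x \<le> x \<bullet> x"
  shows "P (Q x) = 0"
proof -
  have "P (Q x) \<bullet> Q x + Q (Q x) \<bullet> Q x \<le> Q x \<bullet> Q x" by (rule le)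
  then have "P (Q x) \<bullet> Q x \<le> 0" by (simp add: orthogonal_projectionD(2)[OF Q])
  then show ?thesis using orthogonal_projectionD(3)[OF P, of "Q x"] by simp
qed

text \<open>By orthogonality the squared norm of a block of the series is the corresponding block of
  the scalar series of forms. This gives pointwise convergence and a limit that is again symmetric
  and idempotent.\<close>

lemma orthogonal_projection_series:
  fixes P :: "nat \<Rightarrow> 'a::{real_inner,complete_space} \<Rightarrow>\<^sub>L 'a"
  assumes P: "\<And>k. orthogonal_projection (P k)" and orth: "\<And>j k x. j \<noteq> k \<Longrightarrow> P j (P k x) = 0"
    and sm: "\<And>x. summable (\<lambda>k. P k x \<bullet> x)" and le: "\<And>x. suminf (\<lambda>k. P k x \<bullet> x) \<le> x \<bullet> x"
  obtains Q where "orthogonal_projection Q" "\<And>x. (\<lambda>k. P k x) sums Q x"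
proof -
  note PD = orthogonal_projectionD[OF P]
  define s where "s n x = (\<Sum>k<n. P k x)" for n x
  have nsum: "(norm (\<Sum>k\<in>K. P k x))\<^sup>2 = (\<Sum>k\<in>K. P k x \<bullet> x)" if "finite K" for K x
    using that
  proof (induct K rule: finite_induct)
    case (insert k K)
    have "P k x \<bullet> P j x = 0" if "j \<in> K" for j
    proof -
      have "j \<noteq> k" using that insert by blast
      then show ?thesis using PD(1)[of j "P k x" x] orth[of j k x] by simp
    qed
    then have "P k x \<bullet> (\<Sum>k\<in>K. P k x) = 0" by (simp add: inner_sum_right)
    then have "(norm (P k x + (\<Sum>k\<in>K. P k x)))\<^sup>2 = (norm (P k x))\<^sup>2 + (norm (\<Sum>k\<in>K. P k x))\<^sup>2"
      by (simp add: power2_norm_eq_inner inner_add inner_commute)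
    then show ?case using insert by (simp add: PD(3))
  qed simp
  have C: "Cauchy (\<lambda>n. s n x)" for x
  proof (rule Cauchy_of_square_increments)
    show "Cauchy (\<lambda>n. \<Sum>k<n. P k x \<bullet> x)" using sm[of x] by (simp add: summable_iff_convergent convergent_Cauchy)
    fix m n :: nat assume "m \<le> n"
    then have "s n x - s m x = (\<Sum>k=m..<n. P k x)" "(\<Sum>k<n. P k x \<bullet> x) - (\<Sum>k<m. P k x \<bullet> x) = (\<Sum>k=m..<n. P k x \<bullet> x)"
      unfolding s_def lessThan_atLeast0 by (simp_all add: sum_diff_nat_ivl)
    then have "(norm (s n x - s m x))\<^sup>2 \<le> \<bar>(\<Sum>k<n. P k x \<bullet> x) - (\<Sum>k<m. P k x \<bullet> x)\<bar>"
      using nsum[of "{m..<n}" x] by simp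
    then show "(norm (s m x - s n x))\<^sup>2 \<le> \<bar>(\<Sum>k<m. P k x \<bullet> x) - (\<Sum>k<n. P k x \<bullet> x)\<bar>"
      by (subst norm_minus_commute, subst abs_minus_commute)
  qed
  define q where "q x = lim (\<lambda>n. s n x)" for x
  have q: "(\<lambda>n. s n x) \<longlonglongrightarrow> q x" for x
    unfolding q_def using C Cauchy_convergent convergent_LIMSEQ_iff by blast
  have s_add: "s n (x + y) = s n x + s n y" and s_scale: "s n (c *\<^sub>R x) = c *\<^sub>R s n x" for n x y c
    by (simp_all add: s_def blinfun.add_right blinfun.scaleR_right sum.distrib scaleR_sum_right)
  have qs: "(\<lambda>k. P k x) sums q x" for x using q[of x] by (simp add: sums_def s_def)
  have lq: "linear q"
  proof (rule linearI)
    show "q (x + y) = q x + q y" for x y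
      using LIMSEQ_unique[OF q tendsto_add[OF q[of x] q[of y], folded s_add]] .
    show "q (c *\<^sub>R x) = c *\<^sub>R q x" for c x
      using LIMSEQ_unique[OF q tendsto_scaleR[OF tendsto_const q[of x], of c, folded s_scale]] .
  qed
  have ns: "norm (s n x) \<le> norm x" for n x
  proof (rule power2_le_imp_le)
    have "(norm (s n x))\<^sup>2 = (\<Sum>k<n. P k x \<bullet> x)" unfolding s_def by (rule nsum) simp
    also have "\<dots> \<le> suminf (\<lambda>k. P k x \<bullet> x)" by (rule sum_le_suminf[OF sm]) (auto simp: PD(3))
    also have "\<dots> \<le> (norm x)\<^sup>2" using le by (simp add: power2_norm_eq_inner)
    finally show "(norm (s n x))\<^sup>2 \<le> (norm x)\<^sup>2" .
  qed simp
  have nq: "norm (q x) \<le> norm x" for x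
    by (rule LIMSEQ_le_const2[OF tendsto_norm[OF q]]) (use ns in auto)
  have "bounded_linear q" using lq nq
    by (auto simp: bounded_linear_def bounded_linear_axioms_def intro!: exI[of _ 1])
  then have Q: "Blinfun q x = q x" for x by (simp add: bounded_linear_Blinfun_apply)
  have sym: "q x \<bullet> y = x \<bullet> q y" for x y
  proof (rule LIMSEQ_unique)
    show "(\<lambda>n. s n x \<bullet> y) \<longlonglongrightarrow> q x \<bullet> y" by (intro tendsto_intros q)
    show "(\<lambda>n. s n x \<bullet> y) \<longlonglongrightarrow> x \<bullet> q y"
      using tendsto_inner[OF tendsto_const q[of y], of x] by (simp add: s_def inner_sum_left inner_sum_right PD(1))
  qed
  have Pq: "P j (q x) = P j x" for j x
  proof (rule LIMSEQ_unique)
    show "(\<lambda>n. P j (s n x)) \<longlonglongrightarrow> P j (q x)" by (intro tendsto_intros q)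
    have "P j (s n x) = P j x" if "n > j" for n
    proof -
      have "P j (s n x) = (\<Sum>k<n. if k = j then P j x else 0)"
        unfolding s_def blinfun.sum_right by (rule sum.cong) (auto simp: orth PD(2))
      then show ?thesis using that by simp
    qed
    then show "(\<lambda>n. P j (s n x)) \<longlonglongrightarrow> P j x"
      by (intro tendsto_eventually eventually_sequentiallyI[of "Suc j"]) auto
  qed
  have "q (q x) = q x" for x
    using q[of "q x"] q[of x] by (simp add: s_def Pq LIMSEQ_unique)
  then have "orthogonal_projection (Blinfun q)"
    by (simp add: orthogonal_projection_def bounded_self_adjoint_def Q sym)
  then show thesis using that qs by (simp add: Q)
qed

lemma orthogonal_projection_complement:
  "orthogonal_projection P \<Longrightarrow> orthogonal_projection (id_blinfun - P)"
  by (simp add: orthogonal_projection_def bounded_self_adjoint_def blinfun.diff_left blinfun.diff_right inner_diff)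

context spectral_family
begin

text \<open>\<open>P\<close> is the spectral projection of the set, expressed through the scalar
  measures only. A symmetric operator is determined by its form, so there is at most one such
  \<open>P\<close>.\<close>

definition represents :: "('a \<Rightarrow>\<^sub>L 'a) \<Rightarrow> real set \<Rightarrow> bool" where
  "represents P \<Omega> \<longleftrightarrow> orthogonal_projection P \<and> (\<forall>x. P x \<bullet> x = measure (\<mu> x) \<Omega>)"

lemma represents_unique: "represents P \<Omega> \<Longrightarrow> represents Q \<Omega> \<Longrightarrow> P = Q"
  by (rule bounded_self_adjoint_eqI) (auto simp: represents_def orthogonal_projection_def)

lemma represents_union:
  assumes \<Omega>: "range \<Omega> \<subseteq> sets borel" "disjoint_family \<Omega>" and P: "\<And>n::nat. represents (P n) (\<Omega> n)"
  obtains Q where "represents Q (\<Union>n. \<Omega> n)" "\<And>x. (\<lambda>k. P k x) sums Q x"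
proof -
  note fm = finite_measure_\<mu>
  have form: "P k x \<bullet> x = measure (\<mu> x) (\<Omega> k)" for k x using P by (simp add: represents_def)
  have ms: "(\<lambda>k. measure (\<mu> x) (\<Omega> k)) sums measure (\<mu> x) (\<Union>n. \<Omega> n)" for x
    using finite_measure.finite_measure_UNION[OF fm _ \<Omega>(2)] \<Omega>(1) by simp
  have orth: "P j (P k x) = 0" if "j \<noteq> k" for j k x
  proof (rule orthogonal_projections_orthogonal)
    show "P j x \<bullet> x + P k x \<bullet> x \<le> x \<bullet> x" for x
    proof -
      have "\<Omega> j \<inter> \<Omega> k = {}" using \<Omega>(2) that by (auto simp: disjoint_family_on_def)
      then have "P j x \<bullet> x + P k x \<bullet> x = measure (\<mu> x) (\<Omega> j \<union> \<Omega> k)"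
        using \<Omega>(1) by (simp add: form finite_measure.finite_measure_Union[OF fm] range_subsetD)
      also have "\<dots> \<le> x \<bullet> x" using finite_measure.bounded_measure[OF fm, of x] by (simp add: measure_UNIV)
      finally show ?thesis .
    qed
  qed (use P in \<open>auto simp: represents_def\<close>)
  obtain Q where Q: "orthogonal_projection Q" "\<And>x. (\<lambda>k. P k x) sums Q x"
  proof (rule orthogonal_projection_series[of P])
    show "summable (\<lambda>k. P k x \<bullet> x)" for x unfolding form using ms by (rule sums_summable)
    show "suminf (\<lambda>k. P k x \<bullet> x) \<le> x \<bullet> x" for x
      unfolding form using sums_unique[OF ms, of x] finite_measure.bounded_measure[OF fm, of x "\<Union>n. \<Omega> n"] by (simp add: measure_UNIV)
  qed (use P orth in \<open>auto simp: represents_def\<close>)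
  have "Q x \<bullet> x = measure (\<mu> x) (\<Union>n. \<Omega> n)" for x
  proof -
    have "(\<lambda>k. P k x \<bullet> x) sums (Q x \<bullet> x)"
      by (rule bounded_linear.sums[OF bounded_linear_inner_left Q(2)])
    then show ?thesis unfolding form using ms sums_unique2 by blast
  qed
  then show thesis by (intro that[OF _ Q(2)]) (simp add: represents_def Q(1))
qed

lemma represents_complement:
  assumes "represents P \<Omega>" "\<Omega> \<in> sets borel" shows "represents (id_blinfun - P) (UNIV - \<Omega>)"
  using assms finite_measure.finite_measure_compl[OF finite_measure_\<mu>, of \<Omega>]
  by (simp add: represents_def orthogonal_projection_complement blinfun.diff_left inner_diff_left measure_UNIV)

text \<open>Dynkin's argument: half-open intervals form a generator of the Borel sets that is stable
  under intersection, and representability passes to complements and countable disjoint unions.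
  Intersections of represented sets never have to be treated.\<close>

lemma represents_exists:
  assumes "\<Omega> \<in> sets borel" shows "\<exists>P. represents P \<Omega>"
proof -
  let ?G = "range (\<lambda>(a, b). {a<..b::real})"
  have "\<Omega> \<in> sigma_sets UNIV ?G" using assms by (simp add: borel_sigma_sets_Ioc)
  then show ?thesis
  proof (rule sigma_sets_induct_disjoint[where P = "\<lambda>\<Omega>. \<exists>P. represents P \<Omega>", rotated 2])
    show "Int_stable ?G"
    proof (rule Int_stableI)
      fix U V assume "U \<in> ?G" "V \<in> ?G"
      then obtain a b c d where "U = {a<..b}" "V = {c<..d}" by auto
      then have "U \<inter> V = (\<lambda>(a, b). {a<..b}) (max a c, min b d)" by auto
      then show "U \<inter> V \<in> ?G" by blast
    qed
    fix U assume "U \<in> ?G"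
    then obtain a b where U: "U = {a<..b}" by auto
    show "\<exists>P. represents P U"
    proof (cases "a \<le> b")
      case True
      define q where "q x = E b x - E a x" for x
      have "bounded_linear q" unfolding q_def
        by (intro bounded_linear_sub bounded_linear_proj subspace_N complete_N)
      then have Q: "Blinfun q x = q x" for x by (simp add: bounded_linear_Blinfun_apply)
      have "q (q x) = q x" for x
        using True by (simp add: q_def E_diff E_idem E_mono E_commute[of a b])
      moreover have "q x \<bullet> x = measure (\<mu> x) U" for x
        using measure_Ioc[OF True] by (simp add: U q_def F_def inner_diff_left)
      ultimately have "represents (Blinfun q) U"
        by (simp add: represents_def orthogonal_projection_def bounded_self_adjoint_def Q)
          (simp add: q_def inner_diff E_inner)
      then show ?thesis ..
    next
      case False
      then have "represents 0 U" by (simp add: U represents_def orthogonal_projection_def bounded_self_adjoint_def)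
      then show ?thesis ..
    qed
  next
    have "represents 0 {}" by (simp add: represents_def orthogonal_projection_def bounded_self_adjoint_def)
    then show "\<exists>P. represents P {}" ..
  next
    fix U assume "U \<in> sigma_sets UNIV ?G" "\<exists>P. represents P U"
    then obtain P where "represents P U" "U \<in> sets borel" by (auto simp: borel_sigma_sets_Ioc)
    then show "\<exists>P. represents P (UNIV - U)" using represents_complement by blast
  next
    fix U :: "nat \<Rightarrow> real set" assume U: "disjoint_family U" "range U \<subseteq> sigma_sets UNIV ?G" "\<And>i. \<exists>P. represents P (U i)"
    then obtain P where "\<And>i. represents (P i) (U i)" by metis
    moreover have "range U \<subseteq> sets borel" using U(2) by (simp add: borel_sigma_sets_Ioc)
    ultimately show "\<exists>P. represents P (\<Union>i. U i)" using represents_union[of U P] U(1) by blast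
  qed simp
qed

lemma spectral_measure: "\<exists>E. is_spectral_measure D A E"
proof -
  define E where "E \<Omega> = (SOME P. represents P \<Omega>)" for \<Omega>
  have E: "represents (E \<Omega>) \<Omega>" if "\<Omega> \<in> sets borel" for \<Omega>
    unfolding E_def using represents_exists[OF that] by (rule someI_ex)
  have "projection_valued_measure E"
    unfolding projection_valued_measure_def
  proof (intro conjI ballI allI impI)
    show "orthogonal_projection (E \<Omega>)" if "\<Omega> \<in> sets borel" for \<Omega>
      using E[OF that] by (simp add: represents_def)
    have "represents id_blinfun UNIV"
      by (simp add: represents_def orthogonal_projection_def bounded_self_adjoint_def measure_UNIV)
    then show "E UNIV = id_blinfun" using represents_unique E[of UNIV] by simp
    fix \<Omega> :: "nat \<Rightarrow> real set" and x assume \<Omega>: "range \<Omega> \<subseteq> sets borel \<and> disjoint_family \<Omega>"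
    then have "represents (E (\<Omega> n)) (\<Omega> n)" for n using E by blast
    then obtain Q where Q: "represents Q (\<Union>n. \<Omega> n)" "\<And>x. (\<lambda>k. E (\<Omega> k) x) sums Q x"
      using represents_union \<Omega> by metis
    moreover have "(\<Union>n. \<Omega> n) \<in> sets borel" using \<Omega> by (intro sets.countable_UN) auto
    ultimately have "Q = E (\<Union>n. \<Omega> n)" using represents_unique E by blast
    then show "(\<lambda>n. E (\<Omega> n) x) sums E (\<Union>n. \<Omega> n) x" using Q(2) by simp
  qed
  moreover have M: "scalar_spectral_measure E x = \<mu> x" for x
  proof -
    interpret finite_measure "\<mu> x" by (rule finite_measure_\<mu>)
    have "scalar_spectral_measure E x = measure_of UNIV (sets borel) (emeasure (\<mu> x))"
      unfolding scalar_spectral_measure_def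
    proof (rule measure_of_eq)
      fix X :: "real set" assume "X \<in> sigma_sets UNIV (sets borel)"
      then have "X \<in> sets borel" using sets.sigma_sets_eq[of "borel :: real measure"] by simp
      from E[OF this] show "ennreal (E X x \<bullet> x) = emeasure (\<mu> x) X"
        by (simp add: represents_def emeasure_eq_measure)
    qed simp
    also have "\<dots> = \<mu> x" using measure_of_of_measure[of "\<mu> x"] by simp
    finally show ?thesis .
  qed
  ultimately have "is_spectral_measure D A E"
    unfolding is_spectral_measure_def M using domain_integrable integrable_domain by blast
  then show ?thesis by blast
qed

end

text \<open>Gives the choice in \<open>spectral_projection\<close> its meaning. All later facts are
  derived from the three defining properties of the chosen measure.\<close>

theorem (in self_adjoint_operator) is_spectral_measure_spectral_projection:
  "is_spectral_measure D A (spectral_projection D A)"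
proof -
  obtain N where "spectral_family D A N" by (rule spectral_family_exists)
  then interpret spectral_family D A N .
  show ?thesis unfolding spectral_projection_def by (rule someI_ex[OF spectral_measure])
qed

section \<open>Properties of the spectral projections\<close>

context self_adjoint_operator
begin

abbreviation P :: "real set \<Rightarrow> 'a \<Rightarrow>\<^sub>L 'a" where "P \<equiv> spectral_projection D A"
abbreviation M :: "'a \<Rightarrow> real measure" where "M \<equiv> scalar_spectral_measure (spectral_projection D A)"

lemma pvm: "projection_valued_measure P"
  and domain_iff: "x \<in> D \<longleftrightarrow> integrable (M x) (\<lambda>t. t\<^sup>2)"
  and form_integral: "x \<in> D \<Longrightarrow> A x \<bullet> x = (\<integral>t. t \<partial>M x)"
  using is_spectral_measure_spectral_projection unfolding is_spectral_measure_def by blast+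

lemma P_projection: "\<Omega> \<in> sets borel \<Longrightarrow> orthogonal_projection (P \<Omega>)"
  and P_UNIV: "P UNIV = id_blinfun"
  and P_sums: "range U \<subseteq> sets borel \<Longrightarrow> disjoint_family U \<Longrightarrow> (\<lambda>n::nat. P (U n) x) sums P (\<Union>n. U n) x"
  using pvm unfolding projection_valued_measure_def by blast+

lemmas P_inner = orthogonal_projectionD(1)[OF P_projection] and P_idem = orthogonal_projectionD(2)[OF P_projection]
  and P_form = orthogonal_projectionD(3)[OF P_projection] and norm_P = orthogonal_projectionD(4)[OF P_projection]
  and P_form_le = orthogonal_projectionD(5)[OF P_projection]

lemma P_empty: "P {} x = 0"
proof -
  have "(\<lambda>n::nat. P {} x) sums P (\<Union>n::nat. {}) x"
    using P_sums[of "\<lambda>n. {}" x] by (simp add: disjoint_family_on_def)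
  then have "(\<lambda>n::nat. P {} x) \<longlonglongrightarrow> 0" using summable_LIMSEQ_zero sums_summable by blast
  then show ?thesis by (simp add: LIMSEQ_const_iff)
qed

lemma P_Un:
  assumes "\<Omega> \<in> sets borel" "\<Omega>' \<in> sets borel" "\<Omega> \<inter> \<Omega>' = {}"
  shows "P (\<Omega> \<union> \<Omega>') x = P \<Omega> x + P \<Omega>' x"
proof -
  have "(\<lambda>n. P (binaryset \<Omega> \<Omega>' n) x) sums P (\<Union>n. binaryset \<Omega> \<Omega>' n) x"
    using assms by (intro P_sums) (auto simp: range_binaryset_eq disjoint_family_on_def binaryset_def)
  moreover have "(\<lambda>n. P (binaryset \<Omega> \<Omega>' n) x) sums (P \<Omega> x + P \<Omega>' x)"
    by (rule binaryset_sums[of "\<lambda>U. P U x"]) (rule P_empty)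
  ultimately show ?thesis by (simp add: UN_binaryset_eq sums_unique2)
qed

lemma P_disjoint:
  assumes "\<Omega> \<in> sets borel" "\<Omega>' \<in> sets borel" "\<Omega> \<inter> \<Omega>' = {}"
  shows "P \<Omega> (P \<Omega>' x) = 0"
proof (rule orthogonal_projections_orthogonal[OF P_projection P_projection])
  show "P \<Omega> x \<bullet> x + P \<Omega>' x \<bullet> x \<le> x \<bullet> x" for x
    using P_form_le[of "\<Omega> \<union> \<Omega>'" x] P_Un[OF assms, of x] assms by (simp add: inner_add_left)
qed (use assms in auto)

text \<open>Multiplicativity is not part of the definition of a projection-valued measure. It
  follows from additivity, because two projections whose sum is at most 1 are orthogonal.\<close>

lemma P_Int:
  assumes m: "\<Omega> \<in> sets borel" "\<Omega>' \<in> sets borel"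
  shows "P \<Omega> (P \<Omega>' x) = P (\<Omega> \<inter> \<Omega>') x"
proof -
  have "(\<Omega> \<inter> \<Omega>') \<union> (\<Omega>' - \<Omega>) = \<Omega>'" "(\<Omega> \<inter> \<Omega>') \<union> (\<Omega> - \<Omega>') = \<Omega>" by auto
  then have 1: "P \<Omega>' x = P (\<Omega> \<inter> \<Omega>') x + P (\<Omega>' - \<Omega>) x" and 2: "P \<Omega> y = P (\<Omega> \<inter> \<Omega>') y + P (\<Omega> - \<Omega>') y" for y
    using P_Un[of "\<Omega> \<inter> \<Omega>'" "\<Omega>' - \<Omega>" x] P_Un[of "\<Omega> \<inter> \<Omega>'" "\<Omega> - \<Omega>'" y] m by auto
  have "P \<Omega> (P (\<Omega>' - \<Omega>) x) = 0" by (rule P_disjoint) (use m in auto)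
  moreover have "P (\<Omega> - \<Omega>') (P (\<Omega> \<inter> \<Omega>') x) = 0" by (rule P_disjoint) (use m in auto)
  ultimately show ?thesis unfolding 1 blinfun.add_right using m
    by (simp add: 2[of "P (\<Omega> \<inter> \<Omega>') x"] P_idem)
qed

lemma P_Compl: "\<Omega> \<in> sets borel \<Longrightarrow> P (- \<Omega>) x = x - P \<Omega> x"
  using P_Un[of "- \<Omega>" \<Omega> x] by (simp add: P_UNIV eq_diff_eq)

lemma P_subset: "\<Omega> \<in> sets borel \<Longrightarrow> \<Omega>' \<in> sets borel \<Longrightarrow> \<Omega>' \<subseteq> \<Omega> \<Longrightarrow> P \<Omega>' x = x \<Longrightarrow> P \<Omega> x = x"
  by (metis P_Int inf.absorb2)

lemma range_P: "\<Omega> \<in> sets borel \<Longrightarrow> range (P \<Omega>) = {x. P \<Omega> x = x}"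
  using P_idem by (auto simp: image_iff) metis

lemma subspace_range_P: "subspace (range (P \<Omega>))"
  by (rule linear_subspace_image[OF _ subspace_UNIV]) (simp add: bounded_linear.linear blinfun.bounded_linear_right)

lemma sets_M [simp, measurable_cong]: "sets (M x) = sets borel" and space_M [simp]: "space (M x) = UNIV"
  using sets.sigma_sets_eq[of "borel :: real measure"] by (simp_all add: scalar_spectral_measure_def)

lemma emeasure_M:
  assumes "\<Omega> \<in> sets borel" shows "emeasure (M x) \<Omega> = ennreal (P \<Omega> x \<bullet> x)"
proof (rule emeasure_measure_of[of "M x" UNIV "sets borel" "\<lambda>\<Omega>. ennreal (P \<Omega> x \<bullet> x)"])
  show "countably_additive (sets (M x)) (\<lambda>\<Omega>. ennreal (P \<Omega> x \<bullet> x))"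
    unfolding countably_additive_def
  proof (intro allI impI)
    fix B :: "nat \<Rightarrow> real set"
    assume B: "range B \<subseteq> sets (M x)" "disjoint_family B"
    have s: "(\<lambda>n. P (B n) x \<bullet> x) sums (P (\<Union>n. B n) x \<bullet> x)"
      using B by (intro bounded_linear.sums[OF bounded_linear_inner_left] P_sums) auto
    have "0 \<le> P (B n) x \<bullet> x" for n using B by (subst P_form) auto
    then show "suminf (\<lambda>n. ennreal (P (B n) x \<bullet> x)) = ennreal (P (\<Union>n. B n) x \<bullet> x)"
      by (subst suminf_ennreal2[OF _ sums_summable[OF s]]) (simp_all add: sums_unique[OF s])
  qed
qed (auto simp: scalar_spectral_measure_def positive_def P_empty assms)

lemma finite_measure_M: "finite_measure (M x)"
  by (rule finite_measureI) (simp add: emeasure_M)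

lemma measure_M: "\<Omega> \<in> sets borel \<Longrightarrow> measure (M x) \<Omega> = P \<Omega> x \<bullet> x"
  by (simp add: measure_def emeasure_M P_form)

text \<open>Projecting the vector restricts its scalar measure to the set; domain and form
  statements for \<open>P \<Omega> x\<close> become statements about integrals over
  \<open>\<Omega>\<close>.\<close>

lemma M_P:
  assumes m: "\<Omega> \<in> sets borel" shows "M (P \<Omega> x) = density (M x) (\<lambda>u. ennreal (indicator \<Omega> u))"
proof (rule measure_eqI)
  fix U assume "U \<in> sets (M (P \<Omega> x))"
  then have U: "U \<in> sets borel" by simp
  have "emeasure (M (P \<Omega> x)) U = ennreal (P (\<Omega> \<inter> U) x \<bullet> x)"
    using m U by (simp add: emeasure_M P_Int P_inner[symmetric] Int_ac)
  also have "\<dots> = emeasure (M x) (\<Omega> \<inter> U)" using m U by (simp add: emeasure_M)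
  also have "\<dots> = (\<integral>\<^sup>+u. indicator (\<Omega> \<inter> U) u \<partial>M x)" using m U by simp
  also have "\<dots> = (\<integral>\<^sup>+u. ennreal (indicator \<Omega> u) * indicator U u \<partial>M x)"
    by (rule nn_integral_cong) (auto simp: indicator_def)
  also have "\<dots> = emeasure (density (M x) (\<lambda>u. ennreal (indicator \<Omega> u))) U"
    using m U by (subst emeasure_density) auto
  finally show "emeasure (M (P \<Omega> x)) U = emeasure (density (M x) (\<lambda>u. ennreal (indicator \<Omega> u))) U" .
qed simp

lemma integrable_M_P:
  fixes f :: "real \<Rightarrow> real"
  assumes "\<Omega> \<in> sets borel" "f \<in> borel_measurable borel"
  shows "integrable (M (P \<Omega> x)) f \<longleftrightarrow> integrable (M x) (\<lambda>u. indicator \<Omega> u * f u)"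
  using assms by (subst M_P, simp, subst integrable_density) auto

lemma integral_M_P:
  fixes f :: "real \<Rightarrow> real"
  assumes "\<Omega> \<in> sets borel" "f \<in> borel_measurable borel"
  shows "integral\<^sup>L (M (P \<Omega> x)) f = (\<integral>u. indicator \<Omega> u * f u \<partial>M x)"
  using assms by (subst M_P, simp, subst integral_density) auto

lemma P_D: "\<Omega> \<in> sets borel \<Longrightarrow> x \<in> D \<Longrightarrow> P \<Omega> x \<in> D"
  using integrable_real_mult_indicator[of \<Omega> "M x" "\<lambda>t. t\<^sup>2"]
  by (simp add: domain_iff integrable_M_P mult.commute)

lemma P_bounded_D:
  assumes "\<Omega> \<in> sets borel" "\<Omega> \<subseteq> {- c..c}" shows "P \<Omega> x \<in> D"
proof -
  interpret finite_measure "M x" by (rule finite_measure_M)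
  have "norm (indicator \<Omega> u * u\<^sup>2) \<le> c\<^sup>2" for u
  proof -
    have "u\<^sup>2 \<le> c\<^sup>2" if "- c \<le> u" "u \<le> c"
      using power_mono[of "\<bar>u\<bar>" c 2] that by (simp add: abs_le_iff)
    then show ?thesis using assms(2) by (auto simp: indicator_def)
  qed
  then have "integrable (M x) (\<lambda>u. indicator \<Omega> u * u\<^sup>2)"
    using assms(1) by (intro integrable_const_bound[where B = "c\<^sup>2"]) auto
  then show ?thesis using assms(1) by (simp add: domain_iff integrable_M_P)
qed

lemma integrable_id: "x \<in> D \<Longrightarrow> integrable (M x) (\<lambda>t. t)"
proof -
  assume "x \<in> D"
  interpret finite_measure "M x" by (rule finite_measure_M)
  have "integrable (M x) (\<lambda>t. t\<^sup>2 + 1)" using \<open>x \<in> D\<close> by (simp add: domain_iff)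
  then show ?thesis
  proof (rule Bochner_Integration.integrable_bound)
    have "\<bar>t\<bar> \<le> t\<^sup>2 + 1" for t :: real
      using zero_le_power2[of "\<bar>t\<bar> - 1"] zero_le_power2[of t] by (simp add: power2_eq_square algebra_simps)
    then show "AE t in M x. norm t \<le> norm (t\<^sup>2 + 1)" by simp
  qed simp
qed

lemma P_form_integral:
  assumes m: "\<Omega> \<in> sets borel" and x: "x \<in> D"
  shows "integrable (M x) (\<lambda>u. indicator \<Omega> u * u)" "A (P \<Omega> x) \<bullet> P \<Omega> x = (\<integral>u. indicator \<Omega> u * u \<partial>M x)"
proof -
  show "integrable (M x) (\<lambda>u. indicator \<Omega> u * u)"
    using integrable_id[OF P_D[OF m x]] by (subst (asm) integrable_M_P[OF m]) simp_all
  show "A (P \<Omega> x) \<bullet> P \<Omega> x = (\<integral>u. indicator \<Omega> u * u \<partial>M x)"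
    unfolding form_integral[OF P_D[OF m x]] by (rule integral_M_P[OF m]) simp
qed

text \<open>The spectral measure is tied to \<open>A\<close> by the quadratic form alone. Evaluating
  that form at a sum of a vector from each side, the integral splits, so the two cross terms cancel;
  by symmetry they are equal, hence 0. Commutation of \<open>A\<close> with the projections
  follows.\<close>

lemma P_form_split:
  assumes m: "\<Omega> \<in> sets borel" and x: "x \<in> D" and y: "y \<in> D"
  shows "A (P \<Omega> x) \<bullet> P (- \<Omega>) y = 0"
proof -
  have m': "- \<Omega> \<in> sets borel" using m by auto
  define z where "z = P \<Omega> x + P (- \<Omega>) y"
  have z: "z \<in> D" using x y m m' by (simp add: z_def add_D P_D)
  have Pz: "P \<Omega> z = P \<Omega> x" "P (- \<Omega>) z = P (- \<Omega>) y"
    using m m' by (simp_all add: z_def blinfun.add_right P_idem P_disjoint)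
  have "A z \<bullet> z = (\<integral>u. indicator \<Omega> u * u + indicator (- \<Omega>) u * u \<partial>M z)"
    unfolding form_integral[OF z] by (rule Bochner_Integration.integral_cong) (auto simp: indicator_def)
  also have "\<dots> = A (P \<Omega> z) \<bullet> P \<Omega> z + A (P (- \<Omega>) z) \<bullet> P (- \<Omega>) z"
    unfolding P_form_integral(2)[OF m z] P_form_integral(2)[OF m' z]
    by (rule Bochner_Integration.integral_add[OF P_form_integral(1)[OF m z] P_form_integral(1)[OF m' z]])
  finally have "A (P \<Omega> x) \<bullet> P (- \<Omega>) y + A (P (- \<Omega>) y) \<bullet> P \<Omega> x = 0"
    unfolding Pz using m m' x y by (simp add: z_def add P_D inner_add)
  then show ?thesis using symmetric[OF P_D[OF m x] P_D[OF m' y]] by (simp add: inner_commute)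
qed

lemma P_A:
  assumes m: "\<Omega> \<in> sets borel" and x: "x \<in> D"
  shows "A (P \<Omega> x) = P \<Omega> (A x)"
proof -
  have m': "- \<Omega> \<in> sets borel" using m by auto
  have "y \<bullet> (A (P \<Omega> x) - P \<Omega> (A x)) = 0" if y: "y \<in> D" for y
  proof -
    have 1: "A (P \<Omega> x) \<bullet> y = A (P \<Omega> x) \<bullet> P \<Omega> y"
      using P_form_split[OF m x y] by (simp add: P_Compl[OF m] inner_diff_right)
    have "A x = A (P \<Omega> x) + A (P (- \<Omega>) x)"
      using add[OF P_D[OF m x] P_D[OF m' x]] by (simp add: P_Compl[OF m])
    then have "A x \<bullet> P \<Omega> y = A (P \<Omega> x) \<bullet> P \<Omega> y"
      using P_form_split[OF m' x y] by (simp add: inner_add_left)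
    then have "P \<Omega> (A x) \<bullet> y = A (P \<Omega> x) \<bullet> P \<Omega> y" by (simp add: P_inner[OF m])
    with 1 have "(A (P \<Omega> x) - P \<Omega> (A x)) \<bullet> y = 0" by (simp add: inner_diff_left)
    then show ?thesis by (simp add: inner_commute)
  qed
  then have "A (P \<Omega> x) - P \<Omega> (A x) = 0" by (rule orthogonal_D)
  then show ?thesis by simp
qed

lemma P_form_bounds:
  assumes m: "\<Omega> \<in> sets borel" and x: "x \<in> D" "P \<Omega> x = x"
  shows "(\<And>t. t \<in> \<Omega> \<Longrightarrow> t \<le> c) \<Longrightarrow> A x \<bullet> x \<le> c * (x \<bullet> x)"
    and "(\<And>t. t \<in> \<Omega> \<Longrightarrow> c \<le> t) \<Longrightarrow> c * (x \<bullet> x) \<le> A x \<bullet> x"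
proof -
  interpret finite_measure "M x" by (rule finite_measure_M)
  have f: "A x \<bullet> x = (\<integral>u. indicator \<Omega> u * u \<partial>M x)"
    using P_form_integral(2)[OF m x(1)] unfolding x(2) .
  have i: "integrable (M x) (\<lambda>u. indicator \<Omega> u * u)"
    by (rule P_form_integral(1)[OF m x(1)])
  have k: "(\<integral>u. indicator \<Omega> u * c \<partial>M x) = c * (x \<bullet> x)" using m x(2) by (simp add: measure_M)
  have ik: "integrable (M x) (\<lambda>u. indicator \<Omega> u * c)"
    using m by (intro integrable_const_bound[where B = "\<bar>c\<bar>"]) (auto simp: indicator_def)
  show "A x \<bullet> x \<le> c * (x \<bullet> x)" if "\<And>t. t \<in> \<Omega> \<Longrightarrow> t \<le> c"
    unfolding f k[symmetric] by (rule integral_mono[OF i ik]) (use that in \<open>auto simp: indicator_def\<close>)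
  show "c * (x \<bullet> x) \<le> A x \<bullet> x" if "\<And>t. t \<in> \<Omega> \<Longrightarrow> c \<le> t"
    unfolding f k[symmetric] by (rule integral_mono[OF ik i]) (use that in \<open>auto simp: indicator_def\<close>)
qed

lemma P_norm_bound:
  assumes m: "\<Omega> \<in> sets borel" and \<Omega>: "\<Omega> \<subseteq> {l - r..l + r}" and x: "P \<Omega> x = x"
  shows "norm (A x - l *\<^sub>R x) \<le> r * norm x"
proof (rule form_norm_le[where V = "range (P \<Omega>)"])
  have sub: "\<Omega> \<subseteq> {- (\<bar>l\<bar> + \<bar>r\<bar>)..\<bar>l\<bar> + \<bar>r\<bar>}"
  proof
    fix u assume "u \<in> \<Omega>"
    then have "l - r \<le> u" "u \<le> l + r" using \<Omega> by auto
    then have "- (\<bar>l\<bar> + \<bar>r\<bar>) \<le> u" "u \<le> \<bar>l\<bar> + \<bar>r\<bar>" by linarith+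
    then show "u \<in> {- (\<bar>l\<bar> + \<bar>r\<bar>)..\<bar>l\<bar> + \<bar>r\<bar>}" by simp
  qed
  have D: "y \<in> D" if "y \<in> range (P \<Omega>)" for y using that P_bounded_D[OF m sub] by auto
  show "subspace (range (P \<Omega>))" by (rule subspace_range_P)
  show "A (y + z) - l *\<^sub>R (y + z) = (A y - l *\<^sub>R y) + (A z - l *\<^sub>R z)"
    "A (y - z) - l *\<^sub>R (y - z) = (A y - l *\<^sub>R y) - (A z - l *\<^sub>R z)"
    "(A y - l *\<^sub>R y) \<bullet> z = y \<bullet> (A z - l *\<^sub>R z)"
    if "y \<in> range (P \<Omega>)" "z \<in> range (P \<Omega>)" for y z
    using D that by (simp_all add: add diff algebra_simps inner_diff symmetric)
  show "\<bar>(A y - l *\<^sub>R y) \<bullet> y\<bar> \<le> r * (norm y)\<^sup>2" if y: "y \<in> range (P \<Omega>)" for y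
  proof -
    have "P \<Omega> y = y" using y m by (simp add: range_P)
    moreover have "u \<le> l + r" "l - r \<le> u" if "u \<in> \<Omega>" for u using \<Omega> that by auto
    ultimately have "A y \<bullet> y \<le> (l + r) * (y \<bullet> y)" "(l - r) * (y \<bullet> y) \<le> A y \<bullet> y"
      using P_form_bounds[OF m D[OF y]] by blast+
    then show ?thesis by (simp add: power2_norm_eq_inner inner_diff_left abs_le_iff algebra_simps)
  qed
  show xr: "x \<in> range (P \<Omega>)" by (rule range_eqI[of _ _ x]) (simp add: x)
  have "A x - l *\<^sub>R x = P \<Omega> (A x - l *\<^sub>R x)"
    using P_A[OF m D[OF xr]] x by (simp add: blinfun.diff_right blinfun.scaleR_right)
  then have "A x - l *\<^sub>R x \<in> range (P \<Omega>)" by (rule range_eqI)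
  then show "A x - l *\<^sub>R x \<in> closure (range (P \<Omega>))" by (rule subsetD[OF closure_subset])
qed

lemma P_incseq:
  assumes m: "range \<Omega> \<subseteq> sets borel" and inc: "incseq \<Omega>"
  shows "(\<lambda>n. P (\<Omega> n) x) \<longlonglongrightarrow> P (\<Union>n. \<Omega> n) x"
proof -
  interpret finite_measure "M x" by (rule finite_measure_M)
  let ?U = "\<Union>n. \<Omega> n"
  have mn: "\<Omega> n \<in> sets borel" for n using m by auto
  have mU: "?U \<in> sets borel" using m by (intro sets.countable_UN) auto
  have "(\<lambda>n. measure (M x) (\<Omega> n)) \<longlonglongrightarrow> measure (M x) ?U"
    using m by (intro finite_Lim_measure_incseq inc) auto
  then have "(\<lambda>n. P (\<Omega> n) x \<bullet> x) \<longlonglongrightarrow> P ?U x \<bullet> x"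
    unfolding measure_M[OF mn] measure_M[OF mU] .
  then have lim: "(\<lambda>n. sqrt (P ?U x \<bullet> x - P (\<Omega> n) x \<bullet> x)) \<longlonglongrightarrow> sqrt (P ?U x \<bullet> x - P ?U x \<bullet> x)"
    by (intro tendsto_real_sqrt tendsto_diff tendsto_const)
  have e: "norm (P (\<Omega> n) x - P ?U x) = sqrt (P ?U x \<bullet> x - P (\<Omega> n) x \<bullet> x)" for n
  proof -
    have s: "P (\<Omega> n) (P ?U x) = P (\<Omega> n) x" 
      using P_Int[OF mn mU, of n x] by (simp add: inf.absorb1 UN_upper)
    have "P ?U x \<bullet> P (\<Omega> n) x = P (\<Omega> n) x \<bullet> x"
      using P_inner[OF mn, of n "P ?U x" x] s by simp
    moreover have "P (\<Omega> n) x \<bullet> P (\<Omega> n) x = P (\<Omega> n) x \<bullet> x" "P ?U x \<bullet> P ?U x = P ?U x \<bullet> x"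
      using P_form[OF mn, of n x] P_form[OF mU, of x] by (simp_all add: power2_norm_eq_inner)
    ultimately have "(norm (P (\<Omega> n) x - P ?U x))\<^sup>2 = P ?U x \<bullet> x - P (\<Omega> n) x \<bullet> x"
      by (simp add: power2_norm_eq_inner inner_diff inner_commute)
    then show ?thesis by (metis norm_ge_zero real_sqrt_unique)
  qed
  have "(\<lambda>n. norm (P (\<Omega> n) x - P ?U x)) \<longlonglongrightarrow> 0" unfolding e using lim by simp
  then show ?thesis by (simp add: tendsto_norm_zero_iff LIM_zero_iff)
qed

lemma P_truncation:
  assumes m: "\<Omega> \<in> sets borel" shows "(\<lambda>n. P (\<Omega> \<inter> {- real n..real n}) x) \<longlonglongrightarrow> P \<Omega> x"
proof -
  have U: "(\<Union>n. \<Omega> \<inter> {- real n..real n}) = \<Omega>"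
  proof
    show "\<Omega> \<subseteq> (\<Union>n. \<Omega> \<inter> {- real n..real n})"
    proof
      fix u assume u: "u \<in> \<Omega>"
      obtain n where "\<bar>u\<bar> < real n" using reals_Archimedean2 by blast
      then show "u \<in> (\<Union>n. \<Omega> \<inter> {- real n..real n})" using u by (intro UN_I[of n]) auto
    qed
  qed auto
  have "(\<lambda>n. P (\<Omega> \<inter> {- real n..real n}) x) \<longlonglongrightarrow> P (\<Union>n. \<Omega> \<inter> {- real n..real n}) x"
    using m by (intro P_incseq) (auto simp: incseq_def)
  then show ?thesis unfolding U .
qed

lemma P_decseq_zero:
  assumes m: "range \<Omega> \<subseteq> sets borel" and dec: "decseq \<Omega>" and e: "(\<Inter>n. \<Omega> n) = {}"
    and x: "\<And>n. P (\<Omega> n) x = x"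
  shows "x = 0"
proof -
  have mn: "\<Omega> n \<in> sets borel" for n using m by auto
  have "(\<lambda>n. P (- \<Omega> n) x) \<longlonglongrightarrow> P (\<Union>n. - \<Omega> n) x"
    using mn dec by (intro P_incseq) (auto simp: incseq_def decseq_def)
  moreover have "(\<Union>n. - \<Omega> n) = UNIV" using e by blast
  ultimately show ?thesis using x by (simp add: P_Compl[OF mn] P_UNIV LIMSEQ_const_iff)
qed

text \<open>The dimensions of the decreasing ranges become stationary, and a stationary range
  consists of vectors carried by every set of the sequence, hence by the empty intersection.\<close>

lemma gap:
  assumes m: "range \<Omega> \<subseteq> sets borel" and dec: "decseq \<Omega>" and e: "(\<Inter>n. \<Omega> n) = {}"
    and f: "finite_dim (range (P (\<Omega> 0)))"
  obtains n :: nat where "\<And>x. P (\<Omega> n) x = 0"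
proof -
  have mn: "\<Omega> n \<in> sets borel" for n using m by auto
  have sub: "range (P (\<Omega> k)) \<subseteq> range (P (\<Omega> n))" if "n \<le> k" for n k
    using P_subset[OF mn mn decseqD[OF dec that]] by (auto simp: range_P[OF mn])
  obtain n where n: "\<And>k. dim (range (P (\<Omega> n))) \<le> dim (range (P (\<Omega> k)))"
    using ex_has_least_nat[of "\<lambda>_. True" 0 "\<lambda>n. dim (range (P (\<Omega> n)))"] by auto
  have eq: "range (P (\<Omega> k)) = range (P (\<Omega> n))" if "n \<le> k" for k
    using finite_dim_eqI[OF subspace_range_P sub[OF that] finite_dim_subset[OF f sub] n] by simp
  have "x = 0" if x: "P (\<Omega> n) x = x" for x
  proof (rule P_decseq_zero[OF m dec e])
    fix k
    show "P (\<Omega> k) x = x"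
    proof (cases "n \<le> k")
      case True
      then show ?thesis using eq[OF True] x by (auto simp: range_P[OF mn])
    next
      case False
      then show ?thesis using P_subset[OF mn mn decseqD[OF dec, of k n] x] by simp
    qed
  qed
  then show thesis using that P_idem[OF mn] by blast
qed

text \<open>The lower bound and closedness of the graph make the image \<open>R\<close> complete; a
  vector of the range of \<open>Q\<close> orthogonal to \<open>R\<close> is in the kernel of the
  adjoint, that is, of \<open>A\<close>, and vanishes by the lower bound. \<open>Q\<close> may be a
  spectral projection or the identity.\<close>

lemma surjective_on_reducing:
  assumes Q: "orthogonal_projection Q" and QD: "\<And>x. x \<in> D \<Longrightarrow> Q x \<in> D"
    and QA: "\<And>x. x \<in> D \<Longrightarrow> A (Q x) = Q (A x)"
    and c: "c > 0" "\<And>x. x \<in> D \<Longrightarrow> Q x = x \<Longrightarrow> c * norm x \<le> norm (A x)" and v: "Q v = v"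
  obtains \<xi> where "\<xi> \<in> D" "Q \<xi> = \<xi>" "A \<xi> = v"
proof -
  define R where "R = A ` {x\<in>D. Q x = x}"
  have sR: "subspace R"
  proof (rule subspaceI)
    show "0 \<in> R" using zero_D by (auto simp: R_def blinfun.zero_right image_iff intro!: bexI[of _ 0])
    fix p q and k :: real assume "p \<in> R" "q \<in> R"
    then obtain a b where "a \<in> D" "Q a = a" "p = A a" "b \<in> D" "Q b = b" "q = A b" by (auto simp: R_def)
    then have "p + q = A (a + b)" "a + b \<in> {x\<in>D. Q x = x}" "k *\<^sub>R p = A (k *\<^sub>R a)" "k *\<^sub>R a \<in> {x\<in>D. Q x = x}"
      by (simp_all add: add scale add_D scale_D blinfun.add_right blinfun.scaleR_right)
    then show "p + q \<in> R" "k *\<^sub>R p \<in> R" unfolding R_def by blast+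
  qed
  have cR: "complete R"
    unfolding complete_def
  proof (intro allI impI, elim conjE)
    fix s assume s: "\<forall>n. s n \<in> R" "Cauchy s"
    then have "\<forall>n. \<exists>u. u \<in> D \<and> Q u = u \<and> s n = A u" by (auto simp: R_def)
    then obtain u where u: "\<And>n. u n \<in> D" "\<And>n. Q (u n) = u n" "\<And>n. s n = A (u n)" by metis
    have "Cauchy u"
    proof (rule CauchyI)
      fix e :: real assume "e > 0"
      then have "c * e > 0" using c by simp
      then obtain K where K: "\<And>m n. m \<ge> K \<Longrightarrow> n \<ge> K \<Longrightarrow> norm (s m - s n) < c * e"
        using CauchyD[OF s(2)] by blast
      have "norm (u m - u n) < e" if "m \<ge> K" "n \<ge> K" for m n
      proof -
        have "c * norm (u m - u n) \<le> norm (s m - s n)"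
          using c(2)[of "u m - u n"] u by (simp add: diff diff_D blinfun.diff_right)
        also have "\<dots> < c * e" using K that by blast
        finally show ?thesis using c by simp
      qed
      then show "\<exists>M. \<forall>m\<ge>M. \<forall>n\<ge>M. norm (u m - u n) < e" by blast
    qed
    then obtain x where x: "u \<longlonglongrightarrow> x" using Cauchy_convergent convergent_def by blast
    obtain y where y: "s \<longlonglongrightarrow> y" using s(2) Cauchy_convergent convergent_def by blast
    have "x \<in> D" "A x = y" using closed_graph[OF u(1) x, of y] y by (simp_all add: u(3)[symmetric])
    moreover have "Q x = x"
    proof (rule LIMSEQ_unique)
      show "(\<lambda>n. Q (u n)) \<longlonglongrightarrow> Q x" by (intro tendsto_intros x)
      show "(\<lambda>n. Q (u n)) \<longlonglongrightarrow> x" using x u(2) by simp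
    qed
    ultimately show "\<exists>l\<in>R. s \<longlonglongrightarrow> l" using y by (auto simp: R_def)
  qed
  note pR = sR cR
  define \<eta> where "\<eta> = v - proj R v"
  have RQ: "Q r = r" if "r \<in> R" for r using that by (auto simp: R_def simp flip: QA)
  have Q\<eta>: "Q \<eta> = \<eta>" using v RQ[OF proj_mem[OF pR]] by (simp add: \<eta>_def blinfun.diff_right)
  have "A x \<bullet> \<eta> = x \<bullet> 0" if x: "x \<in> D" for x
  proof -
    have "Q (Q x) = Q x" by (rule orthogonal_projectionD(2)[OF Q])
    then have "A (Q x) \<in> R" unfolding R_def using QD[OF x] by (intro imageI) simp
    then have "\<eta> \<bullet> A (Q x) = 0" using proj_orthogonal[OF pR] by (simp add: \<eta>_def)
    moreover have "A x \<bullet> \<eta> = A (Q x) \<bullet> \<eta>"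
      using orthogonal_projectionD(1)[OF Q, of "A x" \<eta>] by (simp add: Q\<eta> QA[OF x])
    ultimately show ?thesis by (simp add: inner_commute)
  qed
  then have "\<eta> \<in> D" "A \<eta> = 0" using adjointD[of \<eta> 0] by auto
  then have "\<eta> = 0" using c(2)[of \<eta>] Q\<eta> c(1) by (simp add: mult_le_0_iff)
  then have "v \<in> R" using proj_mem[OF pR, of v] by (simp add: \<eta>_def)
  then show thesis using that by (auto simp: R_def)
qed

end

section \<open>Finite rank of the spectral projections near the discrete spectrum\<close>

context self_adjoint_operator
begin

definition null :: "real set \<Rightarrow> bool" where "null \<Omega> \<longleftrightarrow> \<Omega> \<in> sets borel \<and> (\<forall>x. P \<Omega> x = 0)"

lemma null_subset: "null \<Omega> \<Longrightarrow> \<Omega>' \<in> sets borel \<Longrightarrow> \<Omega>' \<subseteq> \<Omega> \<Longrightarrow> null \<Omega>'"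
  unfolding null_def by (metis P_Int blinfun.zero_right inf.absorb1)

lemma null_countable_Union:
  assumes "countable \<U>" "\<And>U. U \<in> \<U> \<Longrightarrow> null U" shows "null (\<Union>\<U>)"
proof -
  have m: "\<Union>\<U> \<in> sets borel" using assms by (intro sets.countable_Union) (auto simp: null_def)
  have "P (\<Union>\<U>) x = 0" for x
  proof -
    have "\<Union>\<U> \<in> null_sets (M x)"
      using null_sets_UN'[OF assms(1), of "\<lambda>U. U" "M x"] assms(2) by (auto simp: null_def null_sets_def emeasure_M)
    then have "ennreal (P (\<Union>\<U>) x \<bullet> x) = 0" using m by (simp add: null_sets_def emeasure_M)
    then show ?thesis using P_form[OF m, of x] by simp
  qed
  then show ?thesis using m by (simp add: null_def)
qed

lemma null_open_Union:
  assumes "\<And>U. U \<in> \<U> \<Longrightarrow> open U \<and> null U" shows "null (\<Union>\<U>)"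
proof -
  obtain \<V> where "\<V> \<subseteq> \<U>" "countable \<V>" "\<Union>\<V> = \<Union>\<U>" using Lindelof[of \<U>] assms by blast
  moreover from this have "null U" if "U \<in> \<V>" for U using assms that by blast
  ultimately show ?thesis using null_countable_Union[of \<V>] by simp
qed

lemma null_resolvent:
  assumes l: "l \<in> resolvent_set D A" obtains e where "e > 0" "null {l - e<..<l + e}"
proof -
  obtain C where C: "\<And>x. x \<in> D \<Longrightarrow> norm x \<le> C * norm (A x - l *\<^sub>R x)"
    using l by (auto simp: resolvent_set_def)
  \<comment> \<open>Chosen such that \<open>\<bar>C\<bar> * e = 1 - e < 1\<close>: on the spectral
    subspace of radius \<open>e\<close> the resolvent bound then contradicts itself.\<close>
  define e where "e = 1 / (\<bar>C\<bar> + 1)"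
  have e: "e > 0" by (simp add: e_def add_nonneg_pos)
  let ?\<Omega> = "{l - e<..<l + e}"
  have "P ?\<Omega> x = 0" for x
  proof -
    define y where "y = P ?\<Omega> x"
    have yD: "y \<in> D" unfolding y_def by (rule P_bounded_D[of _ "\<bar>l\<bar> + e"]) auto
    have "norm (A y - l *\<^sub>R y) \<le> e * norm y"
      by (rule P_norm_bound[of ?\<Omega>]) (auto simp: y_def P_idem)
    then have "norm y \<le> \<bar>C\<bar> * (e * norm y)"
      using C[OF yD] mult_mono[OF abs_ge_self[of C], of "norm (A y - l *\<^sub>R y)" "e * norm y"] by simp
    also have "\<dots> = (1 - e) * norm y" by (simp add: e_def field_simps)
    finally have "e * norm y \<le> 0" by (simp add: algebra_simps)
    then show ?thesis using e by (simp add: y_def mult_le_0_iff)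
  qed
  then show thesis using that e by (simp add: null_def)
qed

lemma null_open_resolvent:
  assumes "U \<subseteq> resolvent_set D A" "open U" shows "null U"
proof -
  let ?\<U> = "{V. open V \<and> null V}"
  have "U \<subseteq> \<Union>?\<U>"
  proof
    fix l assume "l \<in> U"
    then have "l \<in> resolvent_set D A" using assms by blast
    from null_resolvent[OF this] obtain e where "e > 0" "null {l - e<..<l + e}" .
    then show "l \<in> \<Union>?\<U>" by (intro UnionI[of "{l - e<..<l + e}"]) auto
  qed
  moreover have "null (\<Union>?\<U>)" by (rule null_open_Union) auto
  ultimately show ?thesis by (metis null_subset assms(2) borel_open)
qed

lemma finite_dim_sum:
  assumes "finite_dim V" "finite_dim W" shows "finite_dim {v + w | v w. v \<in> V \<and> w \<in> W}"
proof -
  obtain S T where ST: "finite S" "V \<subseteq> span S" "finite T" "W \<subseteq> span T" using assms unfolding finite_dim_def by blast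
  then have "{v + w | v w. v \<in> V \<and> w \<in> W} \<subseteq> span (S \<union> T)" by (auto simp: span_Un)
  then show ?thesis using ST unfolding finite_dim_def by blast
qed

lemma finite_rank_Un:
  assumes m: "\<Omega> \<in> sets borel" "\<Omega>' \<in> sets borel" and f: "finite_dim (range (P \<Omega>))" "finite_dim (range (P \<Omega>'))"
  shows "finite_dim (range (P (\<Omega> \<union> \<Omega>')))"
proof (rule finite_dim_subset[OF finite_dim_sum[OF f]], rule image_subsetI)
  fix x
  have "P (\<Omega> \<union> \<Omega>') x = P \<Omega> x + P (\<Omega>' - \<Omega>) x"
    using P_Un[of \<Omega> "\<Omega>' - \<Omega>" x] m by simp
  moreover have "P (\<Omega>' - \<Omega>) x = P \<Omega>' (P (\<Omega>' - \<Omega>) x)"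
    using P_Int[of \<Omega>' "\<Omega>' - \<Omega>" x] m by (simp add: inf.absorb2)
  ultimately show "P (\<Omega> \<union> \<Omega>') x \<in> {v + w |v w. v \<in> range (P \<Omega>) \<and> w \<in> range (P \<Omega>')}" by blast
qed

lemma finite_rank_subset:
  assumes "\<Omega> \<in> sets borel" "\<Omega>' \<in> sets borel" "\<Omega>' \<subseteq> \<Omega>" "finite_dim (range (P \<Omega>))"
  shows "finite_dim (range (P \<Omega>'))"
  using assms P_subset[OF assms(1-3)] by (intro finite_dim_subset[OF assms(4)]) (auto simp: range_P)

text \<open>A punctured neighbourhood of \<open>l\<close> consists of resolvent points and carries
  no spectral measure, and \<open>P {l}\<close> maps into the eigenspace.\<close>

lemma finite_rank_discrete:
  assumes l: "l \<in> discrete_spectrum D A"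
  obtains e where "e > 0" "finite_dim (range (P {l - e<..<l + e}))"
proof -
  have f: "finite_dim {x\<in>D. A x = l *\<^sub>R x}" and li: "\<not> l islimpt spectrum D A"
    using l by (auto simp: discrete_spectrum_def)
  then obtain e where e: "e > 0" "\<And>u. u \<in> spectrum D A \<Longrightarrow> u \<noteq> l \<Longrightarrow> e \<le> dist u l"
    unfolding islimpt_approachable by (meson not_le)
  have "{l - e<..<l} \<union> {l<..<l + e} \<subseteq> resolvent_set D A"
  proof
    fix u assume u: "u \<in> {l - e<..<l} \<union> {l<..<l + e}"
    then have "dist u l < e" "u \<noteq> l" by (auto simp: dist_real_def)
    then show "u \<in> resolvent_set D A" using e(2)[of u] by (auto simp: spectrum_def)
  qed
  then have n: "null ({l - e<..<l} \<union> {l<..<l + e})" by (rule null_open_resolvent) auto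
  have "range (P {l}) \<subseteq> {x\<in>D. A x = l *\<^sub>R x}"
  proof (rule image_subsetI)
    fix x
    define y where "y = P {l} x"
    have "y \<in> D" unfolding y_def by (rule P_bounded_D[of _ "\<bar>l\<bar>"]) auto
    moreover have "norm (A y - l *\<^sub>R y) \<le> 0 * norm y"
      by (rule P_norm_bound[of "{l}"]) (auto simp: y_def P_idem)
    ultimately show "P {l} x \<in> {x\<in>D. A x = l *\<^sub>R x}" by (simp add: y_def)
  qed
  then have "finite_dim (range (P {l}))" using f finite_dim_subset by blast
  moreover have "finite_dim (range (P ({l - e<..<l} \<union> {l<..<l + e})))"
    using n by (auto simp: null_def finite_dim_def image_subset_iff intro!: exI[of _ "{}"])
  ultimately have "finite_dim (range (P ({l} \<union> ({l - e<..<l} \<union> {l<..<l + e}))))"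
    by (rule finite_rank_Un[rotated 2]) auto
  moreover have "{l} \<union> ({l - e<..<l} \<union> {l<..<l + e}) = {l - e<..<l + e}" using e by auto
  ultimately show thesis using that e by simp
qed

text \<open>Here the assumption on the essential spectrum enters: each point of
  \<open>[-c, c]\<close> is a resolvent point or a discrete eigenvalue, hence has a neighbourhood of
  finite rank, and finitely many of these cover the interval.\<close>

lemma finite_rank_compact:
  assumes A: "O0e b D A" and c: "c < b" shows "finite_dim (range (P {- c..c}))"
proof -
  have loc: "\<exists>e>0. finite_dim (range (P {l - e<..<l + e}))" if l: "l \<in> {- c..c}" for l
  proof (cases "l \<in> resolvent_set D A")
    case True
    from null_resolvent[OF this] obtain e where e: "e > 0" "null {l - e<..<l + e}" .
    then have "finite_dim (range (P {l - e<..<l + e}))"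
      by (auto simp: null_def finite_dim_def image_subset_iff intro!: exI[of _ "{}"])
    then show ?thesis using e by blast
  next
    case False
    then have "l \<in> discrete_spectrum D A" using A l c by (auto simp: O0e_def essential_spectrum_def spectrum_def)
    then show ?thesis using finite_rank_discrete by metis
  qed
  then have "\<exists>e. \<forall>l\<in>{- c..c}. e l > 0 \<and> finite_dim (range (P {l - e l<..<l + e l}))"
    by (intro bchoice ballI)
  then obtain e where e: "\<And>l. l \<in> {- c..c} \<Longrightarrow> e l > 0 \<and> finite_dim (range (P {l - e l<..<l + e l}))" by blast
  have "{- c..c} \<subseteq> (\<Union>l\<in>{- c..c}. {l - e l<..<l + e l})" using e by fastforce
  then obtain L where L: "L \<subseteq> {- c..c}" "finite L" "{- c..c} \<subseteq> (\<Union>l\<in>L. {l - e l<..<l + e l})"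
    using compactE_image[OF compact_Icc, of "{- c..c}" "\<lambda>l. {l - e l<..<l + e l}" "- c" c] by auto
  have fd: "finite_dim (range (P (\<Union>l\<in>L. {l - e l<..<l + e l})))" using L(2,1)
  proof (induct L rule: finite_induct)
    case empty
    show ?case by (auto simp: P_empty finite_dim_def image_subset_iff intro!: exI[of _ "{}"])
  next
    case (insert l L)
    then show ?case using e by (auto intro!: finite_rank_Un)
  qed
  have "(\<Union>l\<in>L. {l - e l<..<l + e l}) \<in> sets borel" by (intro sets.finite_UN L(2)) auto
  then show ?thesis by (rule finite_rank_subset[OF _ _ L(3) fd]) simp
qed

end

section \<open>Fredholm indices\<close>

text \<open>\<open>quotient_dim\<close> uses an unspecified complement. A complement is carried onto
  any other along \<open>R\<close>; finite dimension is known for \<open>U'\<close> only, so the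
  isomorphism starts there.\<close>

lemma complement_dim_eq:
  fixes U U' R Y :: "'a::real_inner set"
  assumes U: "subspace U" "U \<inter> R = {0}" "Y = {u + r | u r. u \<in> U \<and> r \<in> R}"
    and U': "subspace U'" "U' \<inter> R = {0}" "Y = {u + r | u r. u \<in> U' \<and> r \<in> R}"
    and R: "subspace R" and f: "finite_dim U'"
  shows "dim U = dim U'"
proof -
  define h where "h y = (SOME u. u \<in> U \<and> y - u \<in> R)" for y
  have h: "h y \<in> U \<and> y - h y \<in> R" if "y \<in> Y" for y
    unfolding h_def
  proof (rule someI_ex)
    obtain u r where "u \<in> U" "r \<in> R" "y = u + r" using \<open>y \<in> Y\<close> U(3) by blast
    then show "\<exists>u. u \<in> U \<and> y - u \<in> R" by (intro exI[of _ u]) simp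
  qed
  have h_eq: "h y = u" if "y \<in> Y" "u \<in> U" "y - u \<in> R" for y u
  proof -
    have "(y - h y) - (y - u) \<in> R" using subspace_diff[OF R conjunct2[OF h[OF that(1)]] that(3)] .
    then have "u - h y \<in> R" by (simp add: algebra_simps)
    moreover have "u - h y \<in> U" using subspace_diff[OF U(1) that(2) conjunct1[OF h[OF that(1)]]] .
    ultimately have "u - h y \<in> U \<inter> R" by simp
    then show ?thesis unfolding U(2) by simp
  qed
  have R0: "0 \<in> R" and U'0: "0 \<in> U'" using R U' by (auto simp: subspace_0)
  have U'Y: "y \<in> Y" if "y \<in> U'" for y using that R0 unfolding U'(3) by force
  have UY: "y \<in> Y" if "y \<in> U" for y using that R0 unfolding U(3) by force
  note p = U'(1) finite_dim_complete[OF U'(1) f]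
  \<comment> \<open>\<open>h\<close>, the projection of \<open>Y\<close> onto \<open>U\<close> along
    \<open>R\<close>, is linear on \<open>Y\<close> only. Precomposing with \<open>proj U'\<close>
    gives a linear map of the whole space, as \<open>rank_nullity\<close> requires.\<close>
  define g where "g y = h (proj U' y)" for y
  have lg: "linear g"
  proof (rule linearI)
    fix x y and c :: real
    let ?a = "proj U' x" and ?b = "proj U' y"
    have ab: "?a \<in> Y" "?b \<in> Y" "?a + ?b \<in> Y" "c *\<^sub>R ?a \<in> Y"
      using proj_mem[OF p] U'(1) by (auto intro!: U'Y subspace_add subspace_scale)
    have "(?a - h ?a) + (?b - h ?b) \<in> R" using h ab R by (intro subspace_add) auto
    then have "?a + ?b - (h ?a + h ?b) \<in> R" by (simp add: algebra_simps)
    then show "g (x + y) = g x + g y"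
      unfolding g_def linear_add[OF linear_proj[OF p]]
      using h ab U(1) by (intro h_eq) (auto simp: subspace_add)
    have "c *\<^sub>R (?a - h ?a) \<in> R" using h ab R by (intro subspace_scale) auto
    then have "c *\<^sub>R ?a - c *\<^sub>R h ?a \<in> R" by (simp add: algebra_simps)
    then show "g (c *\<^sub>R x) = c *\<^sub>R g x"
      unfolding g_def linear_scale[OF linear_proj[OF p]]
      using h ab U(1) by (intro h_eq) (auto simp: subspace_scale)
  qed
  have g: "g y = h y" if "y \<in> U'" for y using proj_id[OF p that] by (simp add: g_def)
  have "{x\<in>U'. g x = 0} = {0}"
  proof -
    have "x = 0" if "x \<in> U'" "g x = 0" for x using h[OF U'Y[OF that(1)]] that U'(2) g by auto
    then show ?thesis using U'0 linear_0[OF lg] by auto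
  qed
  moreover have "g ` U' = U"
  proof
    show "g ` U' \<subseteq> U" using g h U'Y by auto
    show "U \<subseteq> g ` U'"
    proof
      fix u assume u: "u \<in> U"
      then obtain v r where v: "v \<in> U'" "r \<in> R" "u = v + r" using UY U'(3) by blast
      have "v - u \<in> R" using v R subspace_neg[of R r] by simp
      then have "h v = u" using h_eq[OF U'Y[OF v(1)] u] by blast
      then show "u \<in> g ` U'" using g v(1) by force
    qed
  qed
  moreover have "dim {0::'a} = 0" by (rule dim_zero_subspace)
  ultimately show ?thesis using rank_nullity[OF lg U'(1) f] by simp
qed

text \<open>
  The map \<open>Q\<close> identifies both \<open>V / N\<close> and \<open>Y / Y\<^sub>0\<close> with the same space, so the index of \<open>S\<close> is
  that of its restriction \<open>N \<rightarrow> Y\<^sub>0\<close> between finite-dimensional spaces.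
\<close>
lemma fredholm_index_eq:
  fixes V Y :: "'a::real_inner set"
  assumes V: "subspace V" and Y: "subspace Y" and S: "linear S" and Q: "linear Q" and SV: "S ` V \<subseteq> Y"
    and QS: "\<And>v. v \<in> V \<Longrightarrow> Q (S v) = Q v" and QY: "Q ` Y \<subseteq> Q ` V"
    and fN: "finite_dim {v\<in>V. Q v = 0}" and fY: "finite_dim {y\<in>Y. Q y = 0}"
  shows "fredholm_index V Y S = int (dim {v\<in>V. Q v = 0}) - int (dim {y\<in>Y. Q y = 0})"
proof -
  define N where "N = {v\<in>V. Q v = 0}"
  define Y0 where "Y0 = {y\<in>Y. Q y = 0}"
  have sN: "subspace N" and sY0: "subspace Y0"
    using V Y Q by (auto simp: N_def Y0_def subspace_def linear_0 linear_add linear_scale)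
  have ker: "{v\<in>V. S v = 0} = {v\<in>N. S v = 0}" using QS linear_0[OF Q] by (force simp: N_def)
  have rnN: "dim N = dim {v\<in>V. S v = 0} + dim (S ` N)"
    unfolding ker by (rule rank_nullity[OF S sN]) (use fN N_def in simp)
  have SN: "S ` N \<subseteq> Y0" using SV QS by (auto simp: N_def Y0_def)
  have fY0: "finite_dim Y0" using fY by (simp add: Y0_def)
  have sSN: "subspace (S ` N)" using S sN by (rule linear_subspace_image)
  have fSN: "finite_dim (S ` N)" using finite_dim_subset[OF fY0 SN] .
  note p = sSN finite_dim_complete[OF sSN fSN]
  \<comment> \<open>The orthogonal complement of \<open>S N\<close> in \<open>Y0\<close> turns out
    to be a complement of \<open>S V\<close> in \<open>Y\<close>: each \<open>y\<close> in
    \<open>Y\<close> can be moved into \<open>Y0\<close> by subtracting some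
    \<open>S v\<close>.\<close>
  define U' where "U' = {y\<in>Y0. proj (S ` N) y = 0}"
  have sU': "subspace U'" using sY0 linear_proj[OF p]
    by (auto simp: U'_def subspace_def linear_0 linear_add linear_scale)
  have fU': "finite_dim U'" by (rule finite_dim_subset[OF fY0]) (auto simp: U'_def)
  have "proj (S ` N) ` Y0 = S ` N"
  proof
    show "proj (S ` N) ` Y0 \<subseteq> S ` N" using proj_mem[OF p] by blast
    show "S ` N \<subseteq> proj (S ` N) ` Y0"
    proof
      fix y assume y: "y \<in> S ` N"
      then show "y \<in> proj (S ` N) ` Y0" using proj_id[OF p y] SN by (intro image_eqI[of _ _ y]) auto
    qed
  qed
  then have rnY: "dim Y0 = dim U' + dim (S ` N)"
    using rank_nullity[OF linear_proj[OF p] sY0 fY0] by (simp add: U'_def)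
  have sR: "subspace (S ` V)" using S V by (rule linear_subspace_image)
  have int0: "U' \<inter> S ` V = {0}"
  proof -
    have "y = 0" if "y \<in> U'" "y = S v" "v \<in> V" for y v
    proof -
      have "Q v = 0" using QS[OF that(3)] that by (simp add: U'_def Y0_def)
      then have "y \<in> S ` N" using that by (auto simp: N_def)
      then show ?thesis using that(1) proj_id[OF p] by (simp add: U'_def)
    qed
    then show ?thesis using subspace_0[OF sU'] subspace_0[OF sR] by auto
  qed
  have sum: "Y = {u + r | u r. u \<in> U' \<and> r \<in> S ` V}"
  proof
    show "Y \<subseteq> {u + r | u r. u \<in> U' \<and> r \<in> S ` V}"
    proof
      fix y assume y: "y \<in> Y"
      then obtain v where v: "v \<in> V" "Q y = Q v" using QY by blast
      define z where "z = y - S v"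
      have "S v \<in> Y" using SV v by blast
      then have z: "z \<in> Y0" using y v Y QS[OF v(1)]
        by (simp add: z_def Y0_def subspace_diff linear_diff[OF Q])
      define w where "w = proj (S ` N) z"
      have w: "w \<in> S ` N" unfolding w_def by (rule proj_mem[OF p])
      have "z - w \<in> U'"
        using z w SN sY0 proj_id[OF p w] by (auto simp: U'_def subspace_diff linear_diff[OF linear_proj[OF p]] w_def)
      moreover have "w + S v \<in> S ` V"
        using w v sR by (intro subspace_add) (auto simp: N_def)
      moreover have "y = (z - w) + (w + S v)" by (simp add: z_def)
      ultimately show "y \<in> {u + r | u r. u \<in> U' \<and> r \<in> S ` V}" by blast
    qed
    show "{u + r | u r. u \<in> U' \<and> r \<in> S ` V} \<subseteq> Y"
      using SV Y by (auto simp: U'_def Y0_def intro!: subspace_add)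
  qed
  let ?C = "\<lambda>U. subspace U \<and> U \<inter> S ` V = {0} \<and> Y = {u + r | u r. u \<in> U \<and> r \<in> S ` V}"
  define U where "U = (SOME U. ?C U)"
  have "?C U" unfolding U_def by (rule someI[of ?C U']) (use sU' int0 sum in blast)
  then have "dim U = dim U'"
    by (elim conjE) (rule complement_dim_eq[OF _ _ _ sU' int0 sum sR fU'])
  then have "quotient_dim Y (S ` V) = dim U'" by (simp only: quotient_dim_def U_def)
  then show ?thesis using rnN rnY by (simp add: fredholm_index_def N_def Y0_def)
qed

section \<open>Bounded perturbations with a spectral gap\<close>

text \<open>
  A Davis--Kahan type estimate: \<open>A \<le> - c\<close> on \<open>X\<close> and \<open>T \<ge> 0\<close> on \<open>W\<close>, and \<open>A\<close>, \<open>T\<close> differ by at most \<open>\<beta>\<close>.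
  The shifts \<open>n\<close>, \<open>m\<close> make the norm hypotheses sharp; one application of the identity for
  \<open>(n + m) (x \<bullet> w)\<close> contracts the bound towards \<open>\<beta> / c\<close>.
\<close>
lemma davis_kahan_bounded:
  fixes X W :: "'a::real_inner set"
  assumes n: "0 < c" "c \<le> n" and m: "0 \<le> m" and \<beta>: "0 \<le> \<beta>"
    and X: "\<And>x. x \<in> X \<Longrightarrow> A x + n *\<^sub>R x \<in> X \<and> norm (A x + n *\<^sub>R x) \<le> (n - c) * norm x"
    and W: "\<And>w. w \<in> W \<Longrightarrow> T w - m *\<^sub>R w \<in> W \<and> norm (T w - m *\<^sub>R w) \<le> m * norm w"
    and rel: "\<And>x w. x \<in> X \<Longrightarrow> w \<in> W \<Longrightarrow> \<bar>A x \<bullet> w - x \<bullet> T w\<bar> \<le> \<beta> * norm x * norm w"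
    and x: "x \<in> X" and w: "w \<in> W"
  shows "\<bar>x \<bullet> w\<bar> \<le> \<beta> / c * norm x * norm w"
proof -
  define \<rho> where "\<rho> = (n + m - c) / (n + m)"
  \<comment> \<open>The \<open>j\<close>-th iterate of the bound: \<open>k 0 \<ge> 1\<close> is the
    Cauchy-Schwarz inequality, and \<open>\<beta> / c\<close> is the fixed point of the contraction
    with factor \<open>\<rho>\<close>.\<close>
  define k where "k j = \<beta> / c + \<rho> ^ j" for j :: nat
  have nm: "n + m > 0" using n m by linarith
  have \<rho>: "0 \<le> \<rho>" "\<rho> < 1" using n m nm by (auto simp: \<rho>_def)
  have k0: "0 \<le> k j" for j using \<beta> n \<rho> by (simp add: k_def)
  have step: "(k j * m + k j * (n - c) + \<beta>) / (n + m) = k (Suc j)" for j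
  proof -
    have 1: "\<beta> / c * \<rho> + \<beta> / (n + m) = \<beta> / c" 
    proof -
      have "\<rho> = 1 - c / (n + m)" using nm by (simp add: \<rho>_def diff_divide_distrib)
      moreover have "\<beta> / c * (1 - c / (n + m)) = \<beta> / c - \<beta> / (n + m)" using n by (simp add: right_diff_distrib)
      ultimately show ?thesis by simp
    qed
    have "k j * m + k j * (n - c) + \<beta> = k j * (n + m - c) + \<beta>" by (simp add: algebra_simps)
    then have "(k j * m + k j * (n - c) + \<beta>) / (n + m) = k j * \<rho> + \<beta> / (n + m)"
      by (simp add: \<rho>_def add_divide_distrib)
    also have "\<dots> = (\<beta> / c * \<rho> + \<beta> / (n + m)) + \<rho> ^ Suc j" by (simp add: k_def algebra_simps)
    finally show ?thesis unfolding 1 by (simp add: k_def)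
  qed
  have bound: "\<bar>x \<bullet> w\<bar> \<le> k j * norm x * norm w" if "x \<in> X" "w \<in> W" for j x w
    using that
  proof (induct j arbitrary: x w)
    case 0
    have "\<bar>x \<bullet> w\<bar> \<le> 1 * (norm x * norm w)" using Cauchy_Schwarz_ineq2[of x w] by simp
    also have "\<dots> \<le> k 0 * (norm x * norm w)" using \<beta> n by (intro mult_right_mono) (auto simp: k_def)
    finally show ?case by simp
  next
    case (Suc j)
    have "(n + m) * (x \<bullet> w) = (A x + n *\<^sub>R x) \<bullet> w - x \<bullet> (T w - m *\<^sub>R w) - (A x \<bullet> w - x \<bullet> T w)"
      by (simp add: inner_add_left inner_diff_right algebra_simps)
    then have "(n + m) * \<bar>x \<bullet> w\<bar> \<le> \<bar>(A x + n *\<^sub>R x) \<bullet> w\<bar> + \<bar>x \<bullet> (T w - m *\<^sub>R w)\<bar> + \<bar>A x \<bullet> w - x \<bullet> T w\<bar>"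
      using nm by (simp add: abs_mult flip: abs_mult_pos)
    also have "\<dots> \<le> k j * ((n - c) * norm x) * norm w + k j * norm x * (m * norm w) + \<beta> * norm x * norm w"
    proof (intro add_mono)
      have "\<bar>(A x + n *\<^sub>R x) \<bullet> w\<bar> \<le> k j * norm (A x + n *\<^sub>R x) * norm w" using Suc X by blast
      also have "\<dots> \<le> k j * ((n - c) * norm x) * norm w"
        using X[OF Suc(2)] k0 by (intro mult_right_mono mult_left_mono) auto
      finally show "\<bar>(A x + n *\<^sub>R x) \<bullet> w\<bar> \<le> k j * ((n - c) * norm x) * norm w" .
      have "\<bar>x \<bullet> (T w - m *\<^sub>R w)\<bar> \<le> k j * norm x * norm (T w - m *\<^sub>R w)" using Suc W by blast
      also have "\<dots> \<le> k j * norm x * (m * norm w)"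
        using W[OF Suc(3)] k0 by (intro mult_left_mono) auto
      finally show "\<bar>x \<bullet> (T w - m *\<^sub>R w)\<bar> \<le> k j * norm x * (m * norm w)" .
    qed (rule rel[OF Suc(2,3)])
    also have "\<dots> = (k j * m + k j * (n - c) + \<beta>) * (norm x * norm w)" by (simp add: algebra_simps)
    finally have "\<bar>x \<bullet> w\<bar> \<le> (k j * m + k j * (n - c) + \<beta>) / (n + m) * (norm x * norm w)"
      using nm by (simp add: field_simps)
    then show ?case by (simp add: step)
  qed
  have "k \<longlonglongrightarrow> \<beta> / c + 0"
    unfolding k_def using \<rho> by (intro tendsto_add tendsto_const LIMSEQ_power_zero) auto
  then have "(\<lambda>j. k j * norm x * norm w) \<longlonglongrightarrow> (\<beta> / c + 0) * norm x * norm w"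
    by (intro tendsto_mult tendsto_const)
  from LIMSEQ_le_const[OF this] show ?thesis using bound[OF x w] by auto
qed

section \<open>Maximal definite extensions and the splitting of a perturbed operator\<close>

context self_adjoint_operator
begin

text \<open>\<open>d\<close> bounds the dimension of all admissible \<open>L\<close>, so a largest
  one exists. A vector form-orthogonal to \<open>L + X\<close> on which the form had the forbidden
  sign could be adjoined to \<open>L\<close>. The sign \<open>\<sigma>\<close> handles negative and
  positive definiteness together.\<close>

lemma maximal_definite_exists:
  assumes X: "subspace X" and \<epsilon>: "\<epsilon> > 0" "\<And>x. x \<in> X \<Longrightarrow> x \<in> D \<Longrightarrow> \<sigma> * (A x \<bullet> x) \<le> - \<epsilon> * (x \<bullet> x)"
    and bound: "\<And>L k. subspace L \<Longrightarrow> L \<subseteq> D \<Longrightarrow> L \<inter> X \<subseteq> {0} \<Longrightarrow> k > 0 \<Longrightarrow>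
      (\<And>l x. l \<in> L \<Longrightarrow> x \<in> X \<Longrightarrow> x \<in> D \<Longrightarrow> \<sigma> * (A (l + x) \<bullet> (l + x)) \<le> - k * ((l + x) \<bullet> (l + x))) \<Longrightarrow> dim L \<le> d"
  obtains L k where "subspace L" "L \<subseteq> D" "finite_dim L" "L \<inter> X \<subseteq> {0}" "k > 0"
    "\<And>l x. l \<in> L \<Longrightarrow> x \<in> X \<Longrightarrow> x \<in> D \<Longrightarrow> \<sigma> * (A (l + x) \<bullet> (l + x)) \<le> - k * ((l + x) \<bullet> (l + x))"
    "\<And>\<xi>. \<xi> \<in> D \<Longrightarrow> (\<And>l x. l \<in> L \<Longrightarrow> x \<in> X \<Longrightarrow> x \<in> D \<Longrightarrow> A \<xi> \<bullet> (l + x) = 0) \<Longrightarrow> 0 \<le> \<sigma> * (A \<xi> \<bullet> \<xi>)"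
proof -
  define good where "good L k \<longleftrightarrow> subspace L \<and> L \<subseteq> D \<and> finite_dim L \<and> L \<inter> X \<subseteq> {0} \<and> k > 0 \<and>
    (\<forall>l\<in>L. \<forall>x\<in>X \<inter> D. \<sigma> * (A (l + x) \<bullet> (l + x)) \<le> - k * ((l + x) \<bullet> (l + x)))" for L k
  have "good {0} \<epsilon>" using \<epsilon> zero_D by (auto simp: good_def finite_dim_def intro!: exI[of _ "{}"])
  then have ex: "\<exists>L k. good L k \<and> dim L = dim {0::'a}" by blast
  have le: "n \<le> d" if ex_n: "\<exists>L k. good L k \<and> dim L = n" for n
  proof -
    obtain L k where "good L k" "dim L = n" using ex_n by blast
    then show ?thesis using bound[of L k] by (auto simp: good_def)
  qed
  obtain n where n: "\<exists>L k. good L k \<and> dim L = n" "\<And>n'. \<exists>L k. good L k \<and> dim L = n' \<Longrightarrow> n' \<le> n"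
    using GreatestI_nat[of "\<lambda>n. \<exists>L k. good L k \<and> dim L = n", OF ex le]
      Greatest_le_nat[of "\<lambda>n. \<exists>L k. good L k \<and> dim L = n", OF _ le] by blast
  obtain L k where L: "good L k" "dim L = n" using n(1) by blast
  have max: "dim L' \<le> dim L" if "good L' k'" for L' k' using n(2) L(2) that by blast
  have Lp: "subspace L" "L \<subseteq> D" "finite_dim L" "L \<inter> X \<subseteq> {0}" "k > 0"
    "\<And>l x. l \<in> L \<Longrightarrow> x \<in> X \<Longrightarrow> x \<in> D \<Longrightarrow> \<sigma> * (A (l + x) \<bullet> (l + x)) \<le> - k * ((l + x) \<bullet> (l + x))"
    using L by (auto simp: good_def)
  have X0: "0 \<in> X" using X by (rule subspace_0)
  show thesis
  proof (rule that[OF Lp])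
    fix \<xi> assume \<xi>: "\<xi> \<in> D" and orth: "\<And>l x. l \<in> L \<Longrightarrow> x \<in> X \<Longrightarrow> x \<in> D \<Longrightarrow> A \<xi> \<bullet> (l + x) = 0"
    show "0 \<le> \<sigma> * (A \<xi> \<bullet> \<xi>)"
    proof (rule ccontr)
      assume neg: "\<not> 0 \<le> \<sigma> * (A \<xi> \<bullet> \<xi>)"
      then have \<xi>0: "\<xi> \<noteq> 0" by auto
      define L' where "L' = {l + a *\<^sub>R \<xi> | l a. l \<in> L}"
      have \<xi>L: "\<xi> \<notin> L" using orth[of \<xi> 0] X0 zero_D neg by auto
      have L'eq: "L' = span (insert \<xi> L)"
        unfolding span_insert L'_def using Lp(1)
        by (auto simp: span_eq_iff[THEN iffD2]) (metis add_diff_cancel_right', metis diff_add_cancel)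
      have sL': "subspace L'" unfolding L'eq by (rule subspace_span)
      have fL': "finite_dim L'"
      proof -
        obtain S where S: "finite S" "L \<subseteq> span S" using Lp(3) by (auto simp: finite_dim_def)
        have "insert \<xi> L \<subseteq> span (insert \<xi> S)" using S(2) span_mono[of S "insert \<xi> S"] span_base[of \<xi> "insert \<xi> S"] by auto
        then have "L' \<subseteq> span (insert \<xi> S)" unfolding L'eq by (simp add: span_minimal)
        then show ?thesis using S(1) unfolding finite_dim_def by blast
      qed
      have LL': "L \<subseteq> L'" unfolding L'eq using span_superset[of "insert \<xi> L"] by auto
      have \<xi>L': "\<xi> \<in> L'" unfolding L'eq by (rule span_base) simp
      have "dim L \<noteq> dim L'" using finite_dim_eqI[OF Lp(1) LL' fL'] \<xi>L \<xi>L' by auto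
      then have bigger: "dim L < dim L'"
        using dim_mono_finite_dim[OF fL', of L] LL' span_superset[of L'] by (intro order_le_neq_trans) auto
      \<comment> \<open>\<open>y\<close> and the new vector are orthogonal for the form but not for
        the inner product; the factor 1/2 pays for estimating the squared norm of their sum by twice
        the sum of the squares.\<close>
      have "good L' (min k (- (\<sigma> * (A \<xi> \<bullet> \<xi>)) / (\<xi> \<bullet> \<xi>)) / 2)"
        unfolding good_def
      proof (intro conjI ballI)
        show "L' \<subseteq> D" using Lp(2) \<xi> by (auto simp: L'_def add_D scale_D)
        show "L' \<inter> X \<subseteq> {0}"
        proof
          fix y assume y: "y \<in> L' \<inter> X"
          then obtain l a where la: "l \<in> L" "y = l + a *\<^sub>R \<xi>" by (auto simp: L'_def)
          have "y \<in> D" using la Lp(2) \<xi> by (auto simp: add_D scale_D)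
          then have "A \<xi> \<bullet> (l + (- y)) = 0" using y X scale_D[of y "-1"]
            by (intro orth[OF la(1)]) (auto simp: subspace_neg)
          then have "a * (A \<xi> \<bullet> \<xi>) = 0" by (simp add: la(2))
          then have "a = 0" using neg by auto
          then show "y \<in> {0}" using y la Lp(4) by auto
        qed
        show k': "0 < min k (- (\<sigma> * (A \<xi> \<bullet> \<xi>)) / (\<xi> \<bullet> \<xi>)) / 2" using Lp(5) neg \<xi>0 by (simp add: divide_neg_pos)
        fix l' x assume l': "l' \<in> L'" and x: "x \<in> X \<inter> D"
        then obtain l a where la: "l \<in> L" "l' = l + a *\<^sub>R \<xi>" by (auto simp: L'_def)
        define y where "y = l + x"
        define j where "j = min k (- (\<sigma> * (A \<xi> \<bullet> \<xi>)) / (\<xi> \<bullet> \<xi>))"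
        have yD: "y \<in> D" using la Lp(2) x by (auto simp: y_def add_D)
        have A\<xi>y: "A \<xi> \<bullet> y = 0" unfolding y_def using la x by (intro orth) auto
        have "A (y + a *\<^sub>R \<xi>) \<bullet> (y + a *\<^sub>R \<xi>) = A y \<bullet> y + a\<^sup>2 * (A \<xi> \<bullet> \<xi>)"
        proof -
          have "A y \<bullet> \<xi> = 0" using A\<xi>y symmetric[OF yD \<xi>] by (simp add: inner_commute)
          then show ?thesis using A\<xi>y by (simp add: add scale yD \<xi> scale_D inner_add power2_eq_square)
        qed
        then have "\<sigma> * (A (y + a *\<^sub>R \<xi>) \<bullet> (y + a *\<^sub>R \<xi>)) = \<sigma> * (A y \<bullet> y) + a\<^sup>2 * (\<sigma> * (A \<xi> \<bullet> \<xi>))"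
          by (simp add: algebra_simps)
        also have "\<dots> \<le> - j * (y \<bullet> y) + a\<^sup>2 * (- j * (\<xi> \<bullet> \<xi>))"
        proof (rule add_mono)
          have "j * (y \<bullet> y) \<le> k * (y \<bullet> y)" by (intro mult_right_mono) (auto simp: j_def)
          then show "\<sigma> * (A y \<bullet> y) \<le> - j * (y \<bullet> y)" using Lp(6)[OF la(1), of x] x by (simp add: y_def)
          have "j * (\<xi> \<bullet> \<xi>) \<le> - (\<sigma> * (A \<xi> \<bullet> \<xi>)) / (\<xi> \<bullet> \<xi>) * (\<xi> \<bullet> \<xi>)" by (intro mult_right_mono) (auto simp: j_def)
          then show "a\<^sup>2 * (\<sigma> * (A \<xi> \<bullet> \<xi>)) \<le> a\<^sup>2 * (- j * (\<xi> \<bullet> \<xi>))" using \<xi>0 by (intro mult_left_mono) auto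
        qed
        also have "\<dots> = - (j / 2) * (2 * (y \<bullet> y) + 2 * (a\<^sup>2 * (\<xi> \<bullet> \<xi>)))" by (simp add: algebra_simps)
        also have "\<dots> \<le> - (j / 2) * ((y + a *\<^sub>R \<xi>) \<bullet> (y + a *\<^sub>R \<xi>))"
        proof -
          have "0 \<le> (y - a *\<^sub>R \<xi>) \<bullet> (y - a *\<^sub>R \<xi>)" by simp
          then have "(y + a *\<^sub>R \<xi>) \<bullet> (y + a *\<^sub>R \<xi>) \<le> 2 * (y \<bullet> y) + 2 * (a\<^sup>2 * (\<xi> \<bullet> \<xi>))"
            by (simp add: inner_add inner_diff inner_commute power2_eq_square algebra_simps)
          moreover have "0 \<le> j / 2" using k' by (simp add: j_def)
          ultimately show ?thesis using mult_left_mono by fastforce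
        qed
        also have "y + a *\<^sub>R \<xi> = l' + x" by (simp add: y_def la)
        finally show "\<sigma> * (A (l' + x) \<bullet> (l' + x))
            \<le> - (min k (- (\<sigma> * (A \<xi> \<bullet> \<xi>)) / (\<xi> \<bullet> \<xi>)) / 2) * ((l' + x) \<bullet> (l' + x))"
          by (simp add: j_def)
      qed (use sL' fL' in auto)
      then show False using max bigger by (meson not_le)
    qed
  qed
qed

end

text \<open>\<open>Pm\<close>, \<open>Pz\<close>, \<open>Pp\<close> below belong to \<open>A\<close>
  and \<open>c\<close> alone, \<open>V\<close> and \<open>W\<close> to \<open>A - B\<close>. The
  inequality \<open>\<beta> < c\<close> means that the perturbation cannot close the gap of
  \<open>A\<close> outside the finite-dimensional range of \<open>Pz\<close>.\<close>

locale perturbed_operator = self_adjoint_operator D A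
  for D :: "'a::{real_inner,complete_space} set" and A +
  fixes B :: "'a \<Rightarrow>\<^sub>L 'a" and \<beta> c :: real
  assumes B_self_adjoint: "bounded_self_adjoint B" and B_bound: "norm (B x) \<le> \<beta> * norm x"
    and \<beta>: "0 \<le> \<beta>" "\<beta> < c" and finite_rank: "finite_dim (range (P {- c..c}))"
begin

sublocale T: self_adjoint_operator D "\<lambda>x. A x - B x"
  using B_self_adjoint
  by unfold_locales (rule self_adjoint_diff[OF self_adjoint],
    auto simp: bounded_self_adjoint_def bounded_linear.linear blinfun.bounded_linear_right)

abbreviation "Pm \<equiv> P {..<- c}"
abbreviation "Pz \<equiv> P {- c..c}"
abbreviation "Pp \<equiv> P {c<..}"

lemma c_pos: "c > 0" using \<beta> by simp

lemma P_linear: "linear (P \<Omega>)"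
  by (simp add: bounded_linear.linear blinfun.bounded_linear_right)

lemma decomposition: "x = Pm x + Pz x + Pp x"
proof -
  have "{..<- c} \<union> {- c..c} \<union> {c<..} = UNIV" using c_pos by auto
  then have "x = P ({..<- c} \<union> {- c..c} \<union> {c<..}) x" by (simp add: P_UNIV)
  also have "\<dots> = P ({..<- c} \<union> {- c..c}) x + Pp x" by (rule P_Un) (use c_pos in auto)
  also have "P ({..<- c} \<union> {- c..c}) x = Pm x + Pz x" by (rule P_Un) auto
  finally show ?thesis .
qed

text \<open>\<open>A x - C x\<close> is tested against \<open>z - y\<close>, which reverses the
  negative component of \<open>x\<close>: both parts of the form of \<open>A\<close> then count
  positively, and the test vector has the norm of \<open>x\<close>.\<close>

lemma gap_lower_bound:
  assumes C: "\<And>x. norm (C x) \<le> \<gamma> * norm x" and x: "x \<in> D" "Pz x = 0"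
  shows "(c - \<gamma>) * norm x \<le> norm (A x - C x)"
proof -
  define y z where "y = Pm x" and "z = Pp x"
  have yz: "y \<in> D" "z \<in> D" "Pm y = y" "Pp z = z" using x by (simp_all add: y_def z_def P_D P_idem)
  have xyz: "x = y + z" using decomposition[of x] x(2) by (simp add: y_def z_def)
  have "{..<- c} \<inter> {c<..} = {}" using c_pos by auto
  then have yz0: "y \<bullet> z = 0"
    using P_inner[of "{..<- c}" y z] P_disjoint[of "{..<- c}" "{c<..}" x] yz by (simp add: z_def)
  have Ayz: "A z \<bullet> y = A y \<bullet> z" using symmetric[OF yz(2,1)] by (simp add: inner_commute)
  have "- c * (y \<bullet> y) \<ge> A y \<bullet> y" by (rule P_form_bounds(1)[OF _ yz(1,3)]) auto
  moreover have "c * (z \<bullet> z) \<le> A z \<bullet> z" by (rule P_form_bounds(2)[OF _ yz(2,4)]) auto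
  moreover have "A x \<bullet> (z - y) = A z \<bullet> z - A y \<bullet> y" using Ayz by (simp add: xyz add yz inner_add inner_diff)
  moreover have xx: "x \<bullet> x = y \<bullet> y + z \<bullet> z" "(z - y) \<bullet> (z - y) = x \<bullet> x"
    using yz0 by (simp_all add: xyz inner_add inner_diff inner_commute)
  ultimately have 1: "c * (x \<bullet> x) \<le> A x \<bullet> (z - y)" by (simp add: algebra_simps)
  have nzy: "norm (z - y) = norm x" using xx(2) by (simp add: norm_eq)
  have "C x \<bullet> (z - y) \<le> \<gamma> * norm x * norm x"
    using norm_cauchy_schwarz[of "C x" "z - y"] mult_right_mono[OF C[of x] norm_ge_zero[of x]] by (simp add: nzy)
  then have "(c - \<gamma>) * norm x * norm x \<le> (A x - C x) \<bullet> (z - y)"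
    using 1 by (simp add: inner_diff_left dot_square_norm power2_eq_square algebra_simps)
  also have "\<dots> \<le> norm (A x - C x) * norm x" using norm_cauchy_schwarz[of "A x - C x" "z - y"] by (simp add: nzy)
  finally show ?thesis by (cases "x = 0") (auto simp: mult_right_le_imp_le)
qed

text \<open>\<open>Pz\<close> is injective on this spectral subspace: on a vector killed by
  \<open>Pz\<close>, the operator \<open>A - B\<close> expands by at least
  \<open>c - \<beta> = 2 e\<close>, on the subspace by at most \<open>e\<close>.\<close>

lemma finite_rank_T:
  defines "e \<equiv> (c - \<beta>) / 2"
  shows "finite_dim (range (T.P {- e..e}))"
proof (rule dim_inj_le(1)[OF P_linear T.subspace_range_P _ _ finite_rank])
  show "x = 0" if x: "x \<in> range (T.P {- e..e})" "Pz x = 0" for x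
  proof -
    have Px: "T.P {- e..e} x = x" using x(1) T.range_P by auto
    have "x \<in> D" using x(1) T.P_bounded_D[of "{- e..e}" e] by auto
    moreover have "c - \<beta> = 2 * e" by (simp add: e_def)
    ultimately have "2 * e * norm x \<le> norm (A x - B x)" using gap_lower_bound[OF B_bound _ x(2)] by simp
    also have "\<dots> \<le> e * norm x" using T.P_norm_bound[of "{- e..e}" 0 e x] Px by simp
    finally have "e * norm x \<le> 0" by simp
    moreover have "e > 0" using \<beta> by (simp add: e_def)
    ultimately show ?thesis by (simp add: mult_le_0_iff)
  qed
qed auto

abbreviation "V \<equiv> T.P {..<0}"
abbreviation "W \<equiv> T.P {0..}"

lemma VW: "x = V x + W x"
  using T.P_Compl[of "{..<0}" x] by (simp add: Compl_lessThan)

lemma form_B: "\<bar>A x \<bullet> w - x \<bullet> (A w - B w)\<bar> \<le> \<beta> * norm x * norm w" if "x \<in> D" "w \<in> D"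
proof -
  have "A x \<bullet> w - x \<bullet> (A w - B w) = x \<bullet> B w" using symmetric[OF that] by (simp add: inner_diff_right)
  moreover have "\<bar>x \<bullet> B w\<bar> \<le> norm x * (\<beta> * norm w)"
    using Cauchy_Schwarz_ineq2[of x "B w"] mult_left_mono[OF B_bound[of w] norm_ge_zero[of x]] by linarith
  ultimately show ?thesis by (simp add: algebra_simps)
qed

text \<open>Cutting the spectral sets at \<open>n\<close> makes both operators bounded there, so
  that the bounded estimate applies with shifts \<open>n\<close>; its constant does not depend on
  \<open>n\<close>. The sign \<open>1\<close> pairs the negative part of \<open>A\<close> with the
  nonnegative part of \<open>A - B\<close>, the sign \<open>-1\<close> the opposite parts.\<close>

lemma davis_kahan:
  assumes \<sigma>: "\<sigma> = 1 \<or> \<sigma> = -1" and m: "S \<in> sets borel" "S' \<in> sets borel"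
    and S: "\<And>u. u \<in> S \<Longrightarrow> \<sigma> * u \<le> - c" and S': "\<And>u. u \<in> S' \<Longrightarrow> 0 \<le> \<sigma> * u"
  shows "\<bar>P S x \<bullet> T.P S' w\<bar> \<le> \<beta> / c * norm (P S x) * norm (T.P S' w)"
proof -
  define X where "X n = S \<inter> {- real n..real n}" for n
  define Y where "Y n = S' \<inter> {- real n..real n}" for n
  have mX: "X n \<in> sets borel" and mY: "Y n \<in> sets borel" for n using m by (auto simp: X_def Y_def)
  have XD: "x \<in> D" if "P (X n) x = x" for x n
    using P_bounded_D[OF mX, of n "real n" x] that by (simp add: X_def)
  have YD: "x \<in> D" if "T.P (Y n) x = x" for x n
    using T.P_bounded_D[OF mY, of n "real n" x] that by (simp add: Y_def)
  have unit: "norm (\<sigma> *\<^sub>R v) = norm v" for v :: 'a using \<sigma> by auto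
  have bound: "\<bar>P (X n) x \<bullet> T.P (Y n) w\<bar> \<le> \<beta> / c * norm (P (X n) x) * norm (T.P (Y n) w)" if n: "c \<le> real n" for n
  proof (rule davis_kahan_bounded[where n = "real n" and m = "real n" and A = "\<lambda>x. \<sigma> *\<^sub>R A x"
        and T = "\<lambda>x. \<sigma> *\<^sub>R (A x - B x)" and X = "{x. P (X n) x = x}" and W = "{x. T.P (Y n) x = x}"])
    show "\<sigma> *\<^sub>R A x + real n *\<^sub>R x \<in> {x. P (X n) x = x} \<and> norm (\<sigma> *\<^sub>R A x + real n *\<^sub>R x) \<le> (real n - c) * norm x"
      if "x \<in> {x. P (X n) x = x}" for x
    proof
      have x: "P (X n) x = x" using that by simp
      show "\<sigma> *\<^sub>R A x + real n *\<^sub>R x \<in> {x. P (X n) x = x}"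
        using P_A[OF mX XD[OF x], of n] x by (simp add: blinfun.add_right blinfun.scaleR_right)
      \<comment> \<open>The truncated set lies within distance \<open>n - c\<close> of
        \<open>- \<sigma> n\<close>, which is the sharp norm bound for the shifted operator.\<close>
      have "X n \<subseteq> {- (\<sigma> * real n) - (real n - c)..- (\<sigma> * real n) + (real n - c)}"
        using \<sigma> n by (auto simp: X_def dest!: S)
      from P_norm_bound[OF mX this x]
      have "norm (\<sigma> *\<^sub>R (A x - (- (\<sigma> * real n)) *\<^sub>R x)) \<le> (real n - c) * norm x" by (simp only: unit)
      moreover have "\<sigma> *\<^sub>R (A x - (- (\<sigma> * real n)) *\<^sub>R x) = \<sigma> *\<^sub>R A x + real n *\<^sub>R x" using \<sigma> by auto
      ultimately show "norm (\<sigma> *\<^sub>R A x + real n *\<^sub>R x) \<le> (real n - c) * norm x" by (simp only:)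
    qed
    show "\<sigma> *\<^sub>R (A w - B w) - real n *\<^sub>R w \<in> {x. T.P (Y n) x = x} \<and>
        norm (\<sigma> *\<^sub>R (A w - B w) - real n *\<^sub>R w) \<le> real n * norm w"
      if "w \<in> {x. T.P (Y n) x = x}" for w
    proof
      have w: "T.P (Y n) w = w" using that by simp
      then have "T.P (Y n) (A w - B w) = A w - B w" using T.P_A[OF mY YD[OF w], of n] by simp
      then show "\<sigma> *\<^sub>R (A w - B w) - real n *\<^sub>R w \<in> {x. T.P (Y n) x = x}"
        using w by (simp only: blinfun.diff_right[of _ "\<sigma> *\<^sub>R (A w - B w)"] blinfun.scaleR_right mem_Collect_eq)
      have "Y n \<subseteq> {\<sigma> * real n - real n..\<sigma> * real n + real n}"
        using \<sigma> by (auto simp: Y_def dest!: S')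
      from T.P_norm_bound[OF mY this w]
      have "norm (\<sigma> *\<^sub>R (A w - B w - (\<sigma> * real n) *\<^sub>R w)) \<le> real n * norm w" by (simp only: unit)
      moreover have "\<sigma> *\<^sub>R (A w - B w - (\<sigma> * real n) *\<^sub>R w) = \<sigma> *\<^sub>R (A w - B w) - real n *\<^sub>R w" using \<sigma> by auto
      ultimately show "norm (\<sigma> *\<^sub>R (A w - B w) - real n *\<^sub>R w) \<le> real n * norm w" by (simp only:)
    qed
    show "\<bar>(\<sigma> *\<^sub>R A x) \<bullet> w - x \<bullet> (\<sigma> *\<^sub>R (A w - B w))\<bar> \<le> \<beta> * norm x * norm w"
      if "x \<in> {x. P (X n) x = x}" "w \<in> {x. T.P (Y n) x = x}" for x w
    proof -
      have "(\<sigma> *\<^sub>R A x) \<bullet> w - x \<bullet> (\<sigma> *\<^sub>R (A w - B w)) = \<sigma> * (A x \<bullet> w - x \<bullet> (A w - B w))"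
        by (simp add: right_diff_distrib)
      moreover have "\<bar>\<sigma> * v\<bar> = \<bar>v\<bar>" for v using \<sigma> by auto
      ultimately show ?thesis using form_B[of x w] XD YD that by (simp only: mem_Collect_eq)
    qed
  qed (use n \<beta> c_pos mX mY in \<open>auto simp: P_idem T.P_idem\<close>)
  have lim: "(\<lambda>n. P (X n) x) \<longlonglongrightarrow> P S x" "(\<lambda>n. T.P (Y n) w) \<longlonglongrightarrow> T.P S' w"
    unfolding X_def Y_def by (rule P_truncation[OF m(1)], rule T.P_truncation[OF m(2)])
  show ?thesis
  proof (rule LIMSEQ_le)
    show "(\<lambda>n. \<bar>P (X n) x \<bullet> T.P (Y n) w\<bar>) \<longlonglongrightarrow> \<bar>P S x \<bullet> T.P S' w\<bar>" by (intro tendsto_intros lim)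
    show "(\<lambda>n. \<beta> / c * norm (P (X n) x) * norm (T.P (Y n) w)) \<longlonglongrightarrow> \<beta> / c * norm (P S x) * norm (T.P S' w)"
      by (intro tendsto_intros lim) (use c_pos in auto)
    obtain N where N: "c < real N" using reals_Archimedean2 by blast
    show "\<exists>N. \<forall>n\<ge>N. \<bar>P (X n) x \<bullet> T.P (Y n) w\<bar> \<le> \<beta> / c * norm (P (X n) x) * norm (T.P (Y n) w)"
      using bound N by (intro exI[of _ N]) auto
  qed
qed

lemma davis_kahan_negative: "\<bar>Pm x \<bullet> W w\<bar> \<le> \<beta> / c * norm (Pm x) * norm (W w)"
  by (rule davis_kahan[of 1]) auto

lemma davis_kahan_positive: "\<bar>Pp x \<bullet> V w\<bar> \<le> \<beta> / c * norm (Pp x) * norm (V w)"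
  by (rule davis_kahan[of "-1"]) auto

lemma \<theta>: "0 \<le> \<beta> / c" "\<beta> / c < 1" using \<beta> by auto

text \<open>A fixed point \<open>x = h + Pm (W x)\<close> exists because \<open>Pm\<close> after
  \<open>W\<close> has norm at most \<open>\<beta> / c < 1\<close>. It satisfies
  \<open>Pm x = x\<close>, so its component \<open>V x\<close> is mapped to
  \<open>x - Pm (W x) = h\<close>.\<close>

lemma P_minus_surjective:
  assumes h: "Pm h = h" obtains v where "V v = v" "Pm v = h"
proof -
  define f where "f x = h + Pm (W x)" for x
  have "dist (f x) (f y) \<le> \<beta> / c * dist x y" for x y
  proof -
    let ?w = "W (x - y)"
    have "(norm (Pm ?w))\<^sup>2 \<le> \<beta> / c * norm (Pm ?w) * norm ?w"
      using davis_kahan_negative[of ?w "x - y"] P_form[of "{..<- c}" ?w] by simp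
    then have "norm (Pm ?w) * norm (Pm ?w) \<le> (\<beta> / c * norm ?w) * norm (Pm ?w)"
      by (simp add: power2_eq_square algebra_simps)
    then have "norm (Pm ?w) \<le> \<beta> / c * norm ?w"
      using \<theta> by (cases "Pm ?w = 0") (auto simp del: times_divide_eq_left)
    also have "\<dots> \<le> \<beta> / c * norm (x - y)" using \<theta> T.norm_P by (intro mult_left_mono) auto
    finally show ?thesis by (simp add: f_def dist_norm blinfun.diff_right)
  qed
  then obtain x where x: "f x = x" using banach_fix_type[of "\<beta> / c" f] \<theta> by blast
  have "Pm (f x) = f x" using h by (simp add: f_def blinfun.add_right P_idem)
  then have Px: "Pm x = x" using x by simp
  have "V x = x - W x" using VW[of x] by (simp add: algebra_simps)
  moreover have "Pm (W x) = x - h" using x by (simp add: f_def eq_diff_eq add.commute)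
  ultimately have "Pm (V x) = h" using Px by (simp add: blinfun.diff_right)
  then show thesis using that T.P_idem[of "{..<0}" x] by simp
qed

text \<open>Zero is at most an isolated point of the spectrum of \<open>A - B\<close>: shrinking
  punctured intervals have empty intersection and, by \<open>finite_rank_T\<close>, finite
  rank.\<close>

lemma zero_gap:
  obtains \<delta> where "\<delta> > 0" "T.null ({- \<delta>..\<delta>} - {0})"
proof -
  define e where "e = (c - \<beta>) / 2"
  have e: "e > 0" using \<beta> by (simp add: e_def)
  define \<Omega> where "\<Omega> n = {- (e / real (Suc n))..e / real (Suc n)} - {0}" for n
  have m: "range \<Omega> \<subseteq> sets borel" by (auto simp: \<Omega>_def)
  have f: "finite_dim (range (T.P (\<Omega> 0)))"
    by (rule T.finite_rank_subset[of "{- e..e}"]) (use finite_rank_T in \<open>auto simp: \<Omega>_def e_def\<close>)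
  have step: "e / real (Suc n) \<le> e / real (Suc m)" if "m \<le> n" for m n
    using that e by (intro divide_left_mono) auto
  have dec: "decseq \<Omega>"
    unfolding decseq_def
  proof (intro allI impI subsetI)
    fix m n u assume "m \<le> n" "u \<in> \<Omega> n"
    then show "u \<in> \<Omega> m" using step[of m n] unfolding \<Omega>_def Diff_iff atLeastAtMost_iff by linarith
  qed
  have "\<exists>n. u \<notin> \<Omega> n" for u
  proof (cases "u = 0")
    case False
    obtain n where "e / \<bar>u\<bar> < real n" using reals_Archimedean2 by blast
    then have "e < real n * \<bar>u\<bar>" using pos_divide_less_eq[of "\<bar>u\<bar>" e "real n"] False by simp
    then have "e < real (Suc n) * \<bar>u\<bar>" using False by (simp add: algebra_simps)
    then have "e / real (Suc n) < \<bar>u\<bar>" by (simp add: field_simps)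
    then have "u \<notin> \<Omega> n" unfolding \<Omega>_def Diff_iff atLeastAtMost_iff by linarith
    then show ?thesis ..
  qed (simp add: \<Omega>_def)
  then have "(\<Inter>n. \<Omega> n) = {}" by blast
  then obtain n where "\<And>x. T.P (\<Omega> n) x = 0" using T.gap[OF m dec _ f] by blast
  then have "T.null ({- (e / real (Suc n))..e / real (Suc n)} - {0})" by (auto simp: T.null_def \<Omega>_def)
  then show thesis using that[of "e / real (Suc n)"] e by simp
qed

lemma V_gap:
  obtains \<delta> where "\<delta> > 0" "\<And>x. V x = x \<Longrightarrow> T.P {..<- \<delta>} x = x"
proof -
  obtain \<delta> where \<delta>: "\<delta> > 0" "T.null ({- \<delta>..\<delta>} - {0})" by (rule zero_gap)
  have null: "T.null {- \<delta>..<0}" by (rule T.null_subset[OF \<delta>(2)]) (use \<delta>(1) in auto)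
  have "T.P {..<- \<delta>} x = x" if "V x = x" for x
  proof -
    have U: "{..<- \<delta>} \<union> {- \<delta>..<0} = {..<0}" using \<delta>(1) by auto
    have "T.P ({..<- \<delta>} \<union> {- \<delta>..<0}) x = T.P {..<- \<delta>} x + T.P {- \<delta>..<0} x"
      by (rule T.P_Un) auto
    then show ?thesis unfolding U using null that by (simp add: T.null_def)
  qed
  then show thesis using that \<delta>(1) by blast
qed

text \<open>\<open>W\<close> belongs to the closed half-line and contains the kernel of
  \<open>A - B\<close>; once this is trivial, the gap makes \<open>A - B\<close> uniformly positive
  there.\<close>

lemma W_gap:
  assumes ker: "\<And>x. x \<in> D \<Longrightarrow> A x - B x = 0 \<Longrightarrow> x = 0"
  obtains \<delta> where "\<delta> > 0" "\<And>x. W x = x \<Longrightarrow> T.P {\<delta><..} x = x"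
proof -
  obtain \<delta> where \<delta>: "\<delta> > 0" "T.null ({- \<delta>..\<delta>} - {0})" by (rule zero_gap)
  have null: "T.null {0<..\<delta>}" by (rule T.null_subset[OF \<delta>(2)]) (use \<delta>(1) in auto)
  have P0: "T.P {0} x = 0" for x
  proof (rule ker)
    show "T.P {0} x \<in> D" by (rule T.P_bounded_D[of _ 0]) auto
    have "norm (A (T.P {0} x) - B (T.P {0} x) - 0 *\<^sub>R T.P {0} x) \<le> 0 * norm (T.P {0} x)"
      by (rule T.P_norm_bound[of "{0}"]) (auto simp: T.P_idem)
    then show "A (T.P {0} x) - B (T.P {0} x) = 0" by simp
  qed
  have "T.P {\<delta><..} x = x" if "W x = x" for x
  proof -
    have U: "{0<..\<delta>} \<union> {\<delta><..} = {0<..}" "{0} \<union> {0<..} = {0::real..}" using \<delta>(1) by auto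
    have "T.P ({0<..\<delta>} \<union> {\<delta><..}) x = T.P {0<..\<delta>} x + T.P {\<delta><..} x" by (rule T.P_Un) auto
    then have "T.P {0<..} x = T.P {\<delta><..} x" unfolding U using null by (simp add: T.null_def)
    moreover have "T.P ({0} \<union> {0<..}) x = T.P {0} x + T.P {0<..} x" by (rule T.P_Un) auto
    then have "W x = T.P {0<..} x" unfolding U by (simp add: P0)
    ultimately show ?thesis using that by simp
  qed
  then show thesis using that \<delta>(1) by blast
qed

lemma reducing_surjective:
  assumes m: "\<Omega> \<in> sets borel" and \<delta>: "\<delta> > 0" "\<sigma> = 1 \<or> \<sigma> = -1"
    and form: "\<And>x. x \<in> D \<Longrightarrow> T.P \<Omega> x = x \<Longrightarrow> \<sigma> * ((A x - B x) \<bullet> x) \<le> - \<delta> * (x \<bullet> x)" and v: "T.P \<Omega> v = v"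
  obtains \<xi> where "\<xi> \<in> D" "T.P \<Omega> \<xi> = \<xi>" "A \<xi> - B \<xi> = v"
proof (rule T.surjective_on_reducing[OF T.P_projection[OF m] _ _ \<delta>(1) _ v])
  show "\<delta> * norm x \<le> norm (A x - B x)" if x: "x \<in> D" "T.P \<Omega> x = x" for x
  proof -
    have "\<delta> * (x \<bullet> x) \<le> - (\<sigma> * ((A x - B x) \<bullet> x))" using form[OF x] by simp
    also have "\<dots> \<le> \<bar>(A x - B x) \<bullet> x\<bar>" using \<delta>(2) by auto
    also have "\<dots> \<le> norm (A x - B x) * norm x" by (rule Cauchy_Schwarz_ineq2)
    finally have "\<delta> * norm x * norm x \<le> norm (A x - B x) * norm x" by (simp add: dot_square_norm power2_eq_square)
    then show ?thesis by (cases "x = 0") (auto simp: mult_right_le_imp_le)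
  qed
qed (use m T.P_D T.P_A that in auto)

end

section \<open>The relative Morse index and invertibility\<close>

lemma inner_self_le_0_iff: "x \<bullet> x \<le> 0 \<longleftrightarrow> x = 0" for x :: "'a::real_inner"
  using inner_ge_zero[of x] inner_eq_zero_iff[of x] by linarith

context perturbed_operator
begin

lemma form_B_le: "\<bar>B x \<bullet> x\<bar> \<le> \<beta> * (x \<bullet> x)"
  using Cauchy_Schwarz_ineq2[of "B x" x] mult_right_mono[OF B_bound[of x] norm_ge_zero[of x]]
  by (simp add: dot_square_norm power2_eq_square)

text \<open>The reduction \<open>fredholm_index_eq\<close> with \<open>Q = Pm\<close>: by
  \<open>P_minus_surjective\<close> both negative spaces have the same image under
  \<open>Pm\<close>. The subtracted dimension depends on \<open>A\<close> and \<open>c\<close> only,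
  so comparing indices means comparing the first dimensions.\<close>

lemma relative_index:
  assumes f: "finite_dim {v \<in> range V. Pm v = 0}"
  shows "relative_morse_index D A B =
    int (dim {v \<in> range V. Pm v = 0}) - int (dim {y \<in> range (P {..<0}). Pm y = 0})"
  unfolding relative_morse_index_def negative_space_def
proof (rule fredholm_index_eq[OF T.subspace_range_P subspace_range_P P_linear P_linear _ _ _ f])
  have "{..<- c} \<inter> {..<0} = {..<- c}" using c_pos by auto
  then show "Pm (P {..<0} v) = Pm v" for v using P_Int[of "{..<- c}" "{..<0}" v] by simp
  show "Pm ` range (P {..<0}) \<subseteq> Pm ` range V"
  proof (rule image_subsetI)
    fix y
    have "Pm (Pm y) = Pm y" by (rule P_idem) simp
    then obtain v where "V v = v" "Pm v = Pm y" by (rule P_minus_surjective)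
    then show "Pm y \<in> Pm ` range V" by (metis rangeI imageI)
  qed
  show "finite_dim {y \<in> range (P {..<0}). Pm y = 0}"
  proof (rule finite_dim_subset[OF finite_rank], rule subsetI)
    fix y assume "y \<in> {y \<in> range (P {..<0}). Pm y = 0}"
    then have y: "P {..<0} y = y" "Pm y = 0" by (auto simp: range_P)
    have "{c<..} \<inter> {..<0} = {}" using c_pos by auto
    then have "Pp (P {..<0} y) = 0" by (intro P_disjoint) auto
    then have "y = Pz y" using decomposition[of y] y by simp
    then show "y \<in> range Pz" by (rule range_eqI)
  qed
qed auto

text \<open>The dimension bound comes from \<open>Pz\<close>: a vector of an admissible
  \<open>L\<close> killed by \<open>Pz\<close> lies, modulo the range of \<open>P X\<close>, in the
  range of \<open>P Y\<close>, where the form has the opposite sign.\<close>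

lemma maximal_exists:
  assumes \<sigma>: "\<sigma> = 1 \<and> X = {..<- c} \<and> Y = {c<..} \<or> \<sigma> = -1 \<and> X = {c<..} \<and> Y = {..<- c}"
  obtains L k where "subspace L" "L \<subseteq> D" "finite_dim L" "L \<inter> range (P X) \<subseteq> {0}" "k > 0"
    "\<And>l x. l \<in> L \<Longrightarrow> x \<in> range (P X) \<Longrightarrow> x \<in> D \<Longrightarrow>
       \<sigma> * ((A (l + x) - B (l + x)) \<bullet> (l + x)) \<le> - k * ((l + x) \<bullet> (l + x))"
    "\<And>\<xi>. \<xi> \<in> D \<Longrightarrow> (\<And>l x. l \<in> L \<Longrightarrow> x \<in> range (P X) \<Longrightarrow> x \<in> D \<Longrightarrow> (A \<xi> - B \<xi>) \<bullet> (l + x) = 0)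
       \<Longrightarrow> 0 \<le> \<sigma> * ((A \<xi> - B \<xi>) \<bullet> \<xi>)"
proof -
  have mX: "X \<in> sets borel" and mY: "Y \<in> sets borel" using \<sigma> by auto
  have dec: "x = P X x + P Y x" if "Pz x = 0" for x using decomposition[of x] that \<sigma> by (auto simp: add.commute)
  have B: "\<bar>\<sigma> * (B x \<bullet> x)\<bar> \<le> \<beta> * (x \<bullet> x)" for x using form_B_le[of x] \<sigma> by auto
  have formX: "\<sigma> * ((A x - B x) \<bullet> x) \<le> - (c - \<beta>) * (x \<bullet> x)" if x: "x \<in> D" "P X x = x" for x
  proof -
    have "\<sigma> * (A x \<bullet> x) \<le> - c * (x \<bullet> x)"
      using P_form_bounds(1)[OF mX x, of "- c"] P_form_bounds(2)[OF mX x, of c] \<sigma> by auto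
    then show ?thesis using B[of x] by (simp add: inner_diff_left abs_le_iff algebra_simps)
  qed
  have formY: "(c - \<beta>) * (x \<bullet> x) \<le> \<sigma> * ((A x - B x) \<bullet> x)" if x: "x \<in> D" "P Y x = x" for x
  proof -
    have "c * (x \<bullet> x) \<le> \<sigma> * (A x \<bullet> x)"
      using P_form_bounds(1)[OF mY x, of "- c"] P_form_bounds(2)[OF mY x, of c] \<sigma> by auto
    then show ?thesis using B[of x] by (simp add: inner_diff_left abs_le_iff algebra_simps)
  qed
  show thesis
  proof (rule T.maximal_definite_exists[OF subspace_range_P, of "c - \<beta>" X \<sigma> "dim (range Pz)"])
    show "c - \<beta> > 0" using \<beta> by simp
    show "\<sigma> * ((A x - B x) \<bullet> x) \<le> - (c - \<beta>) * (x \<bullet> x)" if "x \<in> range (P X)" "x \<in> D" for x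
      using formX[OF that(2)] that(1) by (simp add: range_P[OF mX])
    fix L k assume L: "subspace L" "L \<subseteq> D" "L \<inter> range (P X) \<subseteq> {0}" "k > (0::real)"
      and neg: "\<And>l x. l \<in> L \<Longrightarrow> x \<in> range (P X) \<Longrightarrow> x \<in> D \<Longrightarrow>
        \<sigma> * ((A (l + x) - B (l + x)) \<bullet> (l + x)) \<le> - k * ((l + x) \<bullet> (l + x))"
    show "dim L \<le> dim (range Pz)"
    proof (rule dim_inj_le(2)[OF P_linear[of "{- c..c}"] L(1) _ _ finite_rank])
      fix l assume l: "l \<in> L" "Pz l = 0"
      define z where "z = P Y l"
      have lD: "l \<in> D" using l L by blast
      have z: "z \<in> D" "P Y z = z" using lD mY by (simp_all add: z_def P_D P_idem)
      have lz: "l + (- P X l) = z" using dec[OF l(2)] by (simp add: z_def algebra_simps)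
      have "- P X l \<in> range (P X)" by (rule range_eqI[of _ _ "- l"]) (simp add: blinfun.minus_right)
      moreover have "- P X l \<in> D" using scale_D[OF P_D[OF mX lD], of "-1"] by simp
      ultimately have "\<sigma> * ((A z - B z) \<bullet> z) \<le> - k * (z \<bullet> z)" using neg[OF l(1)] unfolding lz[symmetric] by blast
      then have "(c - \<beta>) * (z \<bullet> z) + k * (z \<bullet> z) \<le> 0" using formY[OF z] by simp
      then have "(c - \<beta> + k) * (z \<bullet> z) \<le> 0" by (simp add: algebra_simps)
      moreover have "c - \<beta> + k > 0" using \<beta> L(4) by simp
      ultimately have "z = 0" by (simp add: mult_le_0_iff inner_self_le_0_iff)
      then have "l = P X l" using lz by (simp add: add_eq_0_iff2)
      then have "l \<in> L \<inter> range (P X)" using l by (auto intro: range_eqI)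
      then show "l = 0" using L(3) by blast
    qed auto
  qed (use that in blast)
qed

text \<open>
  A vector \<open>v = (A - B) \<xi>\<close> of a definite reducing subspace that is orthogonal to \<open>L + range (P X)\<close>
  has \<open>\<xi>\<close> in the form-orthogonal complement, where the form has the opposite sign; so \<open>\<xi> = 0\<close>.
\<close>
lemma kernel_bound:
  assumes \<sigma>: "\<sigma> = 1 \<or> \<sigma> = -1" and m: "\<Omega> \<in> sets borel" "X \<in> sets borel" and L: "subspace L" "finite_dim L"
    and orth: "\<And>\<xi>. \<xi> \<in> D \<Longrightarrow> (\<And>l x. l \<in> L \<Longrightarrow> x \<in> range (P X) \<Longrightarrow> x \<in> D \<Longrightarrow> (A \<xi> - B \<xi>) \<bullet> (l + x) = 0)
       \<Longrightarrow> 0 \<le> \<sigma> * ((A \<xi> - B \<xi>) \<bullet> \<xi>)"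
    and \<delta>: "\<delta> > 0" "\<And>x. x \<in> D \<Longrightarrow> T.P \<Omega> x = x \<Longrightarrow> \<sigma> * ((A x - B x) \<bullet> x) \<le> - \<delta> * (x \<bullet> x)"
  shows "finite_dim {v \<in> range (T.P \<Omega>). P X v = 0}" "dim {v \<in> range (T.P \<Omega>). P X v = 0} \<le> dim L"
proof -
  note pL = L(1) finite_dim_complete[OF L]
  have s: "subspace {v \<in> range (T.P \<Omega>). P X v = 0}"
    using T.subspace_range_P[of \<Omega>] by (auto simp: subspace_def blinfun.zero_right blinfun.add_right blinfun.scaleR_right)
  have inj: "v = 0" if v: "v \<in> {v \<in> range (T.P \<Omega>). P X v = 0}" "proj L v = 0" for v
  proof -
    have Pv: "T.P \<Omega> v = v" "P X v = 0" using v by (auto simp: T.range_P[OF m(1)])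
    obtain \<xi> where \<xi>: "\<xi> \<in> D" "T.P \<Omega> \<xi> = \<xi>" "A \<xi> - B \<xi> = v"
      using reducing_surjective[OF m(1) \<delta>(1) \<sigma> \<delta>(2) Pv(1)] by blast
    have "0 \<le> \<sigma> * ((A \<xi> - B \<xi>) \<bullet> \<xi>)"
    proof (rule orth[OF \<xi>(1)])
      fix l x assume l: "l \<in> L" and x: "x \<in> range (P X)" "x \<in> D"
      have "v \<bullet> l = 0" using v(2) l proj_eq_0_iff[OF pL] by blast
      moreover have "v \<bullet> x = 0" using x(1) P_inner[OF m(2), of v x] Pv(2) by (simp add: range_P[OF m(2)])
      ultimately show "(A \<xi> - B \<xi>) \<bullet> (l + x) = 0" by (simp add: \<xi>(3) inner_add_right)
    qed
    then have "\<delta> * (\<xi> \<bullet> \<xi>) \<le> 0" using \<delta>(2)[OF \<xi>(1,2)] by simp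
    then have "\<xi> = 0" using \<delta>(1) by (simp add: mult_le_0_iff inner_self_le_0_iff)
    then show ?thesis using \<xi>(3) by (simp add: blinfun.zero_right)
  qed
  show "finite_dim {v \<in> range (T.P \<Omega>). P X v = 0}" "dim {v \<in> range (T.P \<Omega>). P X v = 0} \<le> dim L"
    using dim_inj_le[OF linear_proj[OF pL] s inj _ L(2)] proj_mem[OF pL] by blast+
qed

text \<open>The open half-line excludes the kernel of \<open>A - B\<close>, so \<open>V_gap\<close>
  alone gives the uniform negativity required by \<open>kernel_bound\<close>; the estimate covers a
  \<open>B\<close> for which \<open>A - B\<close> has a kernel.\<close>

lemma negative_index:
  obtains L k where "subspace L" "L \<subseteq> D" "finite_dim L" "L \<inter> range Pm \<subseteq> {0}" "k > 0"
    "\<And>l x. l \<in> L \<Longrightarrow> x \<in> range Pm \<Longrightarrow> x \<in> D \<Longrightarrow>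
       (A (l + x) - B (l + x)) \<bullet> (l + x) \<le> - k * ((l + x) \<bullet> (l + x))"
    "finite_dim {v \<in> range V. Pm v = 0}" "dim {v \<in> range V. Pm v = 0} \<le> dim L"
proof (rule maximal_exists[of 1 "{..<- c}" "{c<..}"])
  fix L k
  assume L: "subspace L" "L \<subseteq> D" "finite_dim L" "L \<inter> range Pm \<subseteq> {0}" "(k::real) > 0"
    "\<And>l x. l \<in> L \<Longrightarrow> x \<in> range Pm \<Longrightarrow> x \<in> D \<Longrightarrow>
       1 * ((A (l + x) - B (l + x)) \<bullet> (l + x)) \<le> - k * ((l + x) \<bullet> (l + x))"
    and orth: "\<And>\<xi>. \<xi> \<in> D \<Longrightarrow> (\<And>l x. l \<in> L \<Longrightarrow> x \<in> range Pm \<Longrightarrow> x \<in> D \<Longrightarrow> (A \<xi> - B \<xi>) \<bullet> (l + x) = 0)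
       \<Longrightarrow> 0 \<le> 1 * ((A \<xi> - B \<xi>) \<bullet> \<xi>)"
  obtain \<delta> where \<delta>: "\<delta> > 0" "\<And>x. V x = x \<Longrightarrow> T.P {..<- \<delta>} x = x" using V_gap by blast
  have form: "1 * ((A x - B x) \<bullet> x) \<le> - \<delta> * (x \<bullet> x)" if x: "x \<in> D" "V x = x" for x
    using T.P_form_bounds(1)[OF _ x(1) \<delta>(2)[OF x(2)], of "- \<delta>"] by simp
  have b: "finite_dim {v \<in> range V. Pm v = 0}" "dim {v \<in> range V. Pm v = 0} \<le> dim L"
    by (rule kernel_bound[where \<sigma> = 1 and \<Omega> = "{..<0}" and X = "{..<- c}" and L = L and \<delta> = \<delta>];
        (fact orth | fact form | simp add: L(1,3) \<delta>(1)))+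
  show thesis using that[OF L(1-5) _ b] L(6) by simp
qed simp

text \<open>The ranges of \<open>V\<close> and \<open>Pp\<close> enclose an angle bounded away from
  0 by \<open>davis_kahan_positive\<close>, so their sum is closed. Its orthogonal complement
  consists of the \<open>w\<close> with \<open>W w = w\<close> and \<open>Pp w = 0\<close>.\<close>

lemma V_plus_complete:
  assumes orth: "\<And>w. W w = w \<Longrightarrow> Pp w = 0 \<Longrightarrow> x \<bullet> w = 0"
  obtains v p where "V v = v" "Pp p = p" "x = v + p"
proof -
  define Z where "Z = {v + p | v p. v \<in> range V \<and> p \<in> range Pp}"
  have sZ: "subspace Z" unfolding Z_def by (rule subspace_sums[OF T.subspace_range_P subspace_range_P])
  define \<eta> where "\<eta> = 1 - \<beta> / c"
  have \<eta>: "\<eta> > 0" using \<theta> by (simp add: \<eta>_def)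
  \<comment> \<open>The mixed term is at most the fraction \<open>\<beta> / c\<close> of the sum of
    squares, which leaves \<open>\<eta> = 1 - \<beta> / c\<close>. Thus both components of a Cauchy
    sequence in the sum are Cauchy.\<close>
  have lower: "\<eta> * ((norm v)\<^sup>2 + (norm p)\<^sup>2) \<le> (norm (v + p))\<^sup>2" if "V v = v" "Pp p = p" for v p
  proof -
    have "\<bar>p \<bullet> v\<bar> \<le> \<beta> / c * (norm p * norm v)" using davis_kahan_positive[of p v] that by simp
    moreover have "2 * (norm p * norm v) \<le> (norm v)\<^sup>2 + (norm p)\<^sup>2"
      using zero_le_power2[of "norm p - norm v"] by (simp add: power2_eq_square algebra_simps)
    then have "\<beta> / c * (2 * (norm p * norm v)) \<le> \<beta> / c * ((norm v)\<^sup>2 + (norm p)\<^sup>2)" using \<theta>(1) by (rule mult_left_mono)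
    then have "2 * (\<beta> / c * (norm p * norm v)) \<le> \<beta> / c * ((norm v)\<^sup>2 + (norm p)\<^sup>2)"
      by (simp only: mult.left_commute[of 2 "\<beta> / c"])
    ultimately have "- (\<beta> / c * ((norm v)\<^sup>2 + (norm p)\<^sup>2)) \<le> 2 * (p \<bullet> v)" by (simp only: abs_le_iff) argo
    moreover have "(norm (v + p))\<^sup>2 = (norm v)\<^sup>2 + (norm p)\<^sup>2 + 2 * (p \<bullet> v)"
      unfolding power2_norm_eq_inner by (simp add: inner_add inner_commute)
    ultimately show ?thesis by (simp add: \<eta>_def algebra_simps)
  qed
  have cZ: "complete Z"
    unfolding complete_def
  proof (intro allI impI, elim conjE)
    fix s assume s: "\<forall>n. s n \<in> Z" "Cauchy s"
    then have "\<forall>n. \<exists>v p. V v = v \<and> Pp p = p \<and> s n = v + p"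
      unfolding Z_def by (simp add: range_P T.range_P) blast
    then obtain v p where vp: "\<And>n. V (v n) = v n" "\<And>n. Pp (p n) = p n" "\<And>n. s n = v n + p n" by metis
    have *: "\<exists>M. \<forall>m\<ge>M. \<forall>n\<ge>M. norm (v m - v n) < e \<and> norm (p m - p n) < e" if e: "e > 0" for e
    proof -
      have "sqrt \<eta> * e > 0" using \<eta> e by simp
      then obtain M where M: "\<And>m n. m \<ge> M \<Longrightarrow> n \<ge> M \<Longrightarrow> norm (s m - s n) < sqrt \<eta> * e"
        using CauchyD[OF s(2)] by blast
      have "norm (v m - v n) < e \<and> norm (p m - p n) < e" if mn: "m \<ge> M" "n \<ge> M" for m n
      proof -
        have "\<eta> * ((norm (v m - v n))\<^sup>2 + (norm (p m - p n))\<^sup>2) \<le> (norm (s m - s n))\<^sup>2"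
          using lower[of "v m - v n" "p m - p n"] vp by (simp add: blinfun.diff_right algebra_simps)
        also have "\<dots> < (sqrt \<eta> * e)\<^sup>2" using M[OF mn] by (intro power_strict_mono) auto
        also have "\<dots> = \<eta> * e\<^sup>2" using \<eta> by (simp add: power_mult_distrib)
        finally have "(norm (v m - v n))\<^sup>2 + (norm (p m - p n))\<^sup>2 < e\<^sup>2" using \<eta> by simp
        then have "(norm (v m - v n))\<^sup>2 < e\<^sup>2" "(norm (p m - p n))\<^sup>2 < e\<^sup>2"
          using zero_le_power2[of "norm (v m - v n)"] zero_le_power2[of "norm (p m - p n)"] by linarith+
        then show ?thesis using e by (auto intro: power2_less_imp_less)
      qed
      then show ?thesis by blast
    qed
    have "Cauchy v" "Cauchy p" using * by (auto intro!: CauchyI) blast+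
    then obtain a b where ab: "v \<longlonglongrightarrow> a" "p \<longlonglongrightarrow> b" by (metis Cauchy_convergent convergent_def)
    have "V a = a"
    proof (rule LIMSEQ_unique)
      show "(\<lambda>n. V (v n)) \<longlonglongrightarrow> V a" by (intro tendsto_intros ab)
      show "(\<lambda>n. V (v n)) \<longlonglongrightarrow> a" using ab vp by simp
    qed
    moreover have "Pp b = b"
    proof (rule LIMSEQ_unique)
      show "(\<lambda>n. Pp (p n)) \<longlonglongrightarrow> Pp b" by (intro tendsto_intros ab)
      show "(\<lambda>n. Pp (p n)) \<longlonglongrightarrow> b" using ab vp by simp
    qed
    moreover have "s = (\<lambda>n. v n + p n)" using vp(3) by auto
    then have "s \<longlonglongrightarrow> a + b" using tendsto_add[OF ab] by simp
    moreover have "a + b \<in> Z" if "V a = a" "Pp b = b" using that unfolding Z_def range_P[OF borel_open[OF open_greaterThan]]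
        T.range_P[OF borel_open[OF open_lessThan]] by blast
    ultimately show "\<exists>l\<in>Z. s \<longlonglongrightarrow> l" by blast
  qed
  note pZ = sZ cZ
  define y where "y = x - proj Z x"
  have yZ: "y \<bullet> z = 0" if "z \<in> Z" for z using proj_orthogonal[OF pZ that] by (simp add: y_def)
  have zero: "0 \<in> range (P \<Omega>)" "0 \<in> range (T.P \<Omega>)" for \<Omega>
    by (rule range_eqI[of _ _ 0], simp add: blinfun.zero_right)+
  have VZ: "V u \<in> Z" for u
  proof -
    have "V u + 0 \<in> Z" unfolding Z_def using zero by blast
    then show ?thesis by simp
  qed
  have PZ: "Pp u \<in> Z" for u
  proof -
    have "0 + Pp u \<in> Z" unfolding Z_def using zero by blast
    then show ?thesis by simp
  qed
  have "V y \<bullet> V y = 0" using yZ[OF VZ, of y] T.P_inner[of "{..<0}" y "V y"] T.P_idem[of "{..<0}" y] by (simp add: inner_commute)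
  then have Wy: "W y = y" using VW[of y] by simp
  have "Pp y \<bullet> Pp y = 0" using yZ[OF PZ, of y] P_inner[of "{c<..}" y "Pp y"] P_idem[of "{c<..}" y] by (simp add: inner_commute)
  then have Py: "Pp y = 0" by simp
  have "x \<bullet> y = 0" using orth[OF Wy Py] .
  moreover have "proj Z x \<bullet> y = 0" using yZ[OF proj_mem[OF pZ]] by (simp add: inner_commute)
  ultimately have "y \<bullet> y = 0" by (simp add: y_def inner_diff_left inner_diff_right)
  then have "x = proj Z x" by (simp add: y_def)
  then have "x \<in> Z" using proj_mem[OF pZ, of x] by simp
  then show thesis using that unfolding Z_def by (auto simp: range_P T.range_P)
qed

text \<open>Let \<open>N'\<close> be the kernel of \<open>Pp\<close> on the range of
  \<open>W\<close>; \<open>kernel_bound\<close> gives \<open>dim N' \<le> dim L\<close>. A vector of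
  the range of \<open>Pz\<close> orthogonal to \<open>N'\<close> splits as \<open>v + p\<close> by
  \<open>V_plus_complete\<close>; comparing components, \<open>Pm v = 0\<close> and
  \<open>Pz v\<close> is the vector itself. So these vectors form a space of dimension at most that
  of the kernel of \<open>Pm\<close> on the range of \<open>V\<close>, and its codimension in the
  range of \<open>Pz\<close> is at most \<open>dim N'\<close>.\<close>

lemma positive_index:
  assumes ker: "\<And>x. x \<in> D \<Longrightarrow> A x - B x = 0 \<Longrightarrow> x = 0"
  obtains L k where "subspace L" "L \<subseteq> D" "finite_dim L" "L \<inter> range Pp \<subseteq> {0}" "k > 0"
    "\<And>l x. l \<in> L \<Longrightarrow> x \<in> range Pp \<Longrightarrow> x \<in> D \<Longrightarrow>
       k * ((l + x) \<bullet> (l + x)) \<le> (A (l + x) - B (l + x)) \<bullet> (l + x)"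
    "dim (range Pz) \<le> dim {v \<in> range V. Pm v = 0} + dim L"
proof (rule maximal_exists[of "-1" "{c<..}" "{..<- c}"])
  fix L k
  assume L: "subspace L" "L \<subseteq> D" "finite_dim L" "L \<inter> range Pp \<subseteq> {0}" "(k::real) > 0"
    "\<And>l x. l \<in> L \<Longrightarrow> x \<in> range Pp \<Longrightarrow> x \<in> D \<Longrightarrow>
       -1 * ((A (l + x) - B (l + x)) \<bullet> (l + x)) \<le> - k * ((l + x) \<bullet> (l + x))"
    and orth: "\<And>\<xi>. \<xi> \<in> D \<Longrightarrow> (\<And>l x. l \<in> L \<Longrightarrow> x \<in> range Pp \<Longrightarrow> x \<in> D \<Longrightarrow> (A \<xi> - B \<xi>) \<bullet> (l + x) = 0)
       \<Longrightarrow> 0 \<le> -1 * ((A \<xi> - B \<xi>) \<bullet> \<xi>)"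
  obtain \<delta> where \<delta>: "\<delta> > 0" "\<And>x. W x = x \<Longrightarrow> T.P {\<delta><..} x = x" using W_gap[OF ker] by blast
  have form: "-1 * ((A x - B x) \<bullet> x) \<le> - \<delta> * (x \<bullet> x)" if x: "x \<in> D" "W x = x" for x
    using T.P_form_bounds(2)[OF _ x(1) \<delta>(2)[OF x(2)], of \<delta>] by simp
  define N' where "N' = {v \<in> range W. Pp v = 0}"
  have fN': "finite_dim N'" and dN': "dim N' \<le> dim L"
    unfolding N'_def
    by (rule kernel_bound[where \<sigma> = "-1" and \<Omega> = "{0..}" and X = "{c<..}" and L = L and \<delta> = \<delta>];
        (fact orth | fact form | simp add: L(1,3) \<delta>(1)))+
  have sN': "subspace N'" unfolding N'_def
    using T.subspace_range_P[of "{0..}"] by (auto simp: subspace_def blinfun.zero_right blinfun.add_right blinfun.scaleR_right)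
  note pN = sN' finite_dim_complete[OF sN' fN']
  define N where "N = {v \<in> range V. Pm v = 0}"
  obtain L0 k0 where fN: "finite_dim N" unfolding N_def using negative_index by blast
  have sN: "subspace N" unfolding N_def
    using T.subspace_range_P[of "{..<0}"] by (auto simp: subspace_def blinfun.zero_right blinfun.add_right blinfun.scaleR_right)
  define K where "K = {x \<in> range Pz. proj N' x = 0}"
  have "K \<subseteq> Pz ` N"
  proof
    fix x assume x: "x \<in> K"
    have "x \<bullet> w = 0" if "W w = w" "Pp w = 0" for w
    proof -
      have "w \<in> N'" using that by (simp add: N'_def T.range_P)
      then show ?thesis using x proj_eq_0_iff[OF pN] by (simp add: K_def)
    qed
    then obtain v p where vp: "V v = v" "Pp p = p" "x = v + p" by (rule V_plus_complete)
    have Px: "Pz x = x" using x by (simp add: K_def range_P)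
    have d: "{..<- c} \<inter> {c<..} = {}" "{..<- c} \<inter> {- c..c} = {}" "{- c..c} \<inter> {c<..} = {}" using c_pos by auto
    have "Pm p = 0" using P_disjoint[OF _ _ d(1), of p] vp(2) by simp
    moreover have "Pm x = 0" using P_disjoint[OF _ _ d(2), of x] Px by simp
    moreover have "Pz p = 0" using P_disjoint[OF _ _ d(3), of p] vp(2) by simp
    ultimately have "Pm v = 0" "Pz v = x" using Px vp(3) by (simp_all add: blinfun.add_right)
    then show "x \<in> Pz ` N" using vp(1) by (intro image_eqI[of _ _ v]) (auto simp: N_def T.range_P)
  qed
  then have "dim K \<le> dim (Pz ` N)"
    using span_superset by (intro dim_mono_finite_dim finite_dim_linear_image[OF P_linear fN]) blast
  also have "\<dots> \<le> dim N" using rank_nullity[OF P_linear[of "{- c..c}"] sN fN] by simp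
  finally have dK: "dim K \<le> dim N" .
  have "proj N' ` range Pz \<subseteq> span N'" using proj_mem[OF pN] span_superset by blast
  then have "dim (proj N' ` range Pz) \<le> dim N'" by (rule dim_mono_finite_dim[OF fN'])
  then have "dim (range Pz) \<le> dim N + dim L"
    using rank_nullity[OF linear_proj[OF pN] subspace_range_P finite_rank] dK dN' by (simp add: K_def)
  moreover have "k * ((l + x) \<bullet> (l + x)) \<le> (A (l + x) - B (l + x)) \<bullet> (l + x)"
    if "l \<in> L" "x \<in> range Pp" "x \<in> D" for l x using L(6)[OF that] by simp
  ultimately show thesis using that[OF L(1-5)] by (simp add: N_def)
qed simp

end

section \<open>Uniform invertibility between the two perturbations\<close>

lemma dim_direct_sum:
  fixes V W :: "'a::real_inner set"
  assumes V: "subspace V" "finite_dim V" and W: "subspace W" "finite_dim W" and 0: "V \<inter> W \<subseteq> {0}"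
  shows "dim {v + w | v w. v \<in> V \<and> w \<in> W} = dim V + dim W"
proof -
  note pW = W(1) finite_dim_complete[OF W]
  define S where "S = {v + w | v w. v \<in> V \<and> w \<in> W}"
  have sS: "subspace S" unfolding S_def by (rule subspace_sums[OF V(1) W(1)])
  obtain A B where AB: "finite A" "V \<subseteq> span A" "finite B" "W \<subseteq> span B" using V(2) W(2) unfolding finite_dim_def by blast
  have fS: "finite_dim S"
  proof -
    have "S \<subseteq> span (A \<union> B)" using AB unfolding S_def span_Un by blast
    then show ?thesis using AB unfolding finite_dim_def by blast
  qed
  define f where "f x = x - proj W x" for x
  have f: "linear f" unfolding f_def using linear_proj[OF pW] by (intro linearI) (simp_all add: linear_add linear_scale algebra_simps)
  have fW: "f w = 0 \<longleftrightarrow> w \<in> W" for w using proj_id[OF pW] proj_mem[OF pW] by (auto simp: f_def) (metis)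
  have "W \<subseteq> S" unfolding S_def using subspace_0[OF V(1)] by force
  then have kerS: "{x\<in>S. f x = 0} = W" using fW by blast
  have "f (v + w) = f v" if "w \<in> W" for v w using fW[of w] that by (simp add: linear_add[OF f])
  moreover have "V \<subseteq> S" unfolding S_def using subspace_0[OF W(1)] by force
  ultimately have img: "f ` S = f ` V" by (auto simp: S_def)
  have kerV: "{x\<in>V. f x = 0} = {0}" using fW 0 subspace_0[OF V(1)] subspace_0[OF W(1)] by auto
  have "dim {0::'a} = 0" by (rule dim_zero_subspace)
  then have "dim V = dim (f ` V)" using rank_nullity[OF f V] unfolding kerV by simp
  then show ?thesis using rank_nullity[OF f sS fS] unfolding kerS img by (simp add: S_def)
qed

locale two_perturbations = B1: perturbed_operator D A B1 \<beta> c + B2: perturbed_operator D A B2 \<beta> c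
  for D :: "'a::{real_inner,complete_space} set" and A B1 B2 \<beta> c +
  assumes le: "op_le B1 B2" and index_eq: "relative_morse_index D A B1 = relative_morse_index D A B2"
    and kernel: "\<And>x. x \<in> D \<Longrightarrow> A x - B2 x = 0 \<Longrightarrow> x = 0"
begin

text \<open>Writing \<open>z = y + w\<close> with \<open>y\<close> on the negative and
  \<open>w\<close> on the positive side, \<open>(A - C) z\<close> is tested against
  \<open>w - y\<close>: the mixed terms cancel by symmetry and the two definite parts add up. The
  decomposition depends on \<open>B1\<close> and \<open>B2\<close> only, so the constant is the same
  for all \<open>C\<close> between them.\<close>

lemma coercive:
  obtains \<kappa> where "\<kappa> > 0"
    "\<And>C z. bounded_self_adjoint C \<Longrightarrow> op_le B1 C \<Longrightarrow> op_le C B2 \<Longrightarrow> z \<in> D \<Longrightarrow> \<kappa> * norm z \<le> norm (A z - C z)"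
proof -
  obtain L1 k1 where L1: "subspace L1" "L1 \<subseteq> D" "finite_dim L1" "L1 \<inter> range B1.Pm \<subseteq> {0}" "k1 > 0"
    "\<And>l x. l \<in> L1 \<Longrightarrow> x \<in> range B1.Pm \<Longrightarrow> x \<in> D \<Longrightarrow>
       (A (l + x) - B1 (l + x)) \<bullet> (l + x) \<le> - k1 * ((l + x) \<bullet> (l + x))"
    "finite_dim {v \<in> range B1.V. B1.Pm v = 0}" "dim {v \<in> range B1.V. B1.Pm v = 0} \<le> dim L1"
    using B1.negative_index by blast
  obtain L2 k2 where L2: "subspace L2" "L2 \<subseteq> D" "finite_dim L2" "L2 \<inter> range B1.Pp \<subseteq> {0}" "k2 > 0"
    "\<And>l x. l \<in> L2 \<Longrightarrow> x \<in> range B1.Pp \<Longrightarrow> x \<in> D \<Longrightarrow>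
       k2 * ((l + x) \<bullet> (l + x)) \<le> (A (l + x) - B2 (l + x)) \<bullet> (l + x)"
    "dim (range B1.Pz) \<le> dim {v \<in> range B2.V. B1.Pm v = 0} + dim L2"
    using B2.positive_index[OF kernel] by blast
  have fN2: "finite_dim {v \<in> range B2.V. B1.Pm v = 0}" using B2.negative_index by blast
  have "dim {v \<in> range B1.V. B1.Pm v = 0} = dim {v \<in> range B2.V. B1.Pm v = 0}"
    using index_eq B1.relative_index[OF L1(7)] B2.relative_index[OF fN2] by simp
  then have dims: "dim (range B1.Pz) \<le> dim L1 + dim L2" using L1(8) L2(7) by simp
  have opposite: "y = 0" if y: "y = l1 + m" "l1 \<in> L1" "m \<in> range B1.Pm" "m \<in> D"
    "y = l2 + p" "l2 \<in> L2" "p \<in> range B1.Pp" "p \<in> D" for y l1 l2 m p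
  proof -
    have "k2 * (y \<bullet> y) \<le> (A y - B2 y) \<bullet> y" using L2(6)[OF y(6-8)] y(5) by simp
    also have "\<dots> \<le> (A y - B1 y) \<bullet> y" using le by (simp add: op_le_def inner_diff_left)
    also have "\<dots> \<le> - k1 * (y \<bullet> y)" using L1(6)[OF y(2-4)] y(1) by simp
    finally have "(k1 + k2) * (y \<bullet> y) \<le> 0" by (simp add: algebra_simps)
    moreover have "k1 + k2 > 0" using L1(5) L2(5) by simp
    ultimately show ?thesis by (simp add: mult_le_0_iff inner_self_le_0_iff)
  qed
  have zero: "0 \<in> range (B1.P \<Omega>)" for \<Omega> by (rule range_eqI[of _ _ 0]) (simp add: blinfun.zero_right)
  define S where "S = {l1 + l2 | l1 l2. l1 \<in> L1 \<and> l2 \<in> L2}"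
  have sS: "subspace S" unfolding S_def by (rule subspace_sums[OF L1(1) L2(1)])
  have "L1 \<inter> L2 \<subseteq> {0}" using opposite[of _ _ 0 _ 0] zero B1.zero_D by auto
  then have dS: "dim S = dim L1 + dim L2" unfolding S_def by (rule dim_direct_sum[OF L1(1,3) L2(1,3)])
  have split: "B1.Pm x + B1.Pz x + B1.Pp x = x" for x using B1.decomposition[of x] by simp
  have PD: "B1.P \<Omega> x \<in> D" if "x \<in> D" "\<Omega> \<in> sets borel" for x \<Omega> using B1.P_D that by blast
  have negD: "- x \<in> D" if "x \<in> D" for x using B1.scale_D[OF that, of "-1"] by simp
  have neg_range: "- x \<in> range (B1.P \<Omega>)" if "x \<in> range (B1.P \<Omega>)" for x \<Omega>
    using B1.subspace_range_P that by (rule subspace_neg)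
  \<comment> \<open>If \<open>Pz\<close> kills \<open>l1 + l2\<close>, moving the outer components
    to the two sides exhibits one vector in both enlarged spaces, which is 0 by
    \<open>opposite\<close>.\<close>
  have inj: "s = 0" if "s \<in> S" "B1.Pz s = 0" for s
  proof -
    obtain l1 l2 where l: "l1 \<in> L1" "l2 \<in> L2" "s = l1 + l2" using \<open>s \<in> S\<close> by (auto simp: S_def)
    then have sD: "s \<in> D" using L1(2) L2(2) by (auto intro: B1.add_D)
    define m p where "m = B1.Pm s" and "p = B1.Pp s"
    have mp: "s = m + p" using split[of s] that(2) by (simp add: m_def p_def)
    have r: "m \<in> range B1.Pm" "p \<in> range B1.Pp" "m \<in> D" "p \<in> D" using PD[OF sD] by (auto simp: m_def p_def)
    have y: "l1 + (- m) = (- l2) + p" using mp l(3) by (simp add: algebra_simps)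
    have l2n: "- l2 \<in> L2" using L2(1) l(2) by (rule subspace_neg)
    have "l1 + (- m) = 0"
      using opposite[OF refl l(1) neg_range[OF r(1)] negD[OF r(3)] y l2n r(2,4)] .
    then have "l1 = m" "p = l2" using y by (auto simp: add_eq_0_iff2)
    then have "l1 \<in> L1 \<inter> range B1.Pm" "l2 \<in> L2 \<inter> range B1.Pp" using l r by auto
    then have "l1 = 0" "l2 = 0" using L1(4) L2(4) by blast+
    then show ?thesis using l(3) by simp
  qed
  have "B1.Pz ` S = range B1.Pz"
  proof (rule finite_dim_eqI)
    show "subspace (B1.Pz ` S)" by (rule linear_subspace_image[OF B1.P_linear sS])
    have "dim S \<le> dim (B1.Pz ` S)"
      by (rule dim_inj_le(2)[OF B1.P_linear sS inj _ finite_dim_subset[OF B1.finite_rank]]) auto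
    then show "dim (range B1.Pz) \<le> dim (B1.Pz ` S)" using dims dS by simp
  qed (use B1.finite_rank in auto)
  note onto = this
  define k where "k = min k1 k2"
  have k: "k > 0" "k \<le> k1" "k \<le> k2" using L1(5) L2(5) by (auto simp: k_def)
  show thesis
  proof (rule that[of "k / 2"])
    show "k / 2 > 0" using k by simp
    fix C :: "'a \<Rightarrow>\<^sub>L 'a" and z
    assume C: "bounded_self_adjoint C" "op_le B1 C" "op_le C B2" and z: "z \<in> D"
    obtain l1 l2 where l: "l1 \<in> L1" "l2 \<in> L2" "B1.Pz z = B1.Pz (l1 + l2)"
    proof -
      have "B1.Pz z \<in> B1.Pz ` S" unfolding onto by simp
      then show thesis using that by (auto simp: S_def)
    qed
    have lD: "l1 \<in> D" "l2 \<in> D" using l L1(2) L2(2) by auto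
    \<comment> \<open>The remainder has no component in the range of \<open>Pz\<close>; its two
      outer components are absorbed into the negative and the positive summand.\<close>
    define r where "r = z - (l1 + l2)"
    have rD: "r \<in> D" using z lD by (simp add: r_def B1.diff_D B1.add_D)
    have "B1.Pz r = 0" using l(3) by (simp add: r_def blinfun.diff_right)
    then have r: "r = B1.Pm r + B1.Pp r" using split[of r] by simp
    define y where "y = l1 + B1.Pm r"
    define w where "w = l2 + B1.Pp r"
    have yw: "y \<in> D" "w \<in> D" using lD PD[OF rD] by (auto simp: y_def w_def B1.add_D)
    have zyw: "z = y + w" using r by (simp add: y_def w_def r_def algebra_simps)
    have y_form: "(A y - C y) \<bullet> y \<le> - k * (y \<bullet> y)"
    proof -
      have "(A y - C y) \<bullet> y \<le> (A y - B1 y) \<bullet> y" using C(2) by (simp add: op_le_def inner_diff_left)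
      also have "\<dots> \<le> - k1 * (y \<bullet> y)" unfolding y_def using L1(6)[OF l(1)] PD[OF rD] by simp
      also have "\<dots> \<le> - k * (y \<bullet> y)" using k by (intro mult_right_mono) auto
      finally show ?thesis .
    qed
    have w_form: "k * (w \<bullet> w) \<le> (A w - C w) \<bullet> w"
    proof -
      have "k * (w \<bullet> w) \<le> k2 * (w \<bullet> w)" using k by (intro mult_right_mono) auto
      also have "\<dots> \<le> (A w - B2 w) \<bullet> w" unfolding w_def using L2(6)[OF l(2)] PD[OF rD] by simp
      also have "\<dots> \<le> (A w - C w) \<bullet> w" using C(3) by (simp add: op_le_def inner_diff_left)
      finally show ?thesis .
    qed
    have "C w \<bullet> y = C y \<bullet> w" using C(1) by (simp add: bounded_self_adjoint_def inner_commute)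
    moreover have "A w \<bullet> y = A y \<bullet> w" using B1.symmetric[OF yw(2,1)] by (simp add: inner_commute)
    ultimately have "(A z - C z) \<bullet> (w - y) = (A w - C w) \<bullet> w - (A y - C y) \<bullet> y"
      using yw by (simp add: zyw B1.add blinfun.add_right inner_add inner_diff)
    then have 1: "k * ((norm w)\<^sup>2 + (norm y)\<^sup>2) \<le> (A z - C z) \<bullet> (w - y)"
      using y_form w_form by (simp add: power2_norm_eq_inner algebra_simps)
    \<comment> \<open>\<open>s\<close> bounds both \<open>norm z\<close> and the norm of the test
      vector; passing from the sum of squares to its square costs the factor 1/2 in the
      constant.\<close>
    define s where "s = norm w + norm y"
    have "s\<^sup>2 \<le> 2 * ((norm w)\<^sup>2 + (norm y)\<^sup>2)"
      using zero_le_power2[of "norm w - norm y"] by (simp add: s_def power2_eq_square algebra_simps)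
    then have "k / 2 * s\<^sup>2 \<le> k / 2 * (2 * ((norm w)\<^sup>2 + (norm y)\<^sup>2))" using k by (intro mult_left_mono) auto
    also have "\<dots> = k * ((norm w)\<^sup>2 + (norm y)\<^sup>2)" by (simp add: algebra_simps)
    also have "\<dots> \<le> (A z - C z) \<bullet> (w - y)" by (rule 1)
    also have "\<dots> \<le> norm (A z - C z) * norm (w - y)" by (rule norm_cauchy_schwarz)
    also have "\<dots> \<le> norm (A z - C z) * s" unfolding s_def by (intro mult_left_mono norm_triangle_ineq4) auto
    finally have 2: "(k / 2 * s) * s \<le> norm (A z - C z) * s" by (simp add: power2_eq_square)
    have "norm z \<le> s" using norm_triangle_ineq[of y w] by (simp add: zyw s_def)
    show "k / 2 * norm z \<le> norm (A z - C z)"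
    proof (cases "s = 0")
      case True
      then show ?thesis using \<open>norm z \<le> s\<close> by simp
    next
      case False
      then have "s > 0" by (simp add: s_def order_less_le)
      then have "k / 2 * s \<le> norm (A z - C z)" using 2 by (simp only: mult_le_cancel_right_pos)
      moreover have "k / 2 * norm z \<le> k / 2 * s" using \<open>norm z \<le> s\<close> k by (intro mult_left_mono) auto
      ultimately show ?thesis by linarith
    qed
  qed
qed

end

section \<open>A zero of a perturbation of the identity\<close>

lemma continuous_map_scaleR_const:
  fixes v :: "'a::real_normed_vector"
  assumes "continuous_map X euclideanreal f" shows "continuous_map X euclidean (\<lambda>x. f x *\<^sub>R v)"
proof -
  have "continuous_on UNIV (\<lambda>r. r *\<^sub>R v)" by (intro continuous_intros)
  then have "continuous_map euclideanreal euclidean (\<lambda>r. r *\<^sub>R v)" by simp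
  from continuous_map_compose[OF assms this] show ?thesis by (simp add: o_def)
qed

text \<open>
  Without a zero, \<open>t \<mapsto> \<psi> (t r u) / \<parallel>\<psi> (t r u)\<parallel>\<close> would contract the unit sphere of \<open>X\<close>; the sphere is
  identified with \<open>nsphere n\<close> by an orthonormal basis.
\<close>
lemma zero_of_identity_near_infinity:
  fixes X :: "'a::real_inner set"
  assumes X: "subspace X" "finite_dim X" and cont: "continuous_on X \<psi>" and maps: "\<psi> ` X \<subseteq> X"
    and id: "\<And>u. u \<in> X \<Longrightarrow> r \<le> norm u \<Longrightarrow> \<psi> u = u" and r: "r > 0"
  shows "\<exists>u\<in>X. \<psi> u = 0"
proof (rule ccontr)
  assume "\<not> ?thesis"
  then have nz: "\<psi> u \<noteq> 0" if "u \<in> X" for u using that by blast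
  obtain B where B: "finite B" "independent B" "B \<subseteq> X" "span B = X" "card B = dim X"
    "\<forall>b\<in>B. b \<bullet> b = 1" "\<forall>b\<in>B. \<forall>c\<in>B. b \<noteq> c \<longrightarrow> b \<bullet> c = 0"
    by (rule orthonormal_basis_exists[OF X])
  \<comment> \<open>In dimension 0 the origin itself is a zero. Otherwise the unit sphere has
    dimension one less than \<open>X\<close>, hence \<open>card B = Suc n\<close>.\<close>
  have "B \<noteq> {}"
  proof
    assume "B = {}"
    then have "X = {0}" using B(4) by simp
    then show False using maps nz[of 0] by auto
  qed
  then obtain n where n: "card B = Suc n" using B(1) by (metis card_0_eq not0_implies_Suc)
  obtain e where e: "bij_betw e {..<Suc n} B" using ex_bij_betw_nat_finite[OF B(1)] n by (auto simp: atLeast0LessThan)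
  then have e: "bij_betw e {..n} B" by (simp add: lessThan_Suc_atMost)
  have eB: "e i \<in> B" if "i \<le> n" for i using e that by (auto simp: bij_betw_def)
  have ee: "e i \<bullet> e j = (if i = j then 1 else 0)" if "i \<le> n" "j \<le> n" for i j
  proof (cases "i = j")
    case False
    then have "e i \<noteq> e j" using e that by (auto simp: bij_betw_def inj_on_def)
    then show ?thesis using B(7) eB that False by auto
  qed (use B(6) eB that in auto)
  have expand: "(\<Sum>i\<le>n. (x \<bullet> e i) *\<^sub>R e i) = x" if "x \<in> X" for x
  proof -
    have "(\<Sum>b\<in>B. (x \<bullet> b) *\<^sub>R b) = x"
      by (rule orthonormal_expansion[OF B(1,6,7)]) (use that B(4) in simp)
    then show ?thesis using sum.reindex_bij_betw[OF e, of "\<lambda>b. (x \<bullet> b) *\<^sub>R b"] by simp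
  qed
  define \<phi> where "\<phi> c = (\<Sum>i\<le>n. c i *\<^sub>R e i)" for c :: "nat \<Rightarrow> real"
  have \<phi>X: "\<phi> c \<in> X" for c
    unfolding \<phi>_def using X(1) B(3) eB by (intro subspace_sum subspace_scale) auto
  have \<phi>e: "\<phi> c \<bullet> e i = c i" if "i \<le> n" for c i
  proof -
    have "\<phi> c \<bullet> e i = (\<Sum>j\<le>n. if j = i then c i else 0)"
      unfolding \<phi>_def inner_sum_left by (rule sum.cong) (auto simp: ee that)
    then show ?thesis using that by simp
  qed
  have norm_sum: "(\<Sum>i\<le>n. (x \<bullet> e i)\<^sup>2) = (norm x)\<^sup>2" if "x \<in> X" for x
  proof -
    have "(norm x)\<^sup>2 = x \<bullet> (\<Sum>i\<le>n. (x \<bullet> e i) *\<^sub>R e i)" using expand[OF that] by (simp add: power2_norm_eq_inner)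
    then show ?thesis by (simp add: inner_sum_right power2_eq_square)
  qed
  \<comment> \<open>Points of \<open>nsphere n\<close> are sequences that vanish beyond index
    \<open>n\<close>; hence the default value 0.\<close>
  define g where "g u i = (if i \<le> n then (\<psi> u \<bullet> e i) / norm (\<psi> u) else 0)" for u i
  define h where "h = (\<lambda>(t::real, c). g ((t * r) *\<^sub>R \<phi> c))"
  have gS: "g u \<in> {x. (\<Sum>i\<le>n. x i ^ 2) = 1 \<and> (\<forall>i>n. x i = 0)}" if u: "u \<in> X" for u
  proof -
    have "(\<Sum>i\<le>n. g u i ^ 2) = (\<Sum>i\<le>n. (\<psi> u \<bullet> e i)\<^sup>2) / (norm (\<psi> u))\<^sup>2"
      unfolding sum_divide_distrib by (rule sum.cong) (auto simp: g_def power_divide)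
    also have "\<dots> = 1" using norm_sum[of "\<psi> u"] maps u nz[OF u] by auto
    finally show ?thesis by (simp add: g_def)
  qed
  let ?P = "prod_topology (top_of_set {0..1::real}) (nsphere n)"
  have fst: "continuous_map ?P euclideanreal fst"
    using continuous_map_fst by (rule continuous_map_into_fulltopology)
  have snd: "continuous_map ?P euclideanreal (\<lambda>p. snd p i)" for i
    using continuous_map_compose[OF continuous_map_snd continuous_map_nsphere_projection] by (simp add: o_def)
  have "continuous_map ?P euclidean (\<lambda>p. (fst p * r) *\<^sub>R \<phi> (snd p))"
  proof -
    have "continuous_map ?P euclidean (\<lambda>p. \<Sum>i\<le>n. (fst p * r * snd p i) *\<^sub>R e i)"
      by (intro continuous_map_sum continuous_map_scaleR_const continuous_map_real_mult fst snd) auto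
    then show ?thesis by (simp add: \<phi>_def scaleR_sum_right)
  qed
  then have u: "continuous_map ?P (top_of_set X) (\<lambda>p. (fst p * r) *\<^sub>R \<phi> (snd p))"
    using \<phi>X X(1) by (auto simp: continuous_map_in_subtopology subspace_scale)
  have "continuous_map ?P (nsphere n) h"
    unfolding nsphere continuous_map_in_subtopology
  proof
    have "continuous_map ?P euclideanreal (\<lambda>p. h p i)" for i
    proof -
      have "continuous_on X (\<lambda>u. g u i)"
        unfolding g_def by (cases "i \<le> n") (auto intro!: continuous_intros cont simp: nz)
      then have "continuous_map (top_of_set X) euclideanreal (\<lambda>u. g u i)" by simp
      from continuous_map_compose[OF u this] show ?thesis by (simp add: o_def h_def case_prod_unfold)
    qed
    then show "continuous_map (prod_topology (top_of_set {0..1})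
        (subtopology (powertop_real UNIV) {x. (\<Sum>i\<le>n. (x i)\<^sup>2) = 1 \<and> (\<forall>i>n. x i = 0)})) (powertop_real UNIV) h"
      by (simp add: continuous_map_componentwise_UNIV nsphere)
    show "h \<in> topspace (prod_topology (top_of_set {0..1})
        (subtopology (powertop_real UNIV) {x. (\<Sum>i\<le>n. (x i)\<^sup>2) = 1 \<and> (\<forall>i>n. x i = 0)}))
        \<rightarrow> {x. (\<Sum>i\<le>n. (x i)\<^sup>2) = 1 \<and> (\<forall>i>n. x i = 0)}"
      using gS \<phi>X X(1) by (auto simp: h_def subspace_scale)
  qed
  \<comment> \<open>At time 1 the argument of \<psi> has norm \<open>r\<close>, where \<psi> is the
    identity; at time 0 it is the origin, so the map is constant.\<close>
  moreover have "h (1, c) = c" if c: "c \<in> topspace (nsphere n)" for c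
  proof -
    have c: "(\<Sum>i\<le>n. (c i)\<^sup>2) = 1" "\<And>i. i > n \<Longrightarrow> c i = 0" using c by (auto simp: nsphere)
    have "(norm (\<phi> c))\<^sup>2 = 1" using norm_sum[OF \<phi>X, of c] c(1) by (simp add: \<phi>e)
    then have n1: "norm (\<phi> c) = 1" by (intro power2_eq_imp_eq[of _ 1]) simp_all
    then have "\<psi> (r *\<^sub>R \<phi> c) = r *\<^sub>R \<phi> c" using r \<phi>X X(1) by (intro id) (auto simp: subspace_scale)
    then show ?thesis using r n1 c(2) by (auto simp: h_def g_def \<phi>e fun_eq_iff)
  qed
  moreover have "h (0, c) = g 0" for c by (simp add: h_def)
  ultimately have "homotopic_with (\<lambda>x. True) (nsphere n) (nsphere n) (\<lambda>x. g 0) id"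
    by (subst homotopic_with) (auto intro!: exI[of _ h])
  then have "homotopic_with (\<lambda>x. True) (nsphere n) (nsphere n) id (\<lambda>x. g 0)" by (rule homotopic_with_symD)
  then have "contractible_space (nsphere n)" unfolding contractible_space_def by blast
  then show False using non_contractible_space_nsphere by blast
qed

section \<open>Lyapunov--Schmidt reduction\<close>

text \<open>The contraction constant is uniform in the parameter. Comparing \<open>f u\<close> with
  \<open>K u (f v)\<close>, continuity in \<open>u\<close> at the single frozen point
  \<open>f v\<close> suffices, at the cost of a factor \<open>1 / (1 - q)\<close>.\<close>

lemma contraction_family:
  fixes K :: "'a::metric_space \<Rightarrow> 'b::complete_space \<Rightarrow> 'b"
  assumes q: "0 \<le> q" "q < 1" and lip: "\<And>u w w'. u \<in> X \<Longrightarrow> dist (K u w) (K u w') \<le> q * dist w w'"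
    and cont: "\<And>w. continuous_on X (\<lambda>u. K u w)"
  obtains f where "\<And>u. u \<in> X \<Longrightarrow> K u (f u) = f u" "continuous_on X f"
proof -
  have "\<exists>w. K u w = w" if "u \<in> X" for u
    using banach_fix_type[OF q, of "K u"] lip[OF that] by blast
  then obtain f where f: "\<And>u. u \<in> X \<Longrightarrow> K u (f u) = f u" by metis
  have bound: "(1 - q) * dist (f u) (f v) \<le> dist (K u (f v)) (K v (f v))" if "u \<in> X" "v \<in> X" for u v
  proof -
    have "dist (f u) (f v) \<le> dist (K u (f u)) (K u (f v)) + dist (K u (f v)) (K v (f v))"
      using dist_triangle[of "f u" "f v" "K u (f v)"] f that by simp
    also have "\<dots> \<le> q * dist (f u) (f v) + dist (K u (f v)) (K v (f v))" using lip[OF that(1)] by simp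
    finally show ?thesis by (simp add: algebra_simps)
  qed
  have "continuous_on X f"
    unfolding continuous_on_iff
  proof (intro ballI allI impI)
    fix v and \<epsilon> :: real assume v: "v \<in> X" and \<epsilon>: "\<epsilon> > 0"
    then have "(1 - q) * \<epsilon> > 0" using q by simp
    then obtain d where d: "d > 0" "\<And>u. u \<in> X \<Longrightarrow> dist u v < d \<Longrightarrow> dist (K u (f v)) (K v (f v)) < (1 - q) * \<epsilon>"
      using cont[of "f v"] v unfolding continuous_on_iff by blast
    have "dist (f u) (f v) < \<epsilon>" if "u \<in> X" "dist u v < d" for u
    proof -
      have "(1 - q) * dist (f u) (f v) < (1 - q) * \<epsilon>" using bound[OF that(1) v] d(2)[OF that] by linarith
      then show ?thesis using q by (simp add: mult_less_cancel_left)
    qed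
    then show "\<exists>d>0. \<forall>u\<in>X. dist u v < d \<longrightarrow> dist (f u) (f v) < \<epsilon>" using d(1) by blast
  qed
  with f show thesis using that by blast
qed

context perturbed_operator
begin

text \<open>\<open>G\<close> inverts \<open>A\<close> on the complement of the range of
  \<open>Pz\<close>, after projecting onto it. Its Lipschitz constant \<open>1 / c\<close> makes the
  complementary equation a contraction with factor \<open>\<beta> / c\<close>.\<close>

lemma complementary_inverse:
  obtains G where "\<And>h. G h \<in> D" "\<And>h. Pz (G h) = 0" "\<And>h. A (G h) = h - Pz h"
    "\<And>h k. c * norm (G h - G k) \<le> norm (h - k)"
proof -
  let ?Q = "P (- {- c..c})"
  have Q: "?Q x = x - Pz x" for x by (rule P_Compl) simp
  have Q_eq: "?Q x = x \<longleftrightarrow> Pz x = 0" for x by (simp add: Q)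
  have low: "c * norm x \<le> norm (A x)" if "x \<in> D" "Pz x = 0" for x
    using gap_lower_bound[of "\<lambda>x. 0" 0, OF _ that] by simp
  have "\<exists>\<xi>. \<xi> \<in> D \<and> Pz \<xi> = 0 \<and> A \<xi> = h - Pz h" for h
  proof -
    have "?Q (?Q h) = ?Q h" by (rule P_idem) simp
    then obtain \<xi> where "\<xi> \<in> D" "?Q \<xi> = \<xi>" "A \<xi> = ?Q h"
      using surjective_on_reducing[OF P_projection[of "- {- c..c}"] _ _ c_pos, of "?Q h"] low
      by (metis P_A P_D Q_eq borel_comp borel_closed closed_atLeastAtMost)
    then show ?thesis using Q Q_eq by auto
  qed
  then obtain G where G: "\<And>h. G h \<in> D" "\<And>h. Pz (G h) = 0" "\<And>h. A (G h) = h - Pz h" by metis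
  have "c * norm (G h - G k) \<le> norm (h - k)" for h k
  proof -
    have "c * norm (G h - G k) \<le> norm (A (G h - G k))"
      using G by (intro low) (simp_all add: diff_D blinfun.diff_right)
    also have "A (G h - G k) = ?Q (h - k)" using G by (simp add: diff Q blinfun.diff_right)
    also have "norm (?Q (h - k)) \<le> norm (h - k)" by (rule norm_P) simp
    finally show ?thesis .
  qed
  with G show thesis using that by blast
qed

text \<open>A self-adjoint operator that is bounded below is onto; this is
  \<open>surjective_on_reducing\<close> with the identity as projection.\<close>

lemma full_inverse:
  assumes "\<kappa> > 0" and low: "\<And>x. x \<in> D \<Longrightarrow> \<kappa> * norm x \<le> norm (A x - B x)"
  obtains K where "\<And>y. K y \<in> D" "\<And>y. A (K y) - B (K y) = y" "\<And>x. x \<in> D \<Longrightarrow> K (A x - B x) = x"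
    "continuous_on UNIV K"
proof -
  have id: "orthogonal_projection (id_blinfun :: 'a \<Rightarrow>\<^sub>L 'a)"
    by (simp add: orthogonal_projection_def bounded_self_adjoint_def)
  have "\<exists>\<xi>. \<xi> \<in> D \<and> A \<xi> - B \<xi> = y" for y
    using T.surjective_on_reducing[OF id _ _ assms(1), of y] low by auto
  then obtain K where K: "\<And>y. K y \<in> D" "\<And>y. A (K y) - B (K y) = y" by metis
  have lip: "\<kappa> * norm (x - y) \<le> norm ((A x - B x) - (A y - B y))" if "x \<in> D" "y \<in> D" for x y
    using low[of "x - y"] that by (simp add: diff diff_D blinfun.diff_right algebra_simps)
  have inv: "K (A x - B x) = x" if "x \<in> D" for x
    using lip[OF K(1) that, of "A x - B x"] assms(1) by (simp add: K(2) mult_le_0_iff)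
  have "continuous_on UNIV K"
    unfolding continuous_on_iff
  proof (intro ballI allI impI)
    fix x :: 'a and e :: real assume e: "e > 0"
    have "dist (K y) (K x) < e" if "dist y x < \<kappa> * e" for y
    proof -
      have "\<kappa> * norm (K y - K x) < \<kappa> * e" using lip[OF K(1) K(1), of y x] that by (simp add: K(2) dist_norm)
      then show ?thesis using assms(1) by (simp add: dist_norm)
    qed
    then show "\<exists>d>0. \<forall>y\<in>UNIV. dist y x < d \<longrightarrow> dist (K y) (K x) < e"
      using e assms(1) by (intro exI[of _ "\<kappa> * e"]) auto
  qed
  with K inv show thesis using that by blast
qed

text \<open>
  The homotopy from \<open>N\<close> to \<open>B\<close> is run along \<open>\<parallel>u\<parallel>\<close> between the radii \<open>r\<close> and \<open>2 r\<close>. The reduced map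
  \<open>u \<mapsto> Pz ((A - B)\<inverse> (A z - N\<^sub>\<tau> z))\<close>, where \<open>z = u + w u\<close> solves the complementary equation, is the
  identity outside the larger ball.
\<close>
lemma solution_by_homotopy:
  fixes N :: "'a \<Rightarrow> 'a"
  assumes \<kappa>: "\<kappa> > 0" "\<And>x. x \<in> D \<Longrightarrow> \<kappa> * norm x \<le> norm (A x - B x)"
    and lip: "\<And>x y. norm (N x - N y) \<le> \<beta> * norm (x - y)" and r: "r > 0"
    and apriori: "\<And>z t. z \<in> D \<Longrightarrow> 0 \<le> t \<Longrightarrow> t \<le> 1 \<Longrightarrow> A z = t *\<^sub>R N z + (1 - t) *\<^sub>R B z \<Longrightarrow> norm z < r"
  shows "\<exists>z\<in>D. A z = N z"
proof -
  define X where "X = range Pz"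
  have Pz: "Pz x = x" if "x \<in> X" for x using that by (simp add: X_def range_P)
  have XD: "x \<in> D" if "x \<in> X" for x
    using P_bounded_D[of "{- c..c}" c x] Pz[OF that] by simp
  have X: "subspace X" "finite_dim X" using subspace_range_P finite_rank by (simp_all add: X_def)
  obtain G where G: "\<And>h. G h \<in> D" "\<And>h. Pz (G h) = 0" "\<And>h. A (G h) = h - Pz h"
    "\<And>h k. c * norm (G h - G k) \<le> norm (h - k)" using complementary_inverse by blast
  obtain K where K: "\<And>y. K y \<in> D" "\<And>y. A (K y) - B (K y) = y" "\<And>x. x \<in> D \<Longrightarrow> K (A x - B x) = x"
    "continuous_on UNIV K" using full_inverse[OF \<kappa>] by blast
  define \<tau> where "\<tau> u = max 0 (min 1 (2 - norm u / r))" for u :: 'a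
  have \<tau>: "0 \<le> \<tau> u" "\<tau> u \<le> 1" for u by (auto simp: \<tau>_def)
  have \<tau>_cont: "continuous_on S \<tau>" for S unfolding \<tau>_def using r by (intro continuous_intros) auto
  define M where "M u z = \<tau> u *\<^sub>R N z + (1 - \<tau> u) *\<^sub>R B z" for u z
  have M_lip: "norm (M u x - M u y) \<le> \<beta> * norm (x - y)" for u x y
  proof -
    have "M u x - M u y = \<tau> u *\<^sub>R (N x - N y) + (1 - \<tau> u) *\<^sub>R B (x - y)"
      by (simp add: M_def blinfun.diff_right algebra_simps)
    then have "norm (M u x - M u y) \<le> \<tau> u * norm (N x - N y) + (1 - \<tau> u) * norm (B (x - y))"
      using norm_triangle_ineq[of "\<tau> u *\<^sub>R (N x - N y)" "(1 - \<tau> u) *\<^sub>R B (x - y)"] \<tau>[of u] by simp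
    also have "\<dots> \<le> \<tau> u * (\<beta> * norm (x - y)) + (1 - \<tau> u) * (\<beta> * norm (x - y))"
      using \<tau>[of u] lip B_bound by (intro add_mono mult_left_mono) auto
    finally show ?thesis by (simp add: algebra_simps)
  qed
  have N_cont: "continuous_on S N" for S
  proof (rule continuous_on_subset[of UNIV])
    show "continuous_on UNIV N"
      using \<beta> lip by (intro lipschitz_on_continuous_on[of \<beta>] lipschitz_onI) (auto simp: dist_norm)
  qed simp
  have M_cont: "continuous_on S (\<lambda>u. M u (f u))" if "continuous_on S f" for S f
    unfolding M_def
    by (intro continuous_intros \<tau>_cont that continuous_on_compose2[OF N_cont[of UNIV]]) auto
  have G_lip: "dist (G h) (G k) \<le> 1 / c * dist h k" for h k
    using G(4)[of h k] c_pos by (simp add: dist_norm field_simps)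
  have G_cont: "continuous_on UNIV G"
    using G_lip c_pos by (intro lipschitz_on_continuous_on[of "1 / c"] lipschitz_onI) auto
  obtain w where w: "\<And>u. u \<in> X \<Longrightarrow> G (M u (u + w u)) = w u" and w_cont: "continuous_on X w"
  proof (rule contraction_family[of "\<beta> / c" X "\<lambda>u w. G (M u (u + w))"])
    show "dist (G (M u (u + w))) (G (M u (u + w'))) \<le> \<beta> / c * dist w w'" for u w w'
    proof -
      have "dist (G (M u (u + w))) (G (M u (u + w'))) \<le> 1 / c * dist (M u (u + w)) (M u (u + w'))" by (rule G_lip)
      also have "\<dots> \<le> 1 / c * (\<beta> * dist w w')"
        using M_lip[of u "u + w" "u + w'"] c_pos by (intro mult_left_mono) (auto simp: dist_norm)
      finally show ?thesis by simp
    qed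
    show "continuous_on X (\<lambda>u. G (M u (u + w)))" for w
      by (intro continuous_on_compose2[OF G_cont] M_cont continuous_intros) auto
  qed (use \<theta> in auto)
  define z where "z u = u + w u" for u
  define g where "g u = A (z u) - M u (z u)" for u
  have wD: "w u \<in> D" "Pz (w u) = 0" "A (w u) = M u (z u) - Pz (M u (z u))" if "u \<in> X" for u
    using G w[OF that] unfolding z_def by metis+
  have zD: "z u \<in> D" if "u \<in> X" for u unfolding z_def using XD[OF that] wD[OF that] by (simp add: add_D)
  have Pz_z: "Pz (z u) = u" if "u \<in> X" for u
    using Pz[OF that] wD[OF that] by (simp add: z_def blinfun.add_right)
  have g_eq: "g u = A u - Pz (M u (z u))" if "u \<in> X" for u
  proof -
    have "A (z u) = A u + A (w u)" unfolding z_def by (rule add[OF XD[OF that] wD(1)[OF that]])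
    then show ?thesis using wD(3)[OF that] by (simp add: g_def)
  qed
  \<comment> \<open>Solving the complementary equation leaves a residual in the finite-dimensional
    space only.\<close>
  have Pz_g: "Pz (g u) = g u" if "u \<in> X" for u
    using P_A[of "{- c..c}" u] XD[OF that] Pz[OF that] P_idem[of "{- c..c}"]
    by (simp add: g_eq[OF that] blinfun.diff_right)
  have A_cont: "continuous_on X A"
  proof (intro lipschitz_on_continuous_on[of c] lipschitz_onI)
    fix x y assume xy: "x \<in> X" "y \<in> X"
    have "norm (A (x - y) - 0 *\<^sub>R (x - y)) \<le> c * norm (x - y)"
      by (rule P_norm_bound[of "{- c..c}"]) (use xy Pz in \<open>auto simp: blinfun.diff_right\<close>)
    then show "dist (A x) (A y) \<le> c * dist x y" using diff[OF XD[OF xy(1)] XD[OF xy(2)]] by (simp add: dist_norm)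
  qed (use c_pos in simp)
  have z_cont: "continuous_on X z" unfolding z_def by (intro continuous_intros w_cont)
  have g_cont: "continuous_on X (\<lambda>u. A u - Pz (M u (z u)))"
    by (intro continuous_intros A_cont M_cont z_cont)
  define \<psi> where "\<psi> u = Pz (K (A u - Pz (M u (z u))))" for u
  have "\<exists>u\<in>X. \<psi> u = 0"
  proof (rule zero_of_identity_near_infinity[OF X, where r = "2 * r"])
    show "continuous_on X \<psi>" unfolding \<psi>_def
      by (intro continuous_intros continuous_on_compose2[OF K(4) g_cont]) auto
    show "\<psi> ` X \<subseteq> X" by (auto simp: \<psi>_def X_def)
    fix u assume u: "u \<in> X" "2 * r \<le> norm u"
    then have "\<tau> u = 0" using r by (simp add: \<tau>_def field_simps)
    then have "g u = A (z u) - B (z u)" by (simp add: g_def M_def)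
    then show "\<psi> u = u" using K(3)[OF zD[OF u(1)]] g_eq[OF u(1)] Pz_z[OF u(1)] by (simp add: \<psi>_def)
  qed (use r in simp)
  then obtain u where u: "u \<in> X" "\<psi> u = 0" by blast
  define \<zeta> where "\<zeta> = K (g u)"
  have \<zeta>: "\<zeta> \<in> D" "A \<zeta> - B \<zeta> = g u" "Pz \<zeta> = 0"
    using K u g_eq[OF u(1)] by (simp_all add: \<zeta>_def \<psi>_def)
  \<comment> \<open>A zero of \<psi> is a zero of the residual: \<zeta> has no component in the
    range of \<open>Pz\<close>, whereas \<open>A \<zeta> - B \<zeta>\<close> lies in that range. So
    \<open>A \<zeta>\<close> equals the complementary part of \<open>B \<zeta>\<close>, and the gap
    bound \<open>c - \<beta> > 0\<close> forces \<open>\<zeta> = 0\<close>.\<close>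
  have "\<zeta> = 0"
  proof -
    have "norm (B x - Pz (B x)) \<le> \<beta> * norm x" for x
    proof -
      have "norm (P (- {- c..c}) (B x)) \<le> norm (B x)" by (rule norm_P) simp
      then show ?thesis using B_bound[of x] by (simp add: P_Compl)
    qed
    then have 1: "(c - \<beta>) * norm \<zeta> \<le> norm (A \<zeta> - (B \<zeta> - Pz (B \<zeta>)))"
      by (rule gap_lower_bound) (use \<zeta> in auto)
    have "Pz (A \<zeta>) = 0" using P_A[of "{- c..c}" \<zeta>] \<zeta> by simp
    then have "Pz (A \<zeta> - B \<zeta>) = - Pz (B \<zeta>)" by (simp add: blinfun.diff_right)
    moreover have "Pz (A \<zeta> - B \<zeta>) = A \<zeta> - B \<zeta>" using Pz_g[OF u(1)] \<zeta>(2) by simp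
    ultimately have e: "A \<zeta> - B \<zeta> = - Pz (B \<zeta>)" by (rule trans[OF sym, rotated])
    have "(A \<zeta> - B \<zeta>) + Pz (B \<zeta>) = 0" unfolding e by simp
    then have "A \<zeta> - (B \<zeta> - Pz (B \<zeta>)) = 0" by (simp add: diff_diff_eq2 diff_add_eq)
    then show ?thesis using 1 \<beta> by (simp add: mult_le_0_iff)
  qed
  then have "g u = 0" using \<zeta>(2) by (simp add: blinfun.zero_right)
  then have eq: "A (z u) = \<tau> u *\<^sub>R N (z u) + (1 - \<tau> u) *\<^sub>R B (z u)" by (simp add: g_def M_def)
  \<comment> \<open>The a priori bound places \<open>u\<close> inside the radius where the cut-off
    is 1, so the solution belongs to the original equation.\<close>
  have "norm (z u) < r" using apriori[OF zD[OF u(1)] \<tau> eq] .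
  then have "norm u < r" using norm_P[of "{- c..c}" "z u"] Pz_z[OF u(1)] by simp
  then have "\<tau> u = 1" using r by (simp add: \<tau>_def field_simps)
  then have "A (z u) = N (z u)" using eq by simp
  then show ?thesis using zD[OF u(1)] by blast
qed

end

text \<open>Positive definiteness is only a strict pointwise inequality; the uniform margin comes
  from the shift \<delta> in the definition. The resulting bound on the form is a bound on the norm
  by \<open>form_norm_le\<close>.\<close>

lemma Ls_norm_bound:
  assumes B: "B \<in> Ls b" and b: "b > 0"
  obtains \<beta> where "0 \<le> \<beta>" "\<beta> < b" "\<And>x. norm (B x) \<le> \<beta> * norm x"
proof -
  have sym: "B x \<bullet> y = x \<bullet> B y" for x y using B by (simp add: Ls_def bounded_self_adjoint_def)
  obtain d1 d2 where d: "d1 > 0" "d2 > 0" "positive_definite ((b - d1) *\<^sub>R id_blinfun - B)"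
    "positive_definite (B - (- b + d2) *\<^sub>R id_blinfun)"
    using B by (auto simp: Ls_def)
  define \<beta> where "\<beta> = max 0 (b - min d1 d2)"
  have form: "\<bar>B x \<bullet> x\<bar> \<le> \<beta> * (norm x)\<^sup>2" for x
  proof (cases "x = 0")
    case False
    have "B x \<bullet> x \<le> (b - d1) * (x \<bullet> x)" "(- b + d2) * (x \<bullet> x) \<le> B x \<bullet> x"
      using d(3,4) False unfolding positive_definite_def
      by (auto simp: blinfun.diff_left blinfun.scaleR_left inner_diff_left less_imp_le)
    moreover have "(b - d1) * (x \<bullet> x) \<le> \<beta> * (x \<bullet> x)" "(b - d2) * (x \<bullet> x) \<le> \<beta> * (x \<bullet> x)"
      by (auto intro!: mult_right_mono simp: \<beta>_def)
    moreover have "(- b + d2) * (x \<bullet> x) = - ((b - d2) * (x \<bullet> x))" by (simp add: algebra_simps)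
    ultimately have "B x \<bullet> x \<le> \<beta> * (x \<bullet> x)" "- (B x \<bullet> x) \<le> \<beta> * (x \<bullet> x)" by linarith+
    then show ?thesis by (simp add: power2_norm_eq_inner abs_le_iff)
  qed simp
  have "norm (B x) \<le> \<beta> * norm x" for x
    by (rule form_norm_le[of UNIV]) (use sym form in \<open>auto simp: blinfun.add_right blinfun.diff_right\<close>)
  moreover have "\<beta> < b" using d b by (auto simp: \<beta>_def)
  moreover have "0 \<le> \<beta>" by (simp add: \<beta>_def)
  ultimately show thesis using that by blast
qed

lemma nullity_0D:
  assumes "linear_operator D A" "nullity D A B = 0" "x \<in> D" "A x - B x = 0"
  shows "x = 0"
proof -
  let ?K = "{x\<in>D. A x - B x = 0}"
  have K: "subspace ?K" using assms(1)
    by (auto simp: linear_operator_def subspace_def blinfun.zero_right blinfun.add_right blinfun.scaleR_right)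
       (metis scaleR_zero_left)
  have "dim {0::'a} = 0" by (rule dim_zero_subspace)
  moreover have "finite_dim ?K" "dim ?K = 0"
    using assms(2) by (auto simp: nullity_def edim_def zero_enat_def split: if_splits)
  ultimately have "{0} = ?K" using subspace_0[OF K] by (intro finite_dim_eqI) auto
  then show ?thesis using assms(3,4) by blast
qed

theorem theorem3p5:
  fixes D :: "'a::{real_inner, complete_space} set"
    and A :: "'a \<Rightarrow> 'a"
    and F :: "'a \<Rightarrow> real"
    and F' :: "'a \<Rightarrow> 'a"
    and B\<^sub>1 B\<^sub>2 :: "'a \<Rightarrow>\<^sub>L 'a"
    and B :: "'a \<Rightarrow> 'a \<Rightarrow>\<^sub>L 'a"
    and b l\<^sub>F :: real
  assumes infinite_dim: "\<not> finite_dim (UNIV :: 'a set)"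
    and separable: "separable_space (euclidean :: 'a topology)"
    and b_pos: "b > 0"
    and A: "O0e b D A"
    and F_gradient: "\<And>z. GDERIV F z :> F' z"
    and F_C1: "continuous_on UNIV F'"
    and l_F: "l\<^sub>F < b"
    and F_Lipschitz: "\<And>z h. norm (F' (z + h) - F' z) \<le> l\<^sub>F * norm h"
    and B1: "B\<^sub>1 \<in> Ls b"
    and B2: "B\<^sub>2 \<in> Ls b"
    and Bz: "\<And>z. B z \<in> Ls b"
    and B1_le_B2: "op_le B\<^sub>1 B\<^sub>2"
    and index_eq: "relative_morse_index D A B\<^sub>1 = relative_morse_index D A B\<^sub>2"
    and nullity_B2: "nullity D A B\<^sub>2 = 0"
    and B1_le_B: "\<And>z. op_le B\<^sub>1 (B z)"
    and B_le_B2: "\<And>z. op_le (B z) B\<^sub>2"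
    and asymptotic: "(\<lambda>z. norm (F' z - B z z)) \<in> o[at_infinity](\<lambda>z. norm z)"
  shows "\<exists>z\<in>D. A z = F' z"
proof -
  obtain \<beta>1 where \<beta>1: "0 \<le> \<beta>1" "\<beta>1 < b" "\<And>x. norm (B\<^sub>1 x) \<le> \<beta>1 * norm x" using Ls_norm_bound[OF B1 b_pos] by blast
  obtain \<beta>2 where \<beta>2: "0 \<le> \<beta>2" "\<beta>2 < b" "\<And>x. norm (B\<^sub>2 x) \<le> \<beta>2 * norm x" using Ls_norm_bound[OF B2 b_pos] by blast
  \<comment> \<open>One constant dominates the Lipschitz constant and both operator norms; it serves
    the spectral estimates and the contraction. The midpoint \<open>c\<close> leaves room on both
    sides: \<open>c < b\<close> for finite rank, \<open>\<beta> < c\<close> for the gap.\<close>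
  define \<beta> where "\<beta> = max l\<^sub>F (max \<beta>1 \<beta>2)"
  define c where "c = (\<beta> + b) / 2"
  have \<beta>: "0 \<le> \<beta>" "\<beta> < c" "c < b" using \<beta>1 \<beta>2 l_F by (auto simp: \<beta>_def c_def)
  have \<beta>_ge: "l\<^sub>F \<le> \<beta>" "\<beta>1 \<le> \<beta>" "\<beta>2 \<le> \<beta>" by (auto simp: \<beta>_def)
  have scale: "k * norm x \<le> \<beta> * norm x" if "k \<le> \<beta>" for k and x :: 'a using that by (rule mult_right_mono) simp
  have sa: "self_adjoint D A" using A by (simp add: O0e_def)
  interpret A: self_adjoint_operator D A by unfold_locales (rule sa)
  have kernel: "x = 0" if "x \<in> D" "A x - B\<^sub>2 x = 0" for x
    using nullity_0D[OF _ nullity_B2 that] sa by (simp add: self_adjoint_def)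
  interpret two_perturbations D A B\<^sub>1 B\<^sub>2 \<beta> c
  proof
    show "bounded_self_adjoint B\<^sub>1" "bounded_self_adjoint B\<^sub>2" using B1 B2 by (auto simp: Ls_def)
    show "norm (B\<^sub>1 x) \<le> \<beta> * norm x" for x by (rule order_trans[OF \<beta>1(3) scale[OF \<beta>_ge(2)]])
    show "norm (B\<^sub>2 x) \<le> \<beta> * norm x" for x by (rule order_trans[OF \<beta>2(3) scale[OF \<beta>_ge(3)]])
    show "finite_dim (range (spectral_projection D A {- c..c}))" by (rule A.finite_rank_compact[OF A \<beta>(3)])
  qed (use \<beta> B1_le_B2 index_eq kernel in auto)
  obtain \<kappa> where \<kappa>: "\<kappa> > 0" "\<And>C z. bounded_self_adjoint C \<Longrightarrow> op_le B\<^sub>1 C \<Longrightarrow> op_le C B\<^sub>2 \<Longrightarrow> z \<in> D \<Longrightarrow>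
      \<kappa> * norm z \<le> norm (A z - C z)"
    using coercive by blast
  \<comment> \<open>Half of the coercivity constant, so that a large solution contradicts coercivity
    strictly.\<close>
  have "\<forall>\<^sub>F z in at_infinity. norm (norm (F' z - B z z)) \<le> \<kappa> / 2 * norm (norm z)"
    using landau_o.smallD[OF asymptotic, of "\<kappa> / 2"] \<kappa>(1) by simp
  then obtain r0 where r0: "\<And>z. r0 \<le> norm z \<Longrightarrow> norm (F' z - B z z) \<le> \<kappa> / 2 * norm z"
    by (auto simp: eventually_at_infinity)
  define r where "r = max r0 1"
  show ?thesis
  proof (rule B2.solution_by_homotopy)
    show "\<kappa> > 0" by (rule \<kappa>(1))
    show "\<kappa> * norm x \<le> norm (A x - B\<^sub>2 x)" if "x \<in> D" for x
      using that B1_le_B2 B2.B_self_adjoint by (intro \<kappa>(2)) (auto simp: op_le_def)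
    show "norm (F' x - F' y) \<le> \<beta> * norm (x - y)" for x y
      using order_trans[OF F_Lipschitz[of y "x - y"] scale[OF \<beta>_ge(1)]] by simp
    show "r > 0" by (simp add: r_def)
    fix z t assume z: "z \<in> D" and t: "0 \<le> t" "t \<le> 1" and eq: "A z = t *\<^sub>R F' z + (1 - t) *\<^sub>R B\<^sub>2 z"
    \<comment> \<open>With the operator frozen at the solution \<open>z\<close>, the homotopy
      equation reads \<open>(A - C) z = t (F' z - B z z)\<close>. As a convex combination of
      \<open>B z\<close> and \<open>B\<^sub>2\<close>, the operator \<open>C\<close> stays between
      \<open>B\<^sub>1\<close> and \<open>B\<^sub>2\<close>, so coercivity applies although
      \<open>B\<close> depends on \<open>z\<close>.\<close>
    define C where "C = t *\<^sub>R B z + (1 - t) *\<^sub>R B\<^sub>2"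
    have C: "C x = t *\<^sub>R B z x + (1 - t) *\<^sub>R B\<^sub>2 x" for x by (simp add: C_def blinfun.add_left blinfun.scaleR_left)
    have "\<kappa> * norm z \<le> norm (A z - C z)"
    proof (rule \<kappa>(2)[OF _ _ _ z])
      show "bounded_self_adjoint C"
        using Bz[of z] B2 by (simp add: Ls_def bounded_self_adjoint_def C inner_add)
      have le: "B\<^sub>1 x \<bullet> x \<le> B z x \<bullet> x" "B z x \<bullet> x \<le> B\<^sub>2 x \<bullet> x" for x
        using B1_le_B[of z] B_le_B2[of z] by (auto simp: op_le_def)
      show "op_le B\<^sub>1 C" unfolding op_le_def
      proof
        fix x
        have "B\<^sub>1 x \<bullet> x = t * (B\<^sub>1 x \<bullet> x) + (1 - t) * (B\<^sub>1 x \<bullet> x)" by (simp add: algebra_simps)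
        also have "\<dots> \<le> t * (B z x \<bullet> x) + (1 - t) * (B\<^sub>2 x \<bullet> x)"
          using le[of x] t by (intro add_mono mult_left_mono) auto
        finally show "B\<^sub>1 x \<bullet> x \<le> C x \<bullet> x" by (simp add: C inner_add_left)
      qed
      show "op_le C B\<^sub>2" unfolding op_le_def
      proof
        fix x
        have "t * (B z x \<bullet> x) + (1 - t) * (B\<^sub>2 x \<bullet> x) \<le> t * (B\<^sub>2 x \<bullet> x) + (1 - t) * (B\<^sub>2 x \<bullet> x)"
          using le[of x] t by (intro add_mono mult_left_mono) auto
        then show "C x \<bullet> x \<le> B\<^sub>2 x \<bullet> x" by (simp add: C inner_add_left algebra_simps)
      qed
    qed
    also have "A z - C z = t *\<^sub>R (F' z - B z z)" by (simp add: eq C algebra_simps)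
    also have "norm \<dots> \<le> norm (F' z - B z z)" using t mult_right_mono[OF t(2) norm_ge_zero[of "F' z - B z z"]] by simp
    finally have 1: "\<kappa> * norm z \<le> norm (F' z - B z z)" .
    show "norm z < r"
    proof (rule ccontr)
      assume "\<not> norm z < r"
      then have z1: "r0 \<le> norm z" "norm z > 0" by (auto simp: r_def)
      then have "\<kappa> * norm z \<le> \<kappa> / 2 * norm z" using 1 r0[OF z1(1)] by linarith
      then show False using \<kappa>(1) z1(2) by simp
    qed
  qed
qed

end
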